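(* Let $B := \{ x \in \mathbb{R}^N : |x| < 1\}$ be the unit ball, let $p > 1$ and let $a: [0,1] \to \mathbb{R}$ be a sign-changing continuous function, having finitely many zeros in $]0,1[$ and such that $a(0) < 0$ and $a(1) < 0$. Let $m$ be the number of disjoint subintervals of $[0,1]$ in which $a$ is non-negative (that is, the number of maximal non-degenerate subintervals of $[0,1]$ on which $a \ge 0$). Then there exists $\mu^*>0$ such that, for every $\mu > \mu^*$, the boundary blow-up problem $$ \begin{cases} \Delta u + \bigl(a^+(|x|) - \mu a^-(|x|)\bigr)u^p = 0, & x \in B,\\ u(x) \to +\infty, & x \to \partial B, \end{cases} $$ has at least $2^m$ distinct positive radial solutions.
   Context: $N$ is a positive integer (the space dimension). $a^+ = \max(a,0)$ and $a^-=\max(-a,0)$ denote the positive and negative parts of $a$, so $a = a^+ - a^-$. A radial solution is a classical one, i.e. $u(x)=u(r)$ with $r=|x|$, where $u$ solves $(r^{N-1}u')' + r^{N-1}(a^+(r)-\mu a^-(r))u^p = 0$ for $0<r<1$, with $u'(0)=0$ and $\lim_{r\to 1^-}u(r)=+\infty$. Positive means $u>0$ in $B$. *)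

theory Defs
  imports "HOL-Analysis.Analysis"
begin

text \<open>The space $\mathbb{R}^N$ is the type \<open>real ^ 'n\<close>, so that $N$ is \<open>CARD('n)\<close>; functions
  on $[0,1]$, $[0,1)$ or the open unit ball are total functions of which only the values on
  these sets matter.\<close>

definition partial_deriv :: "'n::finite \<Rightarrow> (real ^ 'n \<Rightarrow> real) \<Rightarrow> real ^ 'n \<Rightarrow> real" where
  "partial_deriv i f x = deriv (\<lambda>t. f (x + t *\<^sub>R axis i 1)) 0"

definition laplacian :: "(real ^ 'n::finite \<Rightarrow> real) \<Rightarrow> real ^ 'n \<Rightarrow> real" where
  "laplacian f x = (\<Sum>i\<in>UNIV. partial_deriv i (partial_deriv i f) x)"

text \<open>Meant for open \<open>S\<close>: there is a gradient field \<open>g\<close> with a continuous Jacobian \<open>H\<close>.\<close>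

definition C2_on :: "(real ^ 'n::finite) set \<Rightarrow> (real ^ 'n \<Rightarrow> real) \<Rightarrow> bool" where
  "C2_on S f \<longleftrightarrow> (\<exists>(g :: real ^ 'n \<Rightarrow> real ^ 'n) (H :: real ^ 'n \<Rightarrow> real ^ 'n ^ 'n).
     (\<forall>x\<in>S. (f has_derivative (\<lambda>h. g x \<bullet> h)) (at x)) \<and>
     (\<forall>x\<in>S. (g has_derivative (\<lambda>h. H x *v h)) (at x)) \<and>
     continuous_on S H)"

definition weight :: "(real \<Rightarrow> real) \<Rightarrow> real \<Rightarrow> real \<Rightarrow> real" where
  "weight a \<mu> r = max (a r) 0 - \<mu> * max (- a r) 0"

text \<open>The filter \<open>filtercomap norm (at_left 1)\<close> expresses $|x| \to 1^-$, that is, $x \in B$ and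
  $x \to \partial B$.\<close>

definition boundary_blowup_solution ::
    "(real \<Rightarrow> real) \<Rightarrow> real \<Rightarrow> real \<Rightarrow> (real ^ 'n::finite \<Rightarrow> real) \<Rightarrow> bool" where
  "boundary_blowup_solution a p \<mu> u \<longleftrightarrow>
     C2_on (ball 0 1) u \<and>
     (\<forall>x\<in>ball 0 1. laplacian u x + weight a \<mu> (norm x) * u x powr p = 0) \<and>
     filterlim u at_top (filtercomap norm (at_left 1))"

definition radial_profile ::
    "nat \<Rightarrow> (real \<Rightarrow> real) \<Rightarrow> real \<Rightarrow> real \<Rightarrow> (real \<Rightarrow> real) \<Rightarrow> bool" where
  "radial_profile N a p \<mu> v \<longleftrightarrow> (\<exists>v'.
     (\<forall>r\<in>{0..<1}. (v has_real_derivative v' r) (at r within {0..<1})) \<and>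
     (\<forall>r\<in>{0<..<1}. \<exists>d. ((\<lambda>s. s ^ (N - 1) * v' s) has_real_derivative d) (at r) \<and>
        d + r ^ (N - 1) * weight a \<mu> r * v r powr p = 0) \<and>
     v' 0 = 0 \<and>
     filterlim v at_top (at_left 1))"

text \<open>The requirements on \<open>u\<close> and on its profile \<open>v\<close> are two descriptions of the same classical
  radial solution, in $B$ and in the radial variable; both are imposed. Since \<open>u\<close> is positive,
  \<open>powr\<close> is the usual real power.\<close>

definition positive_radial_solution ::
    "(real \<Rightarrow> real) \<Rightarrow> real \<Rightarrow> real \<Rightarrow> (real ^ 'n::finite \<Rightarrow> real) \<Rightarrow> bool" where
  "positive_radial_solution a p \<mu> u \<longleftrightarrow>
     boundary_blowup_solution a p \<mu> u \<and>
     (\<forall>x\<in>ball 0 1. u x > 0) \<and>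
     (\<exists>v. radial_profile CARD('n) a p \<mu> v \<and> (\<forall>x\<in>ball 0 1. u x = v (norm x)))"

definition nonneg_subinterval :: "(real \<Rightarrow> real) \<Rightarrow> real set \<Rightarrow> bool" where
  "nonneg_subinterval a I \<longleftrightarrow>
     is_interval I \<and> I \<subseteq> {0..1} \<and> (\<exists>x\<in>I. \<exists>y\<in>I. x < y) \<and> (\<forall>r\<in>I. a r \<ge> 0)"

definition max_nonneg_subintervals :: "(real \<Rightarrow> real) \<Rightarrow> real set set" where
  "max_nonneg_subintervals a =
     {I. nonneg_subinterval a I \<and> (\<forall>J. nonneg_subinterval a J \<and> I \<subseteq> J \<longrightarrow> J = I)}"

end

theory Submission
  imports Defs
begin

text \<open>Shooting from the origin. Let \<open>u\<^sub>c\<close> be the radial solution with \<open>u(0) = c\<close>, extended by the nonlinearity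
  \<open>max u 0 powr p\<close>: once a solution has vanished it stays nonpositive and exists on all of \<open>[0,1]\<close>.
  On a gap (an interval where \<open>a \<le> 0\<close>) a large \<open>\<mu>\<close> makes every solution that enters with a fixed height and a nonnegative
  slope blow up; on a bump (an interval where \<open>a \<ge> 0\<close>) solutions that stay positive are bounded
  independently of \<open>c\<close> and \<open>\<mu>\<close>, so that a solution entering with a large value vanishes. Consider an
  interval of parameters, joining one whose solution has vanished by the end of a gap to one whose
  solution blows up inside the gap. Moving towards the blow-up end, the slope at the
  end of the gap takes a small fixed value \<open>\<beta>\<close>, where the solution blows up inside the next gap, and
  later the solution vanishes in the next bump. The interval thus yields two disjoint intervals of the same kind for
  the next gap, and after \<open>m\<close> bumps there are \<open>2\<^sup>m\<close> of them; each contains a parameter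
  whose blow-up radius is exactly \<open>1\<close>.\<close>

section \<open>Radial integration and the Lipschitz initial value problem\<close>

text \<open>With \<open>n\<close> = N - 1 and \<open>q\<close> = minus the weight, the equation
  reads (r^n u')' = r^n q u^p, so gaps are where \<open>q\<close> \<ge> 0 and bumps where
  \<open>q\<close> \<le> 0. The flux r^n u' replaces the slope: it is regular at the origin and its
  monotonicity depends on the sign of \<open>q\<close> alone.

  Each search takes the first parameter, coming from the vanishing end, whose solution fails to
  reach the end of the gap: before it, value and flux at that end are continuous in the parameter.

  The delicate point is the solution whose flux at the end of a gap is the small \<beta>, since its
  value there might be large. If the value exceeded \<beta>, then for large \<mu> the flux, followed
  backwards through the gap, would become very negative. The solution would have entered the gap
  higher than the bound on the previous bump permits or, in the first gap, would contradict the zero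
  flux at the origin. So the value is at most \<beta>, and by superlinearity at least half of the
  flux survives the next bump.\<close>

definition flux :: "nat \<Rightarrow> (real \<Rightarrow> real) \<Rightarrow> real \<Rightarrow> real" where
  "flux n g s = integral {0..s} (\<lambda>t. t ^ n * g t)"

text \<open>At \<open>s = 0\<close> the quotient is \<open>0 / 0 ^ n = 0\<close>, the correct value of the derivative there.\<close>

definition radial_inv :: "nat \<Rightarrow> (real \<Rightarrow> real) \<Rightarrow> real \<Rightarrow> real" where
  "radial_inv n g r = integral {0..r} (\<lambda>s. flux n g s / s ^ n)"

lemma flux_0 [simp]: "flux n g 0 = 0"
  by (simp add: flux_def)

lemma radial_inv_0 [simp]: "radial_inv n g 0 = 0"
  by (simp add: radial_inv_def)

lemma flux_cong:
  assumes "\<And>t. t \<in> {0..s} \<Longrightarrow> g t = h t"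
  shows "flux n g s = flux n h s"
  unfolding flux_def by (rule Henstock_Kurzweil_Integration.integral_cong) (use assms in auto)

lemma radial_inv_cong:
  assumes "\<And>t. t \<in> {0..r} \<Longrightarrow> g t = h t"
  shows "radial_inv n g r = radial_inv n h r"
  unfolding radial_inv_def
  by (rule Henstock_Kurzweil_Integration.integral_cong) (use assms flux_cong[of _ g h n] in force)

lemma flux_has_derivative:
  assumes "continuous_on {0..R} g" "r \<in> {0..R}"
  shows "(flux n g has_real_derivative r ^ n * g r) (at r within {0..R})"
  unfolding flux_def [abs_def]
  by (rule integral_has_real_derivative) (use assms in \<open>auto intro!: continuous_intros\<close>)

text \<open>Since t^n / s^n \<le> 1 on [0, s], the division by s^n costs nothing, even as s tends to
  0; all later estimates are uniform at the singular origin for this reason.\<close>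

lemma flux_diff_le:
  assumes g: "continuous_on {0..s} g" and h: "continuous_on {0..s} h" and k: "k integrable_on {0..s}"
    and le: "\<And>t. t \<in> {0..s} \<Longrightarrow> \<bar>g t - h t\<bar> \<le> k t" and s: "0 \<le> s"
  shows "\<bar>flux n g s / s ^ n - flux n h s / s ^ n\<bar> \<le> integral {0..s} k"
proof (cases "s = 0")
  case True then show ?thesis by simp
next
  case False
  with s have s: "0 < s" by simp
  have ig: "(\<lambda>t. t ^ n * g t) integrable_on {0..s}" and ih: "(\<lambda>t. t ^ n * h t) integrable_on {0..s}"
    using g h by (auto intro!: integrable_continuous_real continuous_intros)
  have "norm (integral {0..s} (\<lambda>t. t ^ n * g t - t ^ n * h t)) \<le> integral {0..s} (\<lambda>t. s ^ n * k t)"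
  proof (rule integral_norm_bound_integral)
    show "(\<lambda>t. t ^ n * g t - t ^ n * h t) integrable_on {0..s}"
      using ig ih by (rule integrable_diff)
    show "(\<lambda>t. s ^ n * k t) integrable_on {0..s}" using k by (rule integrable_on_mult_right)
    fix t assume t: "t \<in> {0..s}"
    have "norm (t ^ n * g t - t ^ n * h t) = t ^ n * \<bar>g t - h t\<bar>"
      using t by (simp add: abs_mult flip: right_diff_distrib)
    also have "\<dots> \<le> s ^ n * k t"
      by (intro mult_mono power_mono le) (use t s in auto)
    finally show "norm (t ^ n * g t - t ^ n * h t) \<le> s ^ n * k t" .
  qed
  then have "\<bar>flux n g s - flux n h s\<bar> \<le> s ^ n * integral {0..s} k"
    unfolding flux_def using integral_diff[OF ig ih] by simp
  then show ?thesis
    using s by (simp add: field_simps flip: diff_divide_distrib)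
qed

lemma flux_quotient_le:
  assumes g: "continuous_on {0..s} g" and le: "\<And>t. t \<in> {0..s} \<Longrightarrow> \<bar>g t\<bar> \<le> B" and s: "0 \<le> s"
  shows "\<bar>flux n g s / s ^ n\<bar> \<le> B * s"
proof -
  have "\<bar>flux n g s / s ^ n - flux n (\<lambda>_. 0) s / s ^ n\<bar> \<le> integral {0..s} (\<lambda>_. B)"
    by (rule flux_diff_le) (use assms in auto)
  then show ?thesis using s by (simp add: flux_def mult.commute)
qed

text \<open>Only the origin is critical: there the quotient is squeezed by B s, and its value by
  convention is 0.\<close>

lemma continuous_on_flux_quotient:
  assumes g: "continuous_on {0..R} g"
  shows "continuous_on {0..R} (\<lambda>s. flux n g s / s ^ n)"
proof (cases "0 \<le> R")
  case False then show ?thesis by simp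
next
  case R: True
  show ?thesis
    unfolding continuous_on_eq_continuous_within
  proof
    fix r assume r: "r \<in> {0..R}"
    have fl: "continuous_on {0..R} (flux n g)"
      by (rule DERIV_continuous_on[OF flux_has_derivative[OF g]])
    show "continuous (at r within {0..R}) (\<lambda>s. flux n g s / s ^ n)"
    proof (cases "r = 0")
      case False
      then show ?thesis
        using fl r unfolding continuous_on_eq_continuous_within continuous_within
        by (auto intro!: tendsto_intros)
    next
      case True
      have "bounded (g ` {0..R})"
        by (rule compact_imp_bounded[OF compact_continuous_image[OF g compact_Icc]])
      then obtain B where "\<forall>y\<in>g ` {0..R}. norm y \<le> B" unfolding bounded_iff by blast
      then have B: "\<bar>g t\<bar> \<le> B" if "t \<in> {0..R}" for t using that by simp
      have ev: "eventually (\<lambda>s. norm (flux n g s / s ^ n) \<le> B * s) (at 0 within {0..R})"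
        unfolding eventually_at_filter
        by (rule always_eventually)
          (auto intro!: flux_quotient_le continuous_on_subset[OF g] B simp del: abs_divide)
      have "((\<lambda>s. B * s) \<longlongrightarrow> 0) (at 0 within {0..R})"
        by (auto intro!: tendsto_eq_intros)
      from Lim_null_comparison[OF ev this]
      show ?thesis using True by (simp add: continuous_within)
    qed
  qed
qed

lemma radial_inv_has_derivative:
  assumes "continuous_on {0..R} g" "r \<in> {0..R}"
  shows "(radial_inv n g has_real_derivative flux n g r / r ^ n) (at r within {0..R})"
  unfolding radial_inv_def [abs_def]
  by (rule integral_has_real_derivative[OF continuous_on_flux_quotient[OF assms(1)] assms(2)])

lemma continuous_on_radial_inv:
  assumes "continuous_on {0..R} g"
  shows "continuous_on {0..R} (radial_inv n g)"
  by (rule DERIV_continuous_on[OF radial_inv_has_derivative[OF assms]])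

lemma integral_exp_le:
  fixes l :: real
  assumes "1 \<le> l" "0 \<le> s" "0 \<le> B"
  shows "(\<lambda>t. B * exp (l * t)) integrable_on {0..s}" "integral {0..s} (\<lambda>t. B * exp (l * t)) \<le> B / l * exp (l * s)"
proof -
  have "((\<lambda>t. B * exp (l * t)) has_integral (B / l * exp (l * s) - B / l * exp (l * 0))) {0..s}"
    by (rule fundamental_theorem_of_calculus)
      (use assms in \<open>auto intro!: derivative_eq_intros simp: has_real_derivative_iff_has_vector_derivative [symmetric]\<close>)
  from has_integral_integrable[OF this] integral_unique[OF this]
  show "(\<lambda>t. B * exp (l * t)) integrable_on {0..s}"
    "integral {0..s} (\<lambda>t. B * exp (l * t)) \<le> B / l * exp (l * s)"
    using assms by simp_all
qed

text \<open>Each of the two integrations of exp (l t) yields a factor 1 / l. The first is discarded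
  using 1 \<le> \<open>l\<close>; the second is the gain that makes the solution operator a
  contraction in an exponentially weighted norm.\<close>

lemma radial_inv_diff_le_exp:
  assumes g: "continuous_on {0..R} g" and h: "continuous_on {0..R} h" and l: "1 \<le> l" and B: "0 \<le> B"
    and le: "\<And>t. t \<in> {0..R} \<Longrightarrow> \<bar>g t - h t\<bar> \<le> B * exp (l * t)" and r: "r \<in> {0..R}"
  shows "\<bar>radial_inv n g r - radial_inv n h r\<bar> \<le> B / l * exp (l * r)"
proof -
  have sub: "{0..s} \<subseteq> {0..R}" if "s \<le> r" for s using r that by auto
  have gi: "(\<lambda>s. flux n g s / s ^ n) integrable_on {0..r}" and hi: "(\<lambda>s. flux n h s / s ^ n) integrable_on {0..r}"
    using sub[of r] by (auto intro!: integrable_continuous_real continuous_on_flux_quotient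
        intro: continuous_on_subset[OF g] continuous_on_subset[OF h])
  have "norm (integral {0..r} (\<lambda>s. flux n g s / s ^ n - flux n h s / s ^ n)) \<le> integral {0..r} (\<lambda>s. B * exp (l * s))"
  proof (rule integral_norm_bound_integral)
    show "(\<lambda>s. flux n g s / s ^ n - flux n h s / s ^ n) integrable_on {0..r}"
      by (rule integrable_diff[OF gi hi])
    show "(\<lambda>s. B * exp (l * s)) integrable_on {0..r}" using r l B by (intro integral_exp_le) auto
    fix s assume s: "s \<in> {0..r}"
    have "\<bar>flux n g s / s ^ n - flux n h s / s ^ n\<bar> \<le> integral {0..s} (\<lambda>t. B * exp (l * t))"
      using s r l B by (intro flux_diff_le continuous_on_subset[OF g sub] continuous_on_subset[OF h sub] integral_exp_le le) auto
    also have "\<dots> \<le> B / l * exp (l * s)" using s l B by (intro integral_exp_le) auto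
    also have "\<dots> \<le> B * exp (l * s)" using l B mult_left_mono[of 1 l B] by (intro mult_right_mono) (auto simp: field_simps)
    finally show "norm (flux n g s / s ^ n - flux n h s / s ^ n) \<le> B * exp (l * s)" by simp
  qed
  also have "\<dots> \<le> B / l * exp (l * r)" using r l B by (intro integral_exp_le) auto
  finally show ?thesis unfolding radial_inv_def using integral_diff[OF gi hi] by simp
qed

section \<open>The integral equation with a Lipschitz nonlinearity\<close>

definition ivp_solution ::
    "nat \<Rightarrow> (real \<Rightarrow> real) \<Rightarrow> (real \<Rightarrow> real) \<Rightarrow> real \<Rightarrow> real \<Rightarrow> (real \<Rightarrow> real) \<Rightarrow> bool" where
  "ivp_solution n q f c R u \<longleftrightarrow>
     continuous_on {0..R} u \<and> (\<forall>r\<in>{0..R}. u r = c + radial_inv n (\<lambda>t. q t * f (u t)) r)"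

lemma ivp_solution_continuous: "ivp_solution n q f c R u \<Longrightarrow> continuous_on {0..R} u"
  unfolding ivp_solution_def by (rule conjunct1)

lemma ivp_solution_eq:
  "ivp_solution n q f c R u \<Longrightarrow> r \<in> {0..R} \<Longrightarrow> u r = c + radial_inv n (\<lambda>t. q t * f (u t)) r"
  unfolding ivp_solution_def by (drule conjunct2) (drule bspec, assumption+)

lemma ivp_solution_subset:
  assumes "ivp_solution n q f c R u" "r \<le> R"
  shows "ivp_solution n q f c r u"
  unfolding ivp_solution_def
proof (intro conjI ballI)
  show "continuous_on {0..r} u"
    by (rule continuous_on_subset[OF ivp_solution_continuous[OF assms(1)]]) (use assms(2) in auto)
  show "u s = c + radial_inv n (\<lambda>t. q t * f (u t)) s" if "s \<in> {0..r}" for s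
    by (rule ivp_solution_eq[OF assms(1)]) (use that assms(2) in auto)
qed

lemma ivp_solution_cong:
  assumes u: "ivp_solution n q f c R u" and v: "\<And>r. r \<in> {0..R} \<Longrightarrow> v r = u r"
    and g: "\<And>r. r \<in> {0..R} \<Longrightarrow> g (u r) = f (u r)"
  shows "ivp_solution n q g c R v"
  unfolding ivp_solution_def
proof (intro conjI ballI)
  show "continuous_on {0..R} v"
    by (rule continuous_on_eq[OF ivp_solution_continuous[OF u]]) (simp add: v)
  fix r assume r: "r \<in> {0..R}"
  have "radial_inv n (\<lambda>t. q t * g (v t)) r = radial_inv n (\<lambda>t. q t * f (u t)) r"
    by (rule radial_inv_cong) (use r v g in auto)
  then show "v r = c + radial_inv n (\<lambda>t. q t * g (v t)) r"
    by (simp only: v[OF r] ivp_solution_eq[OF u r, symmetric])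
qed

text \<open>\<open>l\<close> is the exponent of a weighted supremum norm. The condition on 2 Q L
  gives the integral operator the contraction factor 1/2 on all of [0, 1] at once, so no
  continuation argument is needed.\<close>

locale lipschitz_ivp =
  fixes q f :: "real \<Rightarrow> real" and Q L l :: real
  assumes q: "continuous_on {0..1} q" and q_le: "\<And>t. t \<in> {0..1} \<Longrightarrow> \<bar>q t\<bar> \<le> Q"
    and f_lip: "\<And>x y. \<bar>f x - f y\<bar> \<le> L * \<bar>x - y\<bar>" and l: "1 \<le> l" "2 * (Q * L) \<le> l"
begin

lemma Q_nonneg: "0 \<le> Q" using q_le[of 0] by auto

lemma L_nonneg: "0 \<le> L" using f_lip[of 0 1] by auto

lemma f_continuous: "continuous_on S f"
proof -
  have "L-lipschitz_on S f" by (rule lipschitz_onI) (use f_lip L_nonneg in \<open>auto simp: dist_real_def\<close>)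
  then show ?thesis by (rule lipschitz_on_continuous_on)
qed

lemma f_continuous_comp: "continuous_on S u \<Longrightarrow> continuous_on S (\<lambda>t. f (u t))"
  using continuous_on_compose2[OF f_continuous[of UNIV]] by auto

lemma radial_inv_diff:
  assumes u: "continuous_on {0..R} u" and v: "continuous_on {0..R} v" and R: "R \<le> 1" and D: "0 \<le> D"
    and le: "\<And>t. t \<in> {0..R} \<Longrightarrow> \<bar>u t - v t\<bar> \<le> D * exp (l * t)" and r: "r \<in> {0..R}"
  shows "\<bar>radial_inv n (\<lambda>t. q t * f (u t)) r - radial_inv n (\<lambda>t. q t * f (v t)) r\<bar> \<le> D / 2 * exp (l * r)"
proof -
  have qR: "continuous_on {0..R} q" by (rule continuous_on_subset[OF q]) (use R in auto)
  have "\<bar>radial_inv n (\<lambda>t. q t * f (u t)) r - radial_inv n (\<lambda>t. q t * f (v t)) r\<bar> \<le> Q * L * D / l * exp (l * r)"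
  proof (rule radial_inv_diff_le_exp[OF _ _ l(1) _ _ r])
    show "continuous_on {0..R} (\<lambda>t. q t * f (u t))" "continuous_on {0..R} (\<lambda>t. q t * f (v t))"
      by (intro continuous_intros qR f_continuous_comp u v)+
    show "0 \<le> Q * L * D" using Q_nonneg L_nonneg D by auto
    fix t assume t: "t \<in> {0..R}"
    have "\<bar>q t * f (u t) - q t * f (v t)\<bar> = \<bar>q t\<bar> * \<bar>f (u t) - f (v t)\<bar>"
      by (simp add: abs_mult flip: right_diff_distrib)
    also have "\<dots> \<le> Q * (L * (D * exp (l * t)))"
      using t R by (intro mult_mono q_le order.trans[OF f_lip] mult_left_mono le L_nonneg Q_nonneg) auto
    finally show "\<bar>q t * f (u t) - q t * f (v t)\<bar> \<le> Q * L * D * exp (l * t)" by (simp add: algebra_simps)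
  qed
  also have "Q * L * D / l * exp (l * r) \<le> D / 2 * exp (l * r)"
    using l D mult_right_mono[OF l(2) D] by (intro mult_right_mono) (auto simp: field_simps)
  finally show ?thesis .
qed

text \<open>At a maximum point s of exp (- l t) |u - v| the integral terms contribute at most half
  of |u s - v s|, which is absorbed on the left. This plays the role of Gronwall's
  inequality.\<close>

lemma solution_dependence:
  assumes u: "ivp_solution n q f c R u" and v: "ivp_solution n q f d R v" and R: "R \<le> 1" and r: "r \<in> {0..R}"
  shows "\<bar>u r - v r\<bar> \<le> 2 * exp l * \<bar>c - d\<bar>"
proof -
  note cu = ivp_solution_continuous[OF u] and cv = ivp_solution_continuous[OF v]
  let ?e = "\<lambda>t. exp (- l * t) * \<bar>u t - v t\<bar>"
  have "continuous_on {0..R} ?e" by (intro continuous_intros cu cv)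
  from continuous_attains_sup[OF compact_Icc _ this]
  obtain s where s: "s \<in> {0..R}" and max: "\<And>t. t \<in> {0..R} \<Longrightarrow> ?e t \<le> ?e s" using r by auto
  have le: "\<bar>u t - v t\<bar> \<le> ?e s * exp (l * t)" if "t \<in> {0..R}" for t
    using mult_right_mono[OF max[OF that], of "exp (l * t)"] by (simp add: exp_minus field_simps)
  have "\<bar>radial_inv n (\<lambda>t. q t * f (u t)) s - radial_inv n (\<lambda>t. q t * f (v t)) s\<bar> \<le> ?e s / 2 * exp (l * s)"
    by (rule radial_inv_diff[OF cu cv R _ le s]) auto
  also have "?e s / 2 * exp (l * s) = \<bar>u s - v s\<bar> / 2" by (simp add: exp_minus field_simps)
  finally have "\<bar>radial_inv n (\<lambda>t. q t * f (u t)) s - radial_inv n (\<lambda>t. q t * f (v t)) s\<bar> \<le> \<bar>u s - v s\<bar> / 2" .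
  moreover have "\<bar>A - B\<bar> \<le> 2 * \<bar>c - d\<bar>" if "\<bar>x - y\<bar> \<le> \<bar>A - B\<bar> / 2" "A = c + x" "B = d + y" for A B x y
    using that abs_triangle_ineq[of "c - d" "x - y"] by (simp add: algebra_simps)
  ultimately have "\<bar>u s - v s\<bar> \<le> 2 * \<bar>c - d\<bar>"
    using ivp_solution_eq[OF u s] ivp_solution_eq[OF v s] by blast
  moreover have "?e s \<le> \<bar>u s - v s\<bar>" using s l by (intro mult_left_le_one_le) auto
  ultimately have "?e s \<le> 2 * \<bar>c - d\<bar>" by linarith
  then have "?e s * exp (l * r) \<le> 2 * \<bar>c - d\<bar> * exp (l * 1)"
    by (rule mult_mono) (use r R l in auto)
  with le[OF r] show ?thesis by (simp add: algebra_simps)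
qed

lemma solution_exists: "\<exists>u. ivp_solution n q f c 1 u"
proof -
  \<comment> \<open>The projection onto [0, 1] turns functions on the interval into bounded
    continuous functions on the line, a complete space in which Banach's theorem applies.\<close>
  define cl :: "real \<Rightarrow> real" where "cl r = max 0 (min 1 r)" for r
  have cl: "cl r \<in> {0..1}" for r by (auto simp: cl_def)
  have cl_id: "cl r = r" if "r \<in> {0..1}" for r using that by (auto simp: cl_def)
  have cl_cont: "continuous_on UNIV cl" unfolding cl_def by (intro continuous_intros)
  \<comment> \<open>Conjugation by exp (l r) turns the weighted norm into the plain supremum
    distance.\<close>
  define \<Psi> where "\<Psi> w r = exp (- l * r) * (c + radial_inv n (\<lambda>t. q t * f (exp (l * t) * w t)) r)"
    for w :: "real \<Rightarrow> real" and r
  have \<Psi>_cont: "continuous_on {0..1} (\<Psi> w)" if "continuous_on {0..1} w" for w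
    unfolding \<Psi>_def
    by (intro continuous_intros continuous_on_radial_inv q f_continuous_comp that)
  define \<Phi> :: "(real \<Rightarrow>\<^sub>C real) \<Rightarrow> (real \<Rightarrow>\<^sub>C real)" where
    "\<Phi> w = Bcontfun (\<lambda>r. \<Psi> (apply_bcontfun w) (cl r))" for w
  have cw: "continuous_on {0..1} (apply_bcontfun w)" for w :: "real \<Rightarrow>\<^sub>C real"
    using continuous_on_apply_bcontfun by (rule continuous_on_subset) auto
  have \<Phi>: "apply_bcontfun (\<Phi> w) r = \<Psi> (apply_bcontfun w) (cl r)" for w r
  proof -
    have "(\<lambda>r. \<Psi> (apply_bcontfun w) (cl r)) \<in> bcontfun"
      unfolding bcontfun_def mem_Collect_eq
    proof
      show "continuous_on UNIV (\<lambda>r. \<Psi> (apply_bcontfun w) (cl r))"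
        by (rule continuous_on_compose2[OF \<Psi>_cont[OF cw] cl_cont]) (use cl in auto)
      have "range (\<lambda>r. \<Psi> (apply_bcontfun w) (cl r)) \<subseteq> \<Psi> (apply_bcontfun w) ` {0..1}"
        using cl by auto
      then show "bounded (range (\<lambda>r. \<Psi> (apply_bcontfun w) (cl r)))"
        using bounded_subset compact_imp_bounded[OF compact_continuous_image[OF \<Psi>_cont[OF cw] compact_Icc]] by blast
    qed
    then show ?thesis by (simp add: \<Phi>_def Bcontfun_inverse)
  qed
  have "dist (\<Phi> w) (\<Phi> w') \<le> (1 / 2) * dist w w'" for w w'
  proof (rule dist_bound)
    fix r
    let ?s = "cl r"
    have "\<bar>radial_inv n (\<lambda>t. q t * f (exp (l * t) * w t)) ?s - radial_inv n (\<lambda>t. q t * f (exp (l * t) * w' t)) ?s\<bar>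
      \<le> dist w w' / 2 * exp (l * ?s)"
    proof (rule radial_inv_diff[OF _ _ order_refl _ _ cl])
      show "continuous_on {0..1} (\<lambda>t. exp (l * t) * w t)" "continuous_on {0..1} (\<lambda>t. exp (l * t) * w' t)"
        by (intro continuous_intros cw)+
      fix t :: real
      have "\<bar>exp (l * t) * w t - exp (l * t) * w' t\<bar> = exp (l * t) * dist (w t) (w' t)"
        by (simp add: dist_real_def abs_mult flip: right_diff_distrib)
      then show "\<bar>exp (l * t) * w t - exp (l * t) * w' t\<bar> \<le> dist w w' * exp (l * t)"
        using dist_bounded[of w t w'] by (simp add: mult.commute)
    qed auto
    then have "exp (- l * ?s) * \<bar>radial_inv n (\<lambda>t. q t * f (exp (l * t) * w t)) ?s - radial_inv n (\<lambda>t. q t * f (exp (l * t) * w' t)) ?s\<bar>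
      \<le> exp (- l * ?s) * (dist w w' / 2 * exp (l * ?s))" by (rule mult_left_mono) simp
    also have "\<dots> = 1 / 2 * dist w w'" by (simp add: exp_minus field_simps)
    finally show "dist (\<Phi> w r) (\<Phi> w' r) \<le> 1 / 2 * dist w w'"
      by (simp add: \<Phi> \<Psi>_def dist_real_def abs_mult flip: right_diff_distrib)
  qed
  then have "\<exists>!w. \<Phi> w = w"
    by (intro banach_fix_type[of "1/2"]) auto
  then obtain w where w: "\<Phi> w = w" by blast
  define u where "u r = exp (l * r) * w r" for r
  have "ivp_solution n q f c 1 u" unfolding ivp_solution_def
  proof (intro conjI ballI)
    show "continuous_on {0..1} u" unfolding u_def by (intro continuous_intros cw)
    fix r :: real assume r: "r \<in> {0..1}"
    have "w r = \<Psi> w r" using \<Phi>[of w r] w cl_id[OF r] by simp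
    then have "u r = exp (l * r) * \<Psi> w r" by (simp only: u_def)
    also have "\<dots> = c + radial_inv n (\<lambda>t. q t * f (u t)) r"
      by (simp add: u_def \<Psi>_def exp_minus field_simps)
    finally show "u r = c + radial_inv n (\<lambda>t. q t * f (u t)) r" .
  qed
  then show ?thesis by blast
qed

end

section \<open>The power nonlinearity\<close>

definition pos_powr :: "real \<Rightarrow> real \<Rightarrow> real" where
  "pos_powr p x = max x 0 powr p"

text \<open>A cut-off from above suffices for a global Lipschitz bound, because
  \<open>pos_powr\<close> is already constant below 0. Every solution with upper bound
  \<open>K\<close> also solves the truncated problem.\<close>

definition trunc_powr :: "real \<Rightarrow> real \<Rightarrow> real \<Rightarrow> real" where
  "trunc_powr p K x = pos_powr p (min x K)"

lemma pos_powr_nonneg [simp]: "0 \<le> pos_powr p x"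
  by (simp add: pos_powr_def)

lemma pos_powr_nonpos [simp]: "x \<le> 0 \<Longrightarrow> pos_powr p x = 0"
  by (simp add: pos_powr_def)

lemma pos_powr_pos: "0 < x \<Longrightarrow> pos_powr p x = x powr p"
  by (simp add: pos_powr_def)

lemma pos_powr_mono: "0 \<le> p \<Longrightarrow> x \<le> y \<Longrightarrow> pos_powr p x \<le> pos_powr p y"
  unfolding pos_powr_def by (intro powr_mono2) auto

lemma powr_diff_le:
  fixes p x y K :: real
  assumes p: "1 < p" and x: "0 \<le> x" "x \<le> y" "y \<le> K"
  shows "y powr p - x powr p \<le> p * K powr (p - 1) * (y - x)"
proof (cases "x = y")
  case False
  with x have xy: "x < y" by simp
  have "continuous_on {x..y} (\<lambda>t. t powr p)" using x p by (intro continuous_on_powr') auto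
  moreover have "((\<lambda>t. t powr p) has_derivative (*) (p * t powr (p - 1))) (at t)" if "x < t" "t < y" for t
    unfolding has_field_derivative_def[symmetric]
    by (rule has_real_derivative_powr) (use that x in auto)
  ultimately obtain t where t: "x < t" "t < y" "y powr p - x powr p = (*) (p * t powr (p - 1)) (y - x)"
    using mvt[OF xy, of "\<lambda>t. t powr p" "\<lambda>t. (*) (p * t powr (p - 1))"] by blast
  have "t powr (p - 1) \<le> K powr (p - 1)" using t x p by (intro powr_mono2) auto
  then show ?thesis using t x p by (auto intro!: mult_right_mono)
qed simp

lemma trunc_powr_lipschitz:
  assumes p: "1 < p" and K: "0 \<le> K"
  shows "\<bar>trunc_powr p K x - trunc_powr p K y\<bar> \<le> p * K powr (p - 1) * \<bar>x - y\<bar>"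
proof -
  have *: "\<bar>trunc_powr p K x - trunc_powr p K y\<bar> \<le> p * K powr (p - 1) * \<bar>x - y\<bar>" if "x \<le> y" for x y
  proof -
    let ?x = "max (min x K) 0" and ?y = "max (min y K) 0"
    have xy: "0 \<le> ?x" "?x \<le> ?y" "?y \<le> K" using that K by auto
    have "\<bar>trunc_powr p K x - trunc_powr p K y\<bar> = ?y powr p - ?x powr p"
      using powr_mono2[of p ?x ?y] xy p by (simp add: trunc_powr_def pos_powr_def)
    also have "\<dots> \<le> p * K powr (p - 1) * (?y - ?x)" by (rule powr_diff_le[OF p xy])
    also have "\<dots> \<le> p * K powr (p - 1) * \<bar>x - y\<bar>" using that p by (intro mult_left_mono) auto
    finally show ?thesis .
  qed
  show ?thesis using *[of x y] *[of y x] by (cases "x \<le> y") (auto simp: abs_minus_commute)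
qed

lemma trunc_powr_eq: "x \<le> K \<Longrightarrow> trunc_powr p K x = pos_powr p x"
  by (simp add: trunc_powr_def)

lemma continuous_on_pos_powr:
  assumes "0 < p" "continuous_on S u"
  shows "continuous_on S (\<lambda>t. pos_powr p (u t))"
  unfolding pos_powr_def
  by (intro continuous_on_powr' continuous_on_max assms continuous_on_const) (use assms in auto)

lemma continuous_on_Icc_bounded_above:
  fixes u :: "real \<Rightarrow> real"
  assumes "continuous_on {a..b} u"
  obtains K where "0 < K" "\<And>r. r \<in> {a..b} \<Longrightarrow> u r < K"
proof -
  have "bounded (u ` {a..b})"
    by (rule compact_imp_bounded[OF compact_continuous_image[OF assms compact_Icc]])
  then obtain B where "\<forall>y\<in>u ` {a..b}. norm y \<le> B" unfolding bounded_iff by blast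
  then have "\<bar>u r\<bar> \<le> B" if "r \<in> {a..b}" for r using that by simp
  then have "u r < max B 0 + 1" if "r \<in> {a..b}" for r using that by force
  from that[OF _ this] show thesis by auto
qed

lemma isCont_of_local_lipschitz:
  fixes f :: "real \<Rightarrow> real"
  assumes "0 < \<epsilon>" "\<And>d. \<bar>d - c\<bar> < \<epsilon> \<Longrightarrow> \<bar>f d - f c\<bar> \<le> C * \<bar>d - c\<bar>"
  shows "isCont f c"
  unfolding isCont_def
proof (rule Lim_null[THEN iffD2, OF Lim_null_comparison])
  show "\<forall>\<^sub>F d in at c. norm (f d - f c) \<le> C * \<bar>d - c\<bar>"
    unfolding eventually_at dist_real_def using assms by auto
  have "((\<lambda>d. C * \<bar>d - c\<bar>) \<longlongrightarrow> C * \<bar>c - c\<bar>) (at c)" by (intro tendsto_intros)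
  then show "((\<lambda>d. C * \<bar>d - c\<bar>) \<longlongrightarrow> 0) (at c)" by simp
qed

section \<open>Solutions of the power equation and their dependence on the initial value\<close>

locale power_ivp =
  fixes n :: nat and q :: "real \<Rightarrow> real" and p :: real
  assumes q: "continuous_on {0..1} q" and p: "1 < p"
begin

definition solvable :: "real \<Rightarrow> real \<Rightarrow> bool" where
  "solvable c R \<longleftrightarrow> (\<exists>u. ivp_solution n q (pos_powr p) c R u)"

text \<open>The chosen solution depends on the endpoint \<open>r\<close>, but by uniqueness the
  choices agree. One function thus serves every interval of existence, and no maximal interval
  enters the definition.\<close>

definition sol :: "real \<Rightarrow> real \<Rightarrow> real" where
  "sol c r = (SOME u. ivp_solution n q (pos_powr p) c r u) r"

text \<open>The flux r^n u'(r) of the solution.\<close>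

definition w :: "real \<Rightarrow> real \<Rightarrow> real" where
  "w c r = flux n (\<lambda>t. q t * pos_powr p (sol c t)) r"

definition trunc_sol :: "real \<Rightarrow> real \<Rightarrow> real \<Rightarrow> real" where
  "trunc_sol K c = (SOME u. ivp_solution n q (trunc_powr p K) c 1 u)"

lemma q_bounded: obtains Q where "0 \<le> Q" "\<And>t. t \<in> {0..1} \<Longrightarrow> \<bar>q t\<bar> \<le> Q"
proof -
  have "bounded (q ` {0..1})"
    by (rule compact_imp_bounded[OF compact_continuous_image[OF q compact_Icc]])
  then obtain B where "\<forall>y\<in>q ` {0..1}. norm y \<le> B" unfolding bounded_iff by blast
  then have "\<bar>q t\<bar> \<le> B" if "t \<in> {0..1}" for t using that by simp
  from that[OF _ this] this[of 0] show thesis by auto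
qed

lemma trunc_lipschitz_ivp:
  assumes "0 \<le> K" obtains Q L l where "lipschitz_ivp q (trunc_powr p K) Q L l"
proof -
  obtain Q where Q: "\<And>t. t \<in> {0..1} \<Longrightarrow> \<bar>q t\<bar> \<le> Q" using q_bounded by blast
  let ?L = "p * K powr (p - 1)"
  have "lipschitz_ivp q (trunc_powr p K) Q ?L (max 1 (2 * (Q * ?L)))"
    by unfold_locales (use q Q trunc_powr_lipschitz[OF p assms] in auto)
  then show thesis by (rule that)
qed

lemma trunc_sol:
  assumes "0 \<le> K" shows "ivp_solution n q (trunc_powr p K) c 1 (trunc_sol K c)"
proof -
  obtain Q L l where "lipschitz_ivp q (trunc_powr p K) Q L l" using trunc_lipschitz_ivp[OF assms] .
  then interpret lipschitz_ivp q "trunc_powr p K" Q L l .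
  show ?thesis unfolding trunc_sol_def by (rule someI_ex[OF solution_exists])
qed

lemma trunc_sol_lipschitz:
  assumes "0 \<le> K"
  obtains C where "0 \<le> C" "\<And>c d r. r \<in> {0..1} \<Longrightarrow> \<bar>trunc_sol K c r - trunc_sol K d r\<bar> \<le> C * \<bar>c - d\<bar>"
proof -
  obtain Q L l where "lipschitz_ivp q (trunc_powr p K) Q L l" using trunc_lipschitz_ivp[OF assms] .
  then interpret lipschitz_ivp q "trunc_powr p K" Q L l .
  show thesis
    by (rule that[OF _ solution_dependence[OF trunc_sol[OF assms] trunc_sol[OF assms] order_refl]]) simp
qed

lemma trunc_unique:
  assumes "0 \<le> K" and u: "ivp_solution n q (trunc_powr p K) c R u" and v: "ivp_solution n q (trunc_powr p K) c R v"
    and "R \<le> 1" "r \<in> {0..R}"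
  shows "u r = v r"
proof -
  obtain Q L l where "lipschitz_ivp q (trunc_powr p K) Q L l" using trunc_lipschitz_ivp[OF assms(1)] .
  then interpret lipschitz_ivp q "trunc_powr p K" Q L l .
  show ?thesis using solution_dependence[OF u v assms(4,5)] by simp
qed

lemma eq_trunc_sol:
  assumes u: "ivp_solution n q (pos_powr p) c R u" and "R \<le> 1" "0 \<le> K"
    and le: "\<And>r. r \<in> {0..R} \<Longrightarrow> u r \<le> K" and "r \<in> {0..R}"
  shows "u r = trunc_sol K c r"
proof (rule trunc_unique[OF \<open>0 \<le> K\<close> _ _ \<open>R \<le> 1\<close> \<open>r \<in> {0..R}\<close>])
  show "ivp_solution n q (trunc_powr p K) c R u"
    by (rule ivp_solution_cong[OF u]) (use le in \<open>auto simp: trunc_powr_eq\<close>)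
  show "ivp_solution n q (trunc_powr p K) c R (trunc_sol K c)"
    by (rule ivp_solution_subset[OF trunc_sol]) fact+
qed

lemma unique:
  assumes u: "ivp_solution n q (pos_powr p) c R u" and v: "ivp_solution n q (pos_powr p) c R v"
    and R: "R \<le> 1" and r: "r \<in> {0..R}"
  shows "u r = v r"
proof -
  obtain K where K: "0 < K" "\<And>r. r \<in> {0..R} \<Longrightarrow> u r < K"
    using continuous_on_Icc_bounded_above[OF ivp_solution_continuous[OF u]] by blast
  obtain K' where K': "0 < K'" "\<And>r. r \<in> {0..R} \<Longrightarrow> v r < K'"
    using continuous_on_Icc_bounded_above[OF ivp_solution_continuous[OF v]] by blast
  have "u r = trunc_sol (max K K') c r"
    by (rule eq_trunc_sol[OF u R _ _ r]) (use K in \<open>force+\<close>)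
  moreover have "v r = trunc_sol (max K K') c r"
    by (rule eq_trunc_sol[OF v R _ _ r]) (use K' in \<open>force+\<close>)
  ultimately show ?thesis by simp
qed

lemma sol_eq:
  assumes u: "ivp_solution n q (pos_powr p) c R u" and R: "R \<le> 1" and r: "r \<in> {0..R}"
  shows "sol c r = u r"
proof -
  have ur: "ivp_solution n q (pos_powr p) c r u" by (rule ivp_solution_subset[OF u]) (use r in auto)
  from unique[OF someI[of "ivp_solution n q (pos_powr p) c r", OF ur] ur] show ?thesis
    using r R by (simp add: sol_def)
qed

lemma solvable_sol:
  assumes "solvable c R" "R \<le> 1"
  shows "ivp_solution n q (pos_powr p) c R (sol c)"
proof -
  obtain u where u: "ivp_solution n q (pos_powr p) c R u" using assms by (auto simp: solvable_def)
  show ?thesis by (rule ivp_solution_cong[OF u]) (use sol_eq[OF u] assms in auto)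
qed

lemma solvable_mono: "solvable c R \<Longrightarrow> r \<le> R \<Longrightarrow> solvable c r"
  unfolding solvable_def using ivp_solution_subset by blast

lemma solvable_0: "solvable c 0"
  unfolding solvable_def ivp_solution_def by (intro exI[of _ "\<lambda>_. c"]) auto

lemma sol_0 [simp]: "sol c 0 = c"
  using ivp_solution_eq[OF solvable_sol[OF solvable_0], of 0 c] by simp

lemma w_0 [simp]: "w c 0 = 0"
  by (simp add: w_def)

lemma continuous_on_sol: "solvable c R \<Longrightarrow> R \<le> 1 \<Longrightarrow> continuous_on {0..R} (sol c)"
  by (rule ivp_solution_continuous[OF solvable_sol])

lemma continuous_on_rhs:
  assumes "solvable c R" "R \<le> 1"
  shows "continuous_on {0..R} (\<lambda>t. q t * pos_powr p (sol c t))"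
  using assms p continuous_on_subset[OF q, of "{0..R}"]
  by (intro continuous_on_mult continuous_on_pos_powr continuous_on_sol) auto

lemma sol_has_derivative:
  assumes "solvable c R" "R \<le> 1" "r \<in> {0..R}"
  shows "(sol c has_real_derivative w c r / r ^ n) (at r within {0..R})"
proof -
  have "((\<lambda>r. c + radial_inv n (\<lambda>t. q t * pos_powr p (sol c t)) r) has_real_derivative w c r / r ^ n) (at r within {0..R})"
    using radial_inv_has_derivative[OF continuous_on_rhs[OF assms(1,2)] assms(3), of n]
    by (auto intro!: derivative_eq_intros simp: w_def)
  then show ?thesis
    by (rule has_field_derivative_transform_within[OF _ zero_less_one assms(3)])
      (rule ivp_solution_eq[OF solvable_sol[OF assms(1,2)], symmetric])
qed

lemma w_has_derivative:
  assumes "solvable c R" "R \<le> 1" "r \<in> {0..R}"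
  shows "(w c has_real_derivative r ^ n * (q r * pos_powr p (sol c r))) (at r within {0..R})"
  unfolding w_def [abs_def]
  by (rule flux_has_derivative[OF continuous_on_rhs[OF assms(1,2)] assms(3)])

lemma continuous_on_w: "solvable c R \<Longrightarrow> R \<le> 1 \<Longrightarrow> continuous_on {0..R} (w c)"
  by (rule DERIV_continuous_on[OF w_has_derivative])

lemma trunc_sol_ivp:
  assumes "0 \<le> K" "R \<le> 1" "\<And>r. r \<in> {0..R} \<Longrightarrow> trunc_sol K c r \<le> K"
  shows "ivp_solution n q (pos_powr p) c R (trunc_sol K c)"
  by (rule ivp_solution_cong[OF ivp_solution_subset[OF trunc_sol[OF assms(1)] assms(2)]])
    (use assms(3) in \<open>auto simp: trunc_powr_eq\<close>)

text \<open>Truncated solutions exist on all of [0, 1] and are Lipschitz in the initial value. With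
  a margin of 1 between the solution for \<open>c\<close> and the cut-off, nearby truncated
  solutions do not exceed the cut-off and hence solve the original problem.\<close>

lemma solvable_nhd:
  assumes R: "solvable c R" "0 \<le> R" "R \<le> 1"
  shows "\<exists>K>0. \<exists>C\<ge>0. \<exists>\<epsilon>>0. \<forall>d. \<bar>d - c\<bar> < \<epsilon> \<longrightarrow>
    solvable d R \<and> (\<forall>r\<in>{0..R}. sol d r \<le> K \<and> \<bar>sol d r - sol c r\<bar> \<le> C * \<bar>d - c\<bar>)"
proof -
  obtain K where K: "0 < K" "\<And>r. r \<in> {0..R} \<Longrightarrow> sol c r < K"
    using continuous_on_Icc_bounded_above[OF continuous_on_sol[OF R(1,3)]] by blast
  let ?K = "K + 1"
  have K0: "0 \<le> ?K" using K by simp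
  obtain C where C: "0 \<le> C" "\<And>c d r. r \<in> {0..1} \<Longrightarrow> \<bar>trunc_sol ?K c r - trunc_sol ?K d r\<bar> \<le> C * \<bar>c - d\<bar>"
    using trunc_sol_lipschitz[OF K0] by blast
  have c: "sol c r = trunc_sol ?K c r" if "r \<in> {0..R}" for r
    by (rule eq_trunc_sol[OF solvable_sol[OF R(1,3)] R(3) K0 _ that]) (use K(2) in force)
  \<comment> \<open>This keeps C |d - c| within the margin 1, also when C = 0.\<close>
  define \<epsilon> where "\<epsilon> = 1 / (C + 1)"
  have \<epsilon>: "0 < \<epsilon>" using C by (simp add: \<epsilon>_def)
  have C\<epsilon>: "C * \<bar>d - c\<bar> \<le> 1" if "\<bar>d - c\<bar> < \<epsilon>" for d
  proof -
    have "C * \<bar>d - c\<bar> \<le> C * \<epsilon>" using that C by (intro mult_left_mono) auto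
    also have "\<dots> \<le> 1" using C by (simp add: \<epsilon>_def field_simps)
    finally show ?thesis .
  qed
  have le: "trunc_sol ?K d r \<le> ?K" "\<bar>trunc_sol ?K d r - sol c r\<bar> \<le> C * \<bar>d - c\<bar>"
    if "\<bar>d - c\<bar> < \<epsilon>" "r \<in> {0..R}" for d r
  proof -
    show "\<bar>trunc_sol ?K d r - sol c r\<bar> \<le> C * \<bar>d - c\<bar>"
      using C(2)[of r d c] R(3) that c[OF that(2)] by auto
    then show "trunc_sol ?K d r \<le> ?K" using C\<epsilon>[OF that(1)] K(2)[OF that(2)] by linarith
  qed
  have ivp: "ivp_solution n q (pos_powr p) d R (trunc_sol ?K d)" if "\<bar>d - c\<bar> < \<epsilon>" for d
    by (rule trunc_sol_ivp[OF K0 R(3)]) (use le(1)[OF that] in auto)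
  show ?thesis
  proof (intro exI conjI allI impI ballI)
    fix d assume d: "\<bar>d - c\<bar> < \<epsilon>"
    show "solvable d R" using ivp[OF d] by (auto simp: solvable_def)
    fix r assume r: "r \<in> {0..R}"
    show "sol d r \<le> ?K" "\<bar>sol d r - sol c r\<bar> \<le> C * \<bar>d - c\<bar>"
      using le[OF d r] sol_eq[OF ivp[OF d] R(3) r] by simp_all
  qed (use K C \<epsilon> in auto)
qed

lemma eventually_solvable:
  assumes "solvable c R" "0 \<le> R" "R \<le> 1"
  shows "eventually (\<lambda>d. solvable d R) (nhds c)"
proof -
  from solvable_nhd[OF assms] have "\<exists>\<epsilon>>0. \<forall>d. \<bar>d - c\<bar> < \<epsilon> \<longrightarrow> solvable d R" by blast
  then show ?thesis unfolding eventually_nhds_metric dist_real_def by blast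
qed

lemma isCont_sol:
  assumes "solvable c R" "0 \<le> R" "R \<le> 1"
  shows "isCont (\<lambda>c. sol c R) c"
proof -
  obtain C \<epsilon> where "0 < \<epsilon>"
    "\<forall>d. \<bar>d - c\<bar> < \<epsilon> \<longrightarrow> (\<forall>r\<in>{0..R}. \<bar>sol d r - sol c r\<bar> \<le> C * \<bar>d - c\<bar>)"
    using solvable_nhd[OF assms] by blast
  then show ?thesis using assms by (intro isCont_of_local_lipschitz[of \<epsilon> c _ C]) auto
qed

text \<open>Below the common bound \<open>K\<close> the nonlinearity agrees with its truncation,
  whose Lipschitz constant carries the continuity over from the values to the flux.\<close>

lemma isCont_w:
  assumes R: "solvable c R" "0 \<le> R" "R \<le> 1"
  shows "isCont (\<lambda>c. w c R) c"
proof -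
  obtain K C \<epsilon> where K: "0 < K" and C: "0 \<le> C" and \<epsilon>: "0 < \<epsilon>"
    and so: "\<And>d. \<bar>d - c\<bar> < \<epsilon> \<Longrightarrow> solvable d R"
    and le: "\<And>d r. \<bar>d - c\<bar> < \<epsilon> \<Longrightarrow> r \<in> {0..R} \<Longrightarrow> sol d r \<le> K \<and> \<bar>sol d r - sol c r\<bar> \<le> C * \<bar>d - c\<bar>"
    using solvable_nhd[OF R] by blast
  obtain Q where Q: "0 \<le> Q" "\<And>t. t \<in> {0..1} \<Longrightarrow> \<bar>q t\<bar> \<le> Q" using q_bounded by blast
  let ?L = "p * K powr (p - 1)"
  have L0: "0 \<le> ?L" using p by simp
  show ?thesis
  proof (rule isCont_of_local_lipschitz[OF \<epsilon>])
    fix d assume d: "\<bar>d - c\<bar> < \<epsilon>"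
    have "\<bar>w d R / R ^ n - w c R / R ^ n\<bar> \<le> integral {0..R} (\<lambda>_. Q * (?L * (C * \<bar>d - c\<bar>)))"
      unfolding w_def
    proof (rule flux_diff_le[OF continuous_on_rhs[OF so[OF d] R(3)] continuous_on_rhs[OF R(1,3)] _ _ R(2)])
      fix t assume t: "t \<in> {0..R}"
      have "\<bar>pos_powr p (sol d t) - pos_powr p (sol c t)\<bar> \<le> ?L * \<bar>sol d t - sol c t\<bar>"
        using trunc_powr_lipschitz[OF p less_imp_le[OF K], of "sol d t" "sol c t"] le[OF d t] le[of c, OF _ t] \<epsilon>
        by (simp add: trunc_powr_eq)
      also have "\<dots> \<le> ?L * (C * \<bar>d - c\<bar>)" using le[OF d t] L0 by (intro mult_left_mono) auto
      finally have "\<bar>q t\<bar> * \<bar>pos_powr p (sol d t) - pos_powr p (sol c t)\<bar> \<le> Q * (?L * (C * \<bar>d - c\<bar>))"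
        using Q t R by (intro mult_mono) auto
      then show "\<bar>q t * pos_powr p (sol d t) - q t * pos_powr p (sol c t)\<bar> \<le> Q * (?L * (C * \<bar>d - c\<bar>))"
        by (simp add: abs_mult flip: right_diff_distrib)
    qed (rule integrable_const_ivl)
    also have "\<dots> = R * (Q * (?L * (C * \<bar>d - c\<bar>)))" using R by simp
    finally have *: "\<bar>w d R / R ^ n - w c R / R ^ n\<bar> \<le> R * (Q * (?L * (C * \<bar>d - c\<bar>)))" .
    show "\<bar>w d R - w c R\<bar> \<le> R ^ n * R * Q * ?L * C * \<bar>d - c\<bar>"
    proof (cases "R = 0")
      case False
      then have "0 < R ^ n" using R by simp
      then have "\<bar>w d R - w c R\<bar> = R ^ n * \<bar>w d R / R ^ n - w c R / R ^ n\<bar>"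
        by (simp add: abs_mult flip: diff_divide_distrib)
      also have "\<dots> \<le> R ^ n * (R * (Q * (?L * (C * \<bar>d - c\<bar>))))"
        using * \<open>0 < R ^ n\<close> by (intro mult_left_mono) auto
      finally show ?thesis by (simp add: mult_ac)
    qed simp
  qed
qed

lemma solvable_extend:
  assumes R: "solvable c R" "0 \<le> R" "R < 1"
  obtains R' where "R < R'" "R' \<le> 1" "solvable c R'"
proof -
  have R1: "R \<le> 1" using R by simp
  obtain K where K: "0 < K" "\<And>r. r \<in> {0..R} \<Longrightarrow> sol c r < K"
    using continuous_on_Icc_bounded_above[OF continuous_on_sol[OF R(1) R1]] by blast
  have K0: "0 \<le> K" using K by simp
  have eq: "sol c r = trunc_sol K c r" if "r \<in> {0..R}" for r
    by (rule eq_trunc_sol[OF solvable_sol[OF R(1) R1] R1 K0 _ that]) (use K(2) in force)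
  have cont: "continuous_on {0..1} (trunc_sol K c)" by (rule ivp_solution_continuous[OF trunc_sol[OF K0]])
  have "trunc_sol K c R < K" using eq[of R] K(2)[of R] R by auto
  moreover have "(trunc_sol K c \<longlongrightarrow> trunc_sol K c R) (at R within {0..1})"
    using cont R by (auto simp: continuous_on)
  ultimately have "\<forall>\<^sub>F r in at R within {0..1}. trunc_sol K c r < K"
    by (auto simp: order_tendsto_iff)
  then obtain e where e: "0 < e" "\<And>r. r \<in> {0..1} \<Longrightarrow> r \<noteq> R \<Longrightarrow> dist r R < e \<Longrightarrow> trunc_sol K c r < K"
    unfolding eventually_at by blast
  let ?R = "min 1 (R + e / 2)"
  have "ivp_solution n q (pos_powr p) c ?R (trunc_sol K c)"
  proof (rule trunc_sol_ivp[OF K0])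
    fix r assume r: "r \<in> {0..?R}"
    show "trunc_sol K c r \<le> K"
    proof (cases "r \<le> R")
      case True then show ?thesis using eq[of r] K(2)[of r] r by auto
    next
      case False then show ?thesis using e(1) r by (intro less_imp_le e(2)) (auto simp: dist_real_def)
    qed
  qed simp
  then show thesis using e R by (intro that[of ?R]) (auto simp: solvable_def)
qed

text \<open>The truncated solution coincides with the solution before \<open>T\<close> and by
  continuity respects the cut-off at \<open>T\<close> too. An upper bound alone excludes blow-up, as
  the nonlinearity vanishes below 0.\<close>

lemma solvable_limit:
  assumes T: "0 < T" "T \<le> 1" and so: "\<And>r. 0 \<le> r \<Longrightarrow> r < T \<Longrightarrow> solvable c r"
    and le: "\<And>r. 0 \<le> r \<Longrightarrow> r < T \<Longrightarrow> sol c r \<le> K"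
  shows "solvable c T"
proof -
  let ?K = "max K 0"
  have K0: "0 \<le> ?K" by simp
  have eq: "sol c r = trunc_sol ?K c r" if "0 \<le> r" "r < T" for r
    by (rule eq_trunc_sol[OF solvable_sol[OF so[OF that]] _ K0, of r]) (use that T le in force)+
  have cont: "continuous_on {0..1} (trunc_sol ?K c)" by (rule ivp_solution_continuous[OF trunc_sol[OF K0]])
  have le': "trunc_sol ?K c r \<le> ?K" if "0 \<le> r" "r < T" for r
    using eq[OF that] le[OF that] by simp
  have "trunc_sol ?K c r \<le> ?K" if "r \<in> {0..T}" for r
  proof -
    have "continuous_on (closure {0..<T}) (trunc_sol ?K c)"
      using T by (intro continuous_on_subset[OF cont]) auto
    from continuous_le_on_closure[OF this, of r ?K] show ?thesis using that T le' by auto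
  qed
  from trunc_sol_ivp[OF K0 T(2) this] show ?thesis by (auto simp: solvable_def)
qed

end

section \<open>Monotonicity, vanishing and blow-up\<close>

lemma deriv_bound_diff:
  fixes f f' :: "real \<Rightarrow> real"
  assumes "\<And>x. x \<in> {s..t} \<Longrightarrow> (f has_real_derivative f' x) (at x within {s..t})" "s \<le> t"
  shows "(\<And>x. x \<in> {s..t} \<Longrightarrow> B \<le> f' x) \<Longrightarrow> B * (t - s) \<le> f t - f s"
    and "(\<And>x. x \<in> {s..t} \<Longrightarrow> f' x \<le> B) \<Longrightarrow> f t - f s \<le> B * (t - s)"
proof -
  have "\<exists>x\<in>{s..t}. f t - f s = f' x * (t - s)"
    by (rule mvt_very_simple) (use assms in \<open>auto simp: has_field_derivative_def\<close>)
  then obtain x where x: "x \<in> {s..t}" "f t - f s = f' x * (t - s)" by blast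
  show "B * (t - s) \<le> f t - f s" if "\<And>x. x \<in> {s..t} \<Longrightarrow> B \<le> f' x"
    using that[OF x(1)] assms(2) unfolding x(2) by (intro mult_right_mono) auto
  show "f t - f s \<le> B * (t - s)" if "\<And>x. x \<in> {s..t} \<Longrightarrow> f' x \<le> B"
    using that[OF x(1)] assms(2) unfolding x(2) by (intro mult_right_mono) auto
qed

context power_ivp
begin

lemma w_diff:
  assumes "solvable c t" "0 \<le> s" "s \<le> t" "t \<le> 1"
  shows "(\<And>x. x \<in> {s..t} \<Longrightarrow> B \<le> x ^ n * (q x * pos_powr p (sol c x))) \<Longrightarrow> B * (t - s) \<le> w c t - w c s"
    and "(\<And>x. x \<in> {s..t} \<Longrightarrow> x ^ n * (q x * pos_powr p (sol c x)) \<le> B) \<Longrightarrow> w c t - w c s \<le> B * (t - s)"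
proof -
  have "(w c has_real_derivative x ^ n * (q x * pos_powr p (sol c x))) (at x within {s..t})" if "x \<in> {s..t}" for x
    by (rule has_field_derivative_subset[OF w_has_derivative[OF assms(1,4)]]) (use that assms in auto)
  note * = deriv_bound_diff[OF this assms(3)]
  show "(\<And>x. x \<in> {s..t} \<Longrightarrow> B \<le> x ^ n * (q x * pos_powr p (sol c x))) \<Longrightarrow> B * (t - s) \<le> w c t - w c s"
    and "(\<And>x. x \<in> {s..t} \<Longrightarrow> x ^ n * (q x * pos_powr p (sol c x)) \<le> B) \<Longrightarrow> w c t - w c s \<le> B * (t - s)"
    by (rule *; blast)+
qed

lemma w_mono:
  assumes "solvable c t" "0 \<le> s" "s \<le> t" "t \<le> 1" "\<And>x. x \<in> {s..t} \<Longrightarrow> 0 \<le> q x"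
  shows "w c s \<le> w c t"
  using w_diff(1)[OF assms(1-4), of 0] assms by simp

lemma w_antimono:
  assumes "solvable c t" "0 \<le> s" "s \<le> t" "t \<le> 1" "\<And>x. x \<in> {s..t} \<Longrightarrow> q x \<le> 0"
  shows "w c t \<le> w c s"
  using w_diff(2)[OF assms(1-4), of 0] assms by (simp add: mult_nonneg_nonpos mult_nonpos_nonneg)

text \<open>The slope is w / x^n. Because x^n \<le> 1, a flux bounded away from 0 by
  \<open>W\<close> gives a slope at least as far from 0 (first two parts). Limiting the size of the
  slope costs the factor 1 / s^n and therefore requires 0 < s (last two parts).\<close>

lemma sol_diff:
  assumes so: "solvable c t" "0 \<le> s" "s \<le> t" "t \<le> 1" and W: "0 \<le> W"
  shows "(\<And>x. x \<in> {s..t} \<Longrightarrow> W \<le> w c x) \<Longrightarrow> W * (t - s) \<le> sol c t - sol c s"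
    and "(\<And>x. x \<in> {s..t} \<Longrightarrow> w c x \<le> - W) \<Longrightarrow> sol c t - sol c s \<le> - W * (t - s)"
    and "0 < s \<Longrightarrow> (\<And>x. x \<in> {s..t} \<Longrightarrow> w c x \<le> W) \<Longrightarrow> sol c t - sol c s \<le> W / s ^ n * (t - s)"
    and "0 < s \<Longrightarrow> (\<And>x. x \<in> {s..t} \<Longrightarrow> - W \<le> w c x) \<Longrightarrow> - W / s ^ n * (t - s) \<le> sol c t - sol c s"
proof -
  have "(sol c has_real_derivative w c x / x ^ n) (at x within {s..t})" if "x \<in> {s..t}" for x
    by (rule has_field_derivative_subset[OF sol_has_derivative[OF so(1,4)]]) (use that assms in auto)
  note * = deriv_bound_diff[OF this so(3)]
  have pw: "0 < x ^ n" "x ^ n \<le> 1" if "x \<in> {s..t}" "x \<noteq> 0" for x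
    using that so by (auto intro: power_le_one)
  have pw': "s ^ n \<le> x ^ n" if "x \<in> {s..t}" for x
    using that so by (auto intro: power_mono)
  show "W * (t - s) \<le> sol c t - sol c s" if "\<And>x. x \<in> {s..t} \<Longrightarrow> W \<le> w c x"
  proof (rule *(1))
    fix x assume x: "x \<in> {s..t}"
    show "W \<le> w c x / x ^ n"
    proof (cases "x = 0")
      case True then show ?thesis using that[OF x] W by simp
    next
      case False
      have "W * x ^ n \<le> W" using pw[OF x False] W by (simp add: mult_left_le)
      then show ?thesis using that[OF x] pw[OF x False] by (simp add: field_simps)
    qed
  qed
  show "sol c t - sol c s \<le> - W * (t - s)" if "\<And>x. x \<in> {s..t} \<Longrightarrow> w c x \<le> - W"
  proof (rule *(2))
    fix x assume x: "x \<in> {s..t}"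
    show "w c x / x ^ n \<le> - W"
    proof (cases "x = 0")
      case True then show ?thesis using that[OF x] W by simp
    next
      case False
      have "W * x ^ n \<le> W" using pw[OF x False] W by (simp add: mult_left_le)
      then show ?thesis using that[OF x] pw[OF x False] by (simp add: field_simps)
    qed
  qed
  assume s: "0 < s"
  have sn: "0 < s ^ n" using s by simp
  show "sol c t - sol c s \<le> W / s ^ n * (t - s)" if "\<And>x. x \<in> {s..t} \<Longrightarrow> w c x \<le> W"
  proof (rule *(2))
    fix x assume x: "x \<in> {s..t}"
    have "w c x / x ^ n \<le> W / x ^ n" using that[OF x] x s by (intro divide_right_mono) auto
    also have "\<dots> \<le> W / s ^ n" using pw'[OF x] W s x by (intro divide_left_mono) auto
    finally show "w c x / x ^ n \<le> W / s ^ n" .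
  qed
  show "- W / s ^ n * (t - s) \<le> sol c t - sol c s" if "\<And>x. x \<in> {s..t} \<Longrightarrow> - W \<le> w c x"
  proof (rule *(1))
    fix x assume x: "x \<in> {s..t}"
    have "- W / s ^ n \<le> - W / x ^ n" using pw'[OF x] W s x by (simp add: divide_left_mono)
    also have "\<dots> \<le> w c x / x ^ n" using that[OF x] x s by (intro divide_right_mono) auto
    finally show "- W / s ^ n \<le> w c x / x ^ n" .
  qed
qed

lemma sol_mono:
  assumes "solvable c t" "0 \<le> s" "s \<le> t" "t \<le> 1" "\<And>x. x \<in> {s..t} \<Longrightarrow> 0 \<le> w c x"
  shows "sol c s \<le> sol c t"
  using sol_diff(1)[OF assms(1-4), of 0] assms by simp

lemma sol_antimono:
  assumes "solvable c t" "0 \<le> s" "s \<le> t" "t \<le> 1" "\<And>x. x \<in> {s..t} \<Longrightarrow> w c x \<le> 0"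
  shows "sol c t \<le> sol c s"
  using sol_diff(2)[OF assms(1-4), of 0] assms by simp

text \<open>Take the smallest nonpositive point. A positive flux there would make the solution
  increase just before it, giving an earlier nonpositive point; if the point is the origin, the flux
  is 0.\<close>

lemma first_nonpos:
  assumes c: "0 \<le> c" and so: "solvable c r" and r: "0 \<le> r" "r \<le> 1" and np: "sol c r \<le> 0"
  obtains s where "0 \<le> s" "s \<le> r" "sol c s \<le> 0" "w c s \<le> 0"
proof -
  let ?Z = "{x \<in> {0..r}. sol c x \<le> 0}"
  have cont: "continuous_on {0..r} (sol c)" by (rule continuous_on_sol[OF so r(2)])
  have "closed ?Z" by (rule continuous_on_closed_Collect_le[OF cont]) auto
  then have "compact ?Z" by (metis (no_types, lifting) bounded_closed_interval bounded_subset compact_eq_bounded_closed mem_Collect_eq subsetI)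
  moreover have "r \<in> ?Z" using r np by simp
  ultimately obtain s where s: "s \<in> ?Z" and min: "\<And>x. x \<in> ?Z \<Longrightarrow> s \<le> x"
    using compact_attains_inf[of ?Z] by blast
  have "w c s \<le> 0"
  proof (rule ccontr)
    assume "\<not> w c s \<le> 0"
    then have ws: "0 < w c s" by simp
    then have s0: "0 < s" using s by (cases "s = 0") auto
    have "(w c \<longlongrightarrow> w c s) (at s within {0..r})"
      using continuous_on_w[OF so r(2)] s by (auto simp: continuous_on)
    then have "\<forall>\<^sub>F x in at s within {0..r}. 0 < w c x" using ws by (auto simp: order_tendsto_iff)
    then obtain e where e: "0 < e" "\<And>x. x \<in> {0..r} \<Longrightarrow> x \<noteq> s \<Longrightarrow> dist x s < e \<Longrightarrow> 0 < w c x"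
      unfolding eventually_at by blast
    let ?x = "max (s / 2) (s - e / 2)"
    have x: "0 \<le> ?x" "?x < s" using s0 e by auto
    have "sol c ?x \<le> sol c s"
    proof (rule sol_mono[OF solvable_mono[OF so]])
      fix y assume y: "y \<in> {?x..s}"
      show "0 \<le> w c y"
      proof (cases "y = s")
        case False
        have "dist y s < e" using y e(1) by (auto simp: dist_real_def)
        with e(2)[of y] y False x s show ?thesis by auto
      qed (use ws in simp)
    qed (use x s r in auto)
    with s x have "?x \<in> ?Z" by auto
    with min x show False by fastforce
  qed
  with s show thesis by (intro that[of s]) auto
qed

lemma nonpos_continues:
  assumes c: "0 \<le> c" and so: "solvable c r" and r: "0 \<le> r" "r \<le> 1" and np: "sol c r \<le> 0"
  shows "solvable c 1" and "\<And>t. r \<le> t \<Longrightarrow> t \<le> 1 \<Longrightarrow> sol c t \<le> 0 \<and> w c t \<le> 0"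
proof -
  obtain s where s: "0 \<le> s" "s \<le> r" "sol c s \<le> 0" "w c s \<le> 0"
    using first_nonpos[OF assms] by blast
  have sos: "solvable c s" by (rule solvable_mono[OF so s(2)])
  define G where "G t = q t * pos_powr p (sol c (min t s))" for t
  define v where "v t = c + radial_inv n G t" for t
  have contG: "continuous_on {0..1} G" unfolding G_def
  proof (intro continuous_on_mult q continuous_on_pos_powr)
    show "continuous_on {0..1} (\<lambda>t. sol c (min t s))"
      by (rule continuous_on_compose2[OF continuous_on_sol[OF sos]])
        (use s r in \<open>auto intro!: continuous_intros\<close>)
  qed (use p in simp)
  have Geq: "flux n G t = w c t" "radial_inv n G t = radial_inv n (\<lambda>t. q t * pos_powr p (sol c t)) t" if "t \<le> s" for t
    unfolding w_def by (rule flux_cong radial_inv_cong; use that in \<open>auto simp: G_def\<close>)+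
  have v_le: "v t = sol c t" if "0 \<le> t" "t \<le> s" for t
    unfolding v_def Geq[OF that(2)]
    by (rule ivp_solution_eq[OF solvable_sol[OF sos], symmetric]) (use that s r in auto)
  have dflux: "(flux n G has_real_derivative t ^ n * G t) (at t within {0..1})" if "t \<in> {0..1}" for t
    by (rule flux_has_derivative[OF contG that])
  have G0: "G t = 0" if "s \<le> t" for t using that s by (simp add: G_def min_absorb2)
  have flux_s: "flux n G t = w c s" if "s \<le> t" "t \<le> 1" for t
  proof -
    have d: "(flux n G has_real_derivative 0) (at x within {s..t})" if "x \<in> {s..t}" for x
      using has_field_derivative_subset[OF dflux[of x], of "{s..t}"] that \<open>t \<le> 1\<close> s G0 by auto
    have "0 * (t - s) \<le> flux n G t - flux n G s" "flux n G t - flux n G s \<le> 0 * (t - s)"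
      by (rule deriv_bound_diff[OF d that(1)]; simp)+
    then show ?thesis using Geq(1)[of s] by simp
  qed
  have v_np: "v t \<le> 0" if "s \<le> t" "t \<le> 1" for t
  proof -
    have d: "(v has_real_derivative flux n G x / x ^ n) (at x within {s..t})" if "x \<in> {s..t}" for x
      unfolding v_def [abs_def]
      by (auto intro!: derivative_eq_intros has_field_derivative_subset[OF radial_inv_has_derivative[OF contG]])
        (use that \<open>t \<le> 1\<close> s in auto)
    have "v t - v s \<le> 0 * (t - s)"
    proof (rule deriv_bound_diff(2)[OF d that(1)])
      fix x assume "x \<in> {s..t}"
      then show "flux n G x / x ^ n \<le> 0" using flux_s[of x] s that by (auto intro!: divide_nonpos_nonneg)
    qed
    then show ?thesis using v_le[of s] s by simp
  qed
  have vG: "q t * pos_powr p (v t) = G t" if "t \<in> {0..1}" for t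
    using v_le[of t] v_np[of t] G0[of t] that by (cases "t \<le> s") (auto simp: G_def)
  have ivp: "ivp_solution n q (pos_powr p) c 1 v"
    unfolding ivp_solution_def
  proof (intro conjI ballI)
    show "continuous_on {0..1} v" unfolding v_def
      by (intro continuous_intros continuous_on_radial_inv contG)
    fix t :: real assume t: "t \<in> {0..1}"
    have "radial_inv n (\<lambda>t. q t * pos_powr p (v t)) t = radial_inv n G t"
      by (rule radial_inv_cong) (use t vG in auto)
    then show "v t = c + radial_inv n (\<lambda>t. q t * pos_powr p (v t)) t" by (simp only: v_def)
  qed
  then show "solvable c 1" by (auto simp: solvable_def)
  fix t assume t: "r \<le> t" "t \<le> 1"
  have sv: "sol c x = v x" if "x \<in> {0..1}" for x by (rule sol_eq[OF ivp order_refl that])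
  have "w c t = flux n G t"
    unfolding w_def by (rule flux_cong) (use t sv vG in auto)
  then show "sol c t \<le> 0 \<and> w c t \<le> 0"
    using sv[of t] v_np[of t] flux_s[of t] s t r by auto
qed

lemma pos_of_pos_later:
  assumes "0 \<le> c" "solvable c r" "r \<le> 1" "0 < w c r \<or> 0 < sol c r" "0 \<le> s" "s \<le> r"
  shows "0 < sol c s"
  using nonpos_continues(2)[OF assms(1) solvable_mono[OF assms(2)], of s r] assms by force

text \<open>The supremum of the radii reached is not itself reached, since a solution on [0, R] with
  R < 1 extends further.\<close>

lemma blowup_time:
  assumes "solvable c s" "\<not> solvable c t" "0 \<le> s" "t \<le> 1"
  obtains T where "s < T" "T \<le> t" "\<And>r. r < T \<Longrightarrow> solvable c r" "\<not> solvable c T"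
proof -
  let ?S = "{r. solvable c r \<and> r \<le> t}"
  have ne: "s \<in> ?S"
    using assms solvable_mono[of c s t] by (cases "s \<le> t") auto
  have bdd: "bdd_above ?S" by (rule bdd_aboveI[of _ t]) auto
  let ?T = "Sup ?S"
  have lt: "solvable c r" if r: "r < ?T" for r
  proof -
    obtain x where "x \<in> ?S" "r < x" using less_cSupE[OF r] ne by blast
    then show ?thesis using solvable_mono[of c x r] by auto
  qed
  have sT: "s \<le> ?T" by (rule cSup_upper[OF ne bdd])
  have Tt: "?T \<le> t" by (rule cSup_least) (use ne in auto)
  have nT: "\<not> solvable c ?T"
  proof
    assume T: "solvable c ?T"
    with assms Tt have "?T < t" by (cases "?T = t") auto
    then obtain R where R: "?T < R" "R \<le> 1" "solvable c R"
      using solvable_extend[OF T] assms sT by auto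
    then have "min R t \<in> ?S" using solvable_mono[of c R "min R t"] by auto
    from cSup_upper[OF this bdd] R \<open>?T < t\<close> show False by auto
  qed
  have "s \<noteq> ?T" using nT assms by auto
  with sT have "s < ?T" by simp
  from that[OF this Tt lt nT] show thesis .
qed

text \<open>On a bump the flux does not increase, so the slope stays below max (w s) 0 / s^n and the
  solution stays bounded. Blow-up is confined to gaps.\<close>

lemma solvable_bump:
  assumes so: "solvable c s" and st: "0 < s" "s \<le> t" "t \<le> 1" and q_np: "\<And>x. x \<in> {s..t} \<Longrightarrow> q x \<le> 0"
  shows "solvable c t"
proof (rule ccontr)
  assume "\<not> solvable c t"
  then obtain T where T: "s < T" "T \<le> t" "\<And>r. r < T \<Longrightarrow> solvable c r" "\<not> solvable c T"
    using blowup_time[OF so] st by auto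
  obtain K where K: "\<And>r. r \<in> {0..s} \<Longrightarrow> sol c r < K"
    using continuous_on_Icc_bounded_above[OF continuous_on_sol[OF so]] st by auto
  let ?W = "max (w c s) 0"
  have "solvable c T"
  proof (rule solvable_limit)
    fix r assume r: "0 \<le> r" "r < T"
    show "sol c r \<le> max K (sol c s + ?W / s ^ n)"
    proof (cases "r \<le> s")
      case True then show ?thesis using K[of r] r by auto
    next
      case False
      then have sr: "s \<le> r" by simp
      have r1: "r \<le> 1" using r T st by simp
      have "sol c r - sol c s \<le> ?W / s ^ n * (r - s)"
      proof (rule sol_diff(3)[OF T(3)[OF r(2)] _ sr r1 _ st(1)])
        fix x assume x: "x \<in> {s..r}"
        have "w c x \<le> w c s"
          by (rule w_antimono[OF T(3)]) (use x r T st q_np in auto)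
        then show "w c x \<le> ?W" by simp
      qed (use st in auto)
      also have "\<dots> \<le> ?W / s ^ n * 1" using sr r1 st by (intro mult_left_mono) auto
      finally show ?thesis by simp
    qed
  qed (use T st in auto)
  with T show False by simp
qed

text \<open>The value is unbounded near \<open>T\<close> by \<open>solvable_limit\<close>. A bounded
  flux would bound the value, so the nondecreasing flux eventually exceeds K, and from then on the
  value is nondecreasing as well.\<close>

lemma blowup_unbounded:
  assumes s: "0 \<le> s" "s < T" "T \<le> 1" and T: "\<And>r. r < T \<Longrightarrow> solvable c r" "\<not> solvable c T"
    and q_nn: "\<And>x. x \<in> {s..<T} \<Longrightarrow> 0 \<le> q x"
  obtains r where "s < r" "r < T" "\<And>x. r \<le> x \<Longrightarrow> x < T \<Longrightarrow> K < sol c x \<and> K < w c x"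
proof -
  have unb: "\<exists>r. s' < r \<and> r < T \<and> B < sol c r" if s': "s \<le> s'" "s' < T" for s' B
  proof (rule ccontr)
    assume neg: "\<not> ?thesis"
    obtain K where K: "\<And>r. r \<in> {0..s'} \<Longrightarrow> sol c r < K"
      using continuous_on_Icc_bounded_above[OF continuous_on_sol[OF T(1)[OF s'(2)]]] s s' by auto
    have "solvable c T"
    proof (rule solvable_limit)
      fix r assume r: "0 \<le> r" "r < T"
      show "sol c r \<le> max K B" using neg K[of r] r by (cases "r \<le> s'") force+
    qed (use s T in auto)
    with T show False by simp
  qed
  have mono: "w c x \<le> w c y" if "s \<le> x" "x \<le> y" "y < T" for x y
    by (rule w_mono[OF T(1)]) (use that s q_nn in auto)
  let ?K = "max K 0"
  \<comment> \<open>A point to the right of \<open>s\<close> is needed because \<open>s\<close> may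
    be 0, where flux bounds do not control the slope.\<close>
  define s0 where "s0 = (s + T) / 2"
  have s0: "0 < s0" "s < s0" "s0 < T" using s by (auto simp: s0_def)
  have "\<exists>r. s0 < r \<and> r < T \<and> ?K < w c r"
  proof (rule ccontr)
    assume neg: "\<not> ?thesis"
    obtain r where r: "s0 < r" "r < T" "sol c s0 + ?K / s0 ^ n < sol c r"
      using unb[of s0 "sol c s0 + ?K / s0 ^ n"] s0 by auto
    have "sol c r - sol c s0 \<le> ?K / s0 ^ n * (r - s0)"
    proof (rule sol_diff(3)[OF T(1)])
      fix x assume x: "x \<in> {s0..r}"
      have "w c x \<le> w c r" using mono[of x r] x s0 r by auto
      then show "w c x \<le> ?K" using neg r by fastforce
    qed (use r s0 s in auto)
    also have "\<dots> \<le> ?K / s0 ^ n * 1" using r s s0 by (intro mult_left_mono) auto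
    finally show False using r by simp
  qed
  then obtain r1 where r1: "s0 < r1" "r1 < T" "?K < w c r1" by blast
  obtain r2 where r2: "r1 < r2" "r2 < T" "?K < sol c r2" using unb[of r1 ?K] r1 s0 by auto
  show thesis
  proof (rule that[of r2])
    fix x assume x: "r2 \<le> x" "x < T"
    have wy: "?K < w c y" if "r1 \<le> y" "y < T" for y using mono[of r1 y] r1 s0 that by auto
    have "sol c r2 \<le> sol c x"
    proof (rule sol_mono[OF T(1)])
      show "0 \<le> w c y" if "y \<in> {r2..x}" for y using wy[of y] that r2 x by auto
    qed (use x r2 r1 s0 s in auto)
    then show "K < sol c x \<and> K < w c x" using wy[of x] r2 x by auto
  qed (use r1 r2 s0 in auto)
qed

end

section \<open>Quantitative estimates on gaps and bumps\<close>

context power_ivp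
begin

text \<open>A doubling argument: the solution doubles over consecutive subintervals whose lengths
  decrease geometrically.\<close>

lemma blowup_in_gap:
  assumes st: "0 \<le> s" "s \<le> x" "0 < x" "x < y" "y \<le> t" "t \<le> 1"
    and q_nn: "\<And>r. r \<in> {s..t} \<Longrightarrow> 0 \<le> q r" and k: "0 < k" "\<And>r. r \<in> {x..y} \<Longrightarrow> k \<le> q r"
    and init: "solvable c s" "0 < d" "d \<le> sol c s" "0 \<le> w c s"
    and large: "4 / (x ^ n * ((y - x) * (1 - 2 powr ((1 - p) / 2))) ^ 2) \<le> k * d powr (p - 1)"
  shows "\<not> solvable c t"
proof
  assume so: "solvable c t"
  \<comment> \<open>With this ratio, doubling the height X and shrinking the length by \<theta>
    leaves X^(p-1) times the squared length unchanged.\<close>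
  define \<theta> :: real where "\<theta> = 2 powr ((1 - p) / 2)"
  have \<theta>: "0 < \<theta>" "\<theta> < 1" using p powr_less_mono[of "(1 - p) / 2" 0 2] by (auto simp: \<theta>_def)
  \<comment> \<open>The lengths l \<theta>^j add up to y - x, and \<open>large\<close> says exactly
    that the first step, of length \<open>l\<close>, doubles the height \<open>d\<close>.\<close>
  define l where "l = (y - x) * (1 - \<theta>)"
  have l: "0 < l" using \<theta> st by (simp add: l_def)
  define k' where "k' = x ^ n * k"
  have k': "0 < k'" using k st by (simp add: k'_def)
  have large': "1 \<le> k' * d powr (p - 1) * l ^ 2 / 4"
    using large l k st unfolding \<theta>_def[symmetric] l_def[symmetric] k'_def
    by (simp add: field_simps)
  have wnn: "0 \<le> w c r" if "s \<le> r" "r \<le> t" for r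
    using w_mono[OF solvable_mono[OF so that(2)] st(1) that(1)] that st init q_nn by force
  have mono: "sol c a \<le> sol c b" if "s \<le> a" "a \<le> b" "b \<le> t" for a b
    by (rule sol_mono[OF solvable_mono[OF so]]) (use that st wnn in auto)
  have step: "X + k' * X powr p * (b - a) ^ 2 / 4 \<le> sol c b"
    if ab: "x \<le> a" "a < b" "b \<le> y" and X: "0 < X" "X \<le> sol c a" for a b X
  proof -
    \<comment> \<open>The flux gathered on [a, m] is the slope bound used on [m, b]; the product of
      the two half-lengths is (b - a)^2 / 4.\<close>
    define m where "m = (a + b) / 2"
    have m: "a < m" "m < b" "b - m = (b - a) / 2" "m - a = (b - a) / 2" using ab by (auto simp: m_def field_simps)
    let ?B = "k' * X powr p"
    have B: "0 \<le> ?B" using k' by simp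
    have wm: "?B * (r - a) \<le> w c r" if r: "m \<le> r" "r \<le> b" for r
    proof -
      have "?B * (r - a) \<le> w c r - w c a"
      proof (rule w_diff(1)[OF solvable_mono[OF so]])
        fix z assume z: "z \<in> {a..r}"
        have "X \<le> sol c z" using mono[of a z] z r ab X st m by auto
        then have "X powr p \<le> pos_powr p (sol c z)"
          using pos_powr_mono[of p X "sol c z"] p X by (simp add: pos_powr_pos)
        moreover have "x ^ n \<le> z ^ n" using z ab st by (intro power_mono) auto
        moreover have "k \<le> q z" using k z r ab by auto
        ultimately have "x ^ n * (k * X powr p) \<le> z ^ n * (q z * pos_powr p (sol c z))"
          using k st z ab by (intro mult_mono) auto
        then show "?B \<le> z ^ n * (q z * pos_powr p (sol c z))" by (simp add: k'_def mult_ac)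
      qed (use r m ab st in auto)
      then show ?thesis using wnn[of a] ab st by auto
    qed
    have "?B * (m - a) * (b - m) \<le> sol c b - sol c m"
    proof (rule sol_diff(1)[OF solvable_mono[OF so]])
      fix r assume r: "r \<in> {m..b}"
      have "?B * (m - a) \<le> ?B * (r - a)" using B r by (intro mult_left_mono) auto
      with wm[of r] r show "?B * (m - a) \<le> w c r" by auto
    qed (use m ab st B in auto)
    moreover have "?B * (m - a) * (b - m) = ?B * (b - a) ^ 2 / 4"
      unfolding m by (simp add: power2_eq_square)
    moreover have "sol c a \<le> sol c m" using mono ab m st by auto
    ultimately show ?thesis using X by linarith
  qed
  define \<rho> where "\<rho> j = x + (y - x) * (1 - \<theta> ^ j)" for j :: nat
  have \<rho>_bd: "x \<le> \<rho> j" "\<rho> j \<le> y" for j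
  proof -
    have "0 \<le> 1 - \<theta> ^ j" "1 - \<theta> ^ j \<le> 1" using \<theta> by (auto intro: power_le_one)
    then have "0 \<le> (y - x) * (1 - \<theta> ^ j)" "(y - x) * (1 - \<theta> ^ j) \<le> (y - x) * 1"
      using st by (auto intro!: mult_nonneg_nonneg mult_left_mono)
    then show "x \<le> \<rho> j" "\<rho> j \<le> y" unfolding \<rho>_def mult_1_right by linarith+
  qed
  have \<rho>_step: "\<rho> (Suc j) - \<rho> j = l * \<theta> ^ j" for j by (simp add: \<rho>_def l_def algebra_simps)
  have growth: "2 ^ j * d \<le> sol c (\<rho> j)" for j
  proof (induction j)
    case 0
    have "sol c s \<le> sol c x" by (rule mono) (use st in auto)
    then show ?case using init by (simp add: \<rho>_def)
  next
    case (Suc j)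
    let ?X = "2 ^ j * d"
    have X: "0 < ?X" using init by simp
    have pos: "0 < l * \<theta> ^ j" using l \<theta> by simp
    have "?X + k' * ?X powr p * (l * \<theta> ^ j) ^ 2 / 4 \<le> sol c (\<rho> (Suc j))"
      using step[OF \<rho>_bd(1)[of j] _ \<rho>_bd(2)[of "Suc j"] X Suc] \<rho>_step[of j] pos by force
    moreover have "?X \<le> k' * ?X powr p * (l * \<theta> ^ j) ^ 2 / 4"
    proof -
      have "(2 ^ j :: real) powr (p - 1) * (\<theta> ^ j) ^ 2 = 2 powr (j * (p - 1)) * 2 powr (j * (1 - p))"
        by (simp add: \<theta>_def powr_powr powr_realpow[symmetric] powr_power mult.commute field_simps)
          (simp add: diff_divide_distrib)
      also have "\<dots> = 1" by (simp add: powr_add[symmetric] algebra_simps)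
      finally have e: "(2 ^ j :: real) powr (p - 1) * (\<theta> ^ j) ^ 2 = 1" .
      have "?X powr p = ?X * ?X powr (p - 1)"
        using powr_add[of ?X 1 "p - 1"] X by simp
      also have "?X powr (p - 1) = (2 ^ j) powr (p - 1) * d powr (p - 1)"
        using init by (intro powr_mult)
      finally have "k' * ?X powr p * (l * \<theta> ^ j) ^ 2 / 4 =
          ?X * (k' * d powr (p - 1) * l ^ 2 / 4) * ((2 ^ j) powr (p - 1) * (\<theta> ^ j) ^ 2)"
        by (simp add: power_mult_distrib mult_ac)
      also have "\<dots> = ?X * (k' * d powr (p - 1) * l ^ 2 / 4)" unfolding e by simp
      also have "\<dots> \<ge> ?X * 1" using large' X by (intro mult_left_mono) auto
      finally show ?thesis by simp
    qed
    ultimately show ?case by simp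
  qed
  obtain K where K: "0 < K" "\<And>r. r \<in> {0..t} \<Longrightarrow> sol c r < K"
    using continuous_on_Icc_bounded_above[OF continuous_on_sol[OF so st(6)]] by blast
  obtain j where "K / d < 2 ^ j" using real_arch_pow[of 2 "K / d"] by auto
  then have "K < 2 ^ j * d" using init by (simp add: field_simps)
  with growth[of j] K(2)[of "\<rho> j"] \<rho>_bd[of j] st show False by auto
qed

text \<open>Let S be the maximum. As the flux is nonincreasing, a Harnack-type comparison gives
  values at least \<theta> S on [x, y], so the flux drops there by a multiple of S^p. Positivity on
  the margins of length \<delta> on both sides permits a drop of at most 2 S / \<delta>. Since p >
  1, this bounds S, and \<open>q\<close> enters the bound only through \<open>k\<close>.\<close>

lemma sol_bump_bound:
  assumes st: "0 < s" "0 < \<delta>" "s + \<delta> \<le> x" "x < y" "y + \<delta> \<le> t" "t \<le> 1"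
    and q_np: "\<And>r. r \<in> {s..t} \<Longrightarrow> q r \<le> 0" and k: "0 < k" "\<And>r. r \<in> {x..y} \<Longrightarrow> q r \<le> - k"
    and so: "solvable c t" and pos: "\<And>r. r \<in> {s..t} \<Longrightarrow> 0 < sol c r" and r: "r \<in> {s..t}"
  shows "sol c r \<le> (2 / (\<delta> * (y - x) * s ^ n * k * (s ^ n * \<delta> / 2) powr p)) powr (1 / (p - 1))"
proof -
  have "continuous_on {s..t} (sol c)"
    by (rule continuous_on_subset[OF continuous_on_sol[OF so]]) (use st in auto)
  from continuous_attains_sup[OF compact_Icc _ this] obtain x0
    where x0: "x0 \<in> {s..t}" and max: "\<And>r. r \<in> {s..t} \<Longrightarrow> sol c r \<le> sol c x0" using r by auto
  define S where "S = sol c x0"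
  have S: "0 < S" using pos x0 by (simp add: S_def)
  define \<kappa> where "\<kappa> = s ^ n"
  have \<kappa>: "0 < \<kappa>" "\<kappa> \<le> 1" using st by (auto simp: \<kappa>_def intro: power_le_one)
  have \<delta>: "\<delta> \<le> 1" using st by linarith
  define \<theta> where "\<theta> = \<kappa> * \<delta> / 2"
  have \<kappa>\<delta>: "\<kappa> * \<delta> \<le> 1" using \<kappa> \<delta> st(2) mult_mono[of \<kappa> 1 \<delta> 1] by simp
  have \<theta>: "0 < \<theta>" "\<theta> \<le> 1" using \<kappa> \<delta> st \<kappa>\<delta> by (auto simp: \<theta>_def)
  have so': "solvable c r" if "r \<le> t" for r by (rule solvable_mono[OF so that])
  have wanti: "w c b \<le> w c a" if "s \<le> a" "a \<le> b" "b \<le> t" for a b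
    by (rule w_antimono[OF so']) (use that st q_np in auto)
  \<comment> \<open>Here u is the value and W the modulus of the flux at a point of [x, y]. Towards
    the maximum the slope is at most W / \<kappa> in modulus; on the other side it is at least W
    over a length at least \<delta>, and the solution stays positive there.\<close>
  have arith: "\<theta> * S \<le> u" if "S - u \<le> W / \<kappa>" "W * \<delta> \<le> u" for u W
  proof -
    have "\<theta> * (S - u) \<le> \<theta> * (W / \<kappa>)" using that \<theta> by (intro mult_left_mono) auto
    also have "\<dots> = W * \<delta> / 2" using \<kappa> by (simp add: \<theta>_def)
    finally have 1: "\<theta> * S \<le> u / 2 + \<theta> * u" using that by (simp add: algebra_simps)
    have "0 \<le> u"
    proof (rule ccontr)
      assume "\<not> 0 \<le> u"
      then have "W * \<delta> < 0" using that by linarith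
      then have "W < 0" using st by (simp add: mult_less_0_iff)
      then have "W / \<kappa> < 0" using \<kappa> by (simp add: divide_neg_pos)
      with that S \<open>\<not> 0 \<le> u\<close> show False by linarith
    qed
    then have "\<theta> * u \<le> u / 2" using \<kappa>\<delta> mult_right_mono[of \<theta> "1/2" u] by (simp add: \<theta>_def)
    with 1 show ?thesis by linarith
  qed
  have low: "\<theta> * S \<le> sol c r" if r: "r \<in> {x..y}" for r
  proof (cases "r \<le> x0")
    case True
    show ?thesis
    proof (cases "w c r \<le> 0")
      case np: True
      have "S \<le> sol c r" unfolding S_def
        by (rule sol_antimono[OF so']) (use np True r st x0 wanti[of r] in force)+
      then show ?thesis using \<theta> S mult_right_mono[of \<theta> 1 S] by linarith
    next
      case False
      have "S - sol c r \<le> w c r / r ^ n * (x0 - r)" unfolding S_def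
        by (rule sol_diff(3)[OF so']) (use False True r st x0 wanti[of r] in force)+
      also have "\<dots> \<le> w c r / \<kappa> * 1"
        using False True r st x0 by (intro mult_mono divide_left_mono) (auto simp: \<kappa>_def intro: power_mono)
      finally have 1: "S - sol c r \<le> w c r / \<kappa>" by simp
      have "w c r * \<delta> \<le> w c r * (r - s)" using False r st by (intro mult_left_mono) auto
      also have "\<dots> \<le> sol c r - sol c s"
        by (rule sol_diff(1)[OF so']) (use False r st wanti[of _ r] in force)+
      also have "\<dots> \<le> sol c r" using pos[of s] st by simp
      finally show ?thesis by (rule arith[OF 1])
    qed
  next
    case False
    then have xr: "x0 \<le> r" by simp
    show ?thesis
    proof (cases "0 \<le> w c r")
      case nn: True
      have "S \<le> sol c r" unfolding S_def
      proof (rule sol_mono[OF so'])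
        show "0 \<le> w c z" if "z \<in> {x0..r}" for z
          using nn wanti[of z r] that x0 r st by auto
      qed (use xr r st x0 in auto)
      then show ?thesis using \<theta> S mult_right_mono[of \<theta> 1 S] by linarith
    next
      case neg: False
      let ?W = "- w c r"
      have "- ?W / x0 ^ n * (r - x0) \<le> sol c r - sol c x0"
        by (rule sol_diff(4)[OF so']) (use neg xr r st x0 wanti[of _ r] in force)+
      then have "S - sol c r \<le> ?W / x0 ^ n * (r - x0)" by (simp add: S_def)
      also have "\<dots> \<le> ?W / \<kappa> * 1"
        using neg xr r st x0 \<kappa> by (intro mult_mono divide_left_mono) (auto simp: \<kappa>_def intro: power_mono divide_nonpos_pos)
      finally have 1: "S - sol c r \<le> ?W / \<kappa>" by simp
      have "sol c t - sol c r \<le> - ?W * (t - r)"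
        by (rule sol_diff(2)[OF so']) (use neg r st wanti[of r] in force)+
      then have "?W * (t - r) \<le> sol c r" using pos[of t] st by simp
      moreover have "?W * \<delta> \<le> ?W * (t - r)" using neg r st by (intro mult_left_mono) auto
      ultimately show ?thesis by (intro arith[OF 1]) linarith
    qed
  qed
  have "w c y - w c x \<le> - (\<kappa> * (k * (\<theta> * S) powr p)) * (y - x)"
  proof (rule w_diff(2)[OF so'])
    fix z assume z: "z \<in> {x..y}"
    have "(\<theta> * S) powr p \<le> pos_powr p (sol c z)"
      using pos_powr_mono[OF _ low[OF z], of p] p S \<theta> by (simp add: pos_powr_pos)
    moreover have "\<kappa> \<le> z ^ n" using z st unfolding \<kappa>_def by (intro power_mono) auto
    moreover have "k \<le> - q z" using k(2)[OF z] by simp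
    ultimately have "\<kappa> * (k * (\<theta> * S) powr p) \<le> z ^ n * (- q z * pos_powr p (sol c z))"
      using k \<kappa> z st by (intro mult_mono) auto
    then show "z ^ n * (q z * pos_powr p (sol c z)) \<le> - (\<kappa> * (k * (\<theta> * S) powr p))" by simp
  qed (use st in auto)
  moreover have "w c x * \<delta> \<le> S"
  proof (cases "w c x \<le> 0")
    case True
    then have "w c x * \<delta> \<le> 0" using st by (simp add: mult_nonpos_nonneg)
    then show ?thesis using S by linarith
  next
    case False
    have "w c x * \<delta> \<le> w c x * (x - s)" using False st by (intro mult_left_mono) auto
    also have "\<dots> \<le> sol c x - sol c s"
      by (rule sol_diff(1)[OF so']) (use False st wanti[of _ x] in force)+
    also have "\<dots> \<le> S" using pos[of s] max[of x] st by (simp add: S_def)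
    finally show ?thesis .
  qed
  moreover have "- w c y * \<delta> \<le> S"
  proof (cases "0 \<le> w c y")
    case True
    then have "- w c y * \<delta> \<le> 0" using st by simp
    then show ?thesis using S by linarith
  next
    case False
    have "sol c t - sol c y \<le> - (- w c y) * (t - y)"
      by (rule sol_diff(2)[OF so']) (use False st wanti[of y] in force)+
    then have "- w c y * (t - y) \<le> S" using pos[of t] max[of y] st by (simp add: S_def)
    moreover have "- w c y * \<delta> \<le> - w c y * (t - y)" using False st by (intro mult_left_mono) auto
    ultimately show ?thesis by linarith
  qed
  ultimately have "\<kappa> * (k * (\<theta> * S) powr p) * (y - x) * \<delta> \<le> 2 * S"
    using st mult_right_mono[of "\<kappa> * (k * (\<theta> * S) powr p) * (y - x)" "w c x - w c y" \<delta>] by (simp add: algebra_simps)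
  moreover have "(\<theta> * S) powr p = \<theta> powr p * (S powr (p - 1) * S)"
    using powr_add[of S 1 "p - 1"] S \<theta> by (simp add: powr_mult)
  ultimately have "(\<kappa> * k * \<theta> powr p * (y - x) * \<delta> * S powr (p - 1)) * S \<le> 2 * S" by (simp add: mult_ac)
  then have "\<kappa> * k * \<theta> powr p * (y - x) * \<delta> * S powr (p - 1) \<le> 2" using S by simp
  then have "S powr (p - 1) \<le> 2 / (\<delta> * (y - x) * \<kappa> * k * \<theta> powr p)"
    using \<kappa> k \<theta> st by (simp add: field_simps)
  then have "(S powr (p - 1)) powr (1 / (p - 1)) \<le> (2 / (\<delta> * (y - x) * \<kappa> * k * \<theta> powr p)) powr (1 / (p - 1))"
    using p by (intro powr_mono2) auto
  then have "S \<le> (2 / (\<delta> * (y - x) * \<kappa> * k * \<theta> powr p)) powr (1 / (p - 1))"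
    using p S by (simp add: powr_powr)
  with max[OF r] show ?thesis by (simp add: S_def \<kappa>_def \<theta>_def)
qed

text \<open>Read backwards from \<open>t\<close>: the point \<open>x\<close> is so close that the
  value stays at least \<delta> / 2 on [x, t]. The flux gained across [x1, x2] is then at least b +
  K, which in the application is achieved by a large \<mu> inside \<open>k\<close>. Ending at most
  at \<open>b\<close>, the flux must have started at or below - K.\<close>

lemma w_before_gap_end:
  assumes st: "0 \<le> s" "s < x" "x \<le> x1" "x1 < x2" "x2 \<le> t" "t \<le> 1"
    and q_nn: "\<And>r. r \<in> {x..t} \<Longrightarrow> 0 \<le> q r" and k: "0 < k" "\<And>r. r \<in> {x1..x2} \<Longrightarrow> k \<le> q r"
    and so: "solvable c t" and b: "0 < b" "w c t \<le> b" and \<delta>: "0 < \<delta>" "\<delta> < sol c t"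
    and x: "b / x ^ n * (t - x) \<le> \<delta> / 2"
    and large: "b + K \<le> k * (x1 ^ n * (\<delta> / 2) powr p * (x2 - x1))"
  shows "w c x \<le> - K" "\<delta> / 2 \<le> sol c x"
proof -
  have so': "solvable c r" if "r \<le> t" for r by (rule solvable_mono[OF so that])
  have mono: "w c a \<le> w c b" if "x \<le> a" "a \<le> b" "b \<le> t" for a b
    by (rule w_mono[OF so']) (use that st q_nn in auto)
  have low: "\<delta> / 2 \<le> sol c r" if r: "x \<le> r" "r \<le> t" for r
  proof -
    have "sol c t - sol c r \<le> b / r ^ n * (t - r)"
    proof (rule sol_diff(3)[OF so])
      show "w c z \<le> b" if "z \<in> {r..t}" for z
        using mono[of z t] that r b by auto
    qed (use r st b in auto)
    also have "\<dots> \<le> b / x ^ n * (t - x)"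
      using r st b by (intro mult_mono divide_left_mono power_mono) auto
    finally show ?thesis using x \<delta> by linarith
  qed
  have "k * (x1 ^ n * (\<delta> / 2) powr p) * (x2 - x1) \<le> w c x2 - w c x1"
  proof (rule w_diff(1)[OF so'])
    fix z assume z: "z \<in> {x1..x2}"
    have "(\<delta> / 2) powr p \<le> pos_powr p (sol c z)"
      using pos_powr_mono[OF _ low[of z], of p] p \<delta> z st by (simp add: pos_powr_pos)
    moreover have "x1 ^ n \<le> z ^ n" using z st by (intro power_mono) auto
    moreover have "0 \<le> q z" using k(1) k(2)[OF z] by simp
    ultimately have "x1 ^ n * (k * (\<delta> / 2) powr p) \<le> z ^ n * (q z * pos_powr p (sol c z))"
      using k z st by (intro mult_mono) auto
    then show "k * (x1 ^ n * (\<delta> / 2) powr p) \<le> z ^ n * (q z * pos_powr p (sol c z))" by (simp add: mult_ac)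
  qed (use st in auto)
  moreover have "w c x2 \<le> b" using mono[of x2 t] st b by linarith
  moreover have "w c x \<le> w c x1" using mono st by auto
  ultimately show "w c x \<le> - K" using large by (simp add: mult.assoc)
  show "\<delta> / 2 \<le> sol c x" using low st by auto
qed

text \<open>The flux never exceeds \<open>b\<close>, so the value stays below M = b (1 + 1 / s^n)
  and the flux loses at most A M^p. This loss is superlinear in \<open>b\<close>, hence at most b /
  2 for small \<open>b\<close>. In the application \<open>A\<close> bounds |a|, so \<open>b\<close>
  can be fixed before \<mu>.\<close>

lemma w_bump_lower:
  assumes st: "0 < s" "s \<le> t" "t \<le> 1" and q: "\<And>r. r \<in> {s..t} \<Longrightarrow> q r \<le> 0 \<and> - A \<le> q r"
    and so: "solvable c t" and b: "0 < b" "w c s = b" "sol c s \<le> b"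
    and small: "A * (b * (1 + 1 / s ^ n)) powr p \<le> b / 2" and r: "r \<in> {s..t}"
  shows "b / 2 \<le> w c r"
proof -
  have so': "solvable c r" if "r \<le> t" for r by (rule solvable_mono[OF so that])
  have A: "0 \<le> A" using q[of s] st by auto
  have anti: "w c z \<le> b" if "s \<le> z" "z \<le> t" for z
    unfolding b(2)[symmetric] by (rule w_antimono[OF so']) (use that st q in auto)
  let ?M = "b * (1 + 1 / s ^ n)"
  have sn: "0 < s ^ n" using st by simp
  have up: "sol c z \<le> ?M" if z: "s \<le> z" "z \<le> t" for z
  proof -
    have "sol c z - sol c s \<le> b / s ^ n * (z - s)"
      by (rule sol_diff(3)[OF so']) (use z st b anti in auto)
    also have "\<dots> \<le> b / s ^ n * 1" using z st b by (intro mult_left_mono) auto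
    finally show ?thesis using b by (simp add: algebra_simps)
  qed
  have M: "0 < ?M" using b sn by (intro mult_pos_pos add_pos_pos) auto
  have "- (A * ?M powr p) * (r - s) \<le> w c r - w c s"
  proof (rule w_diff(1)[OF so'])
    fix z assume z: "z \<in> {s..r}"
    have "pos_powr p (sol c z) \<le> ?M powr p"
      using pos_powr_mono[OF _ up[of z], of p] p M z r by (simp add: pos_powr_pos)
    moreover have "- q z \<le> A" "0 \<le> - q z" using q[of z] z r by auto
    ultimately have "- q z * pos_powr p (sol c z) \<le> A * ?M powr p"
      using A by (intro mult_mono) auto
    moreover have "z ^ n * (- q z * pos_powr p (sol c z)) \<le> - q z * pos_powr p (sol c z)"
      using z st r q[of z] by (intro mult_left_le_one_le mult_nonneg_nonneg) (auto intro: power_le_one)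
    ultimately show "- (A * ?M powr p) \<le> z ^ n * (q z * pos_powr p (sol c z))" by simp
  qed (use st r in auto)
  moreover have "A * ?M powr p * (r - s) \<le> A * ?M powr p * 1"
    using A r st by (intro mult_left_mono) auto
  ultimately show ?thesis using small b by simp
qed

end

section \<open>Shooting\<close>

lemma powr_eventually_ge:
  fixes p k Z :: real
  assumes "1 < p" "0 < k"
  obtains d where "0 < d" "\<And>x. d \<le> x \<Longrightarrow> Z \<le> k * x powr (p - 1)"
proof
  let ?d = "max 1 ((max Z 0 / k) powr (1 / (p - 1)))"
  show "0 < ?d" by simp
  fix x assume x: "?d \<le> x"
  have "max Z 0 / k = ((max Z 0 / k) powr (1 / (p - 1))) powr (p - 1)"
    using assms by (simp add: powr_powr)
  also have "\<dots> \<le> x powr (p - 1)" using x assms by (intro powr_mono2) auto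
  finally show "Z \<le> k * x powr (p - 1)" using assms by (simp add: field_simps)
qed

lemma superlinear_small:
  fixes p A C :: real
  assumes p: "1 < p" and A: "0 \<le> A" and C: "0 < C"
  obtains b where "0 < b" "A * (b * C) powr p \<le> b / 2"
proof -
  obtain d where d: "0 < d" "\<And>x. d \<le> x \<Longrightarrow> 2 * A * C powr p \<le> 1 * x powr (p - 1)"
    using powr_eventually_ge[OF p zero_less_one] by blast
  show thesis
  proof (rule that[of "1 / d"])
    have "2 * A * C powr p * (1 / d) powr (p - 1) \<le> d powr (p - 1) * (1 / d) powr (p - 1)"
      using d by (intro mult_right_mono) auto
    also have "\<dots> = 1" using d(1) by (simp add: powr_divide)
    finally have 1: "2 * A * C powr p * (1 / d) powr (p - 1) \<le> 1" .
    have "(1 / d * C) powr p = (1 / d) powr p * C powr p"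
      using d(1) C by (intro powr_mult)
    also have "(1 / d) powr p = (1 / d) powr (p - 1) * (1 / d)"
      using powr_add[of "1 / d" "p - 1" 1] d(1) by simp
    finally have "(1 / d * C) powr p = (1 / d) powr (p - 1) * (1 / d) * C powr p" .
    then have "A * (1 / d * C) powr p = (2 * A * C powr p * (1 / d) powr (p - 1)) * (1 / d) / 2" by simp
    also have "\<dots> \<le> 1 * (1 / d) / 2" using 1 d(1) by (intro divide_right_mono mult_right_mono) auto
    finally show "A * (1 / d * C) powr p \<le> 1 / d / 2" by simp
  qed (use d in simp)
qed

text \<open>The infimum of the failures is itself a failure, because success is an open
  condition.\<close>

lemma first_failure:
  fixes P :: "real \<Rightarrow> bool"
  assumes P0: "P 0" and P1: "\<not> P 1" and op: "\<And>\<theta>. 0 \<le> \<theta> \<Longrightarrow> \<theta> \<le> 1 \<Longrightarrow> P \<theta> \<Longrightarrow> eventually P (nhds \<theta>)"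
  obtains \<Theta> where "0 < \<Theta>" "\<Theta> \<le> 1" "\<not> P \<Theta>" "\<And>\<theta>. 0 \<le> \<theta> \<Longrightarrow> \<theta> < \<Theta> \<Longrightarrow> P \<theta>"
proof -
  let ?N = "{\<theta> \<in> {0..1}. \<not> P \<theta>}"
  have ne: "?N \<noteq> {}" using P1 by auto
  have bdd: "bdd_below ?N" by (rule bdd_belowI[of _ 0]) auto
  let ?T = "Inf ?N"
  have T: "0 \<le> ?T" "?T \<le> 1" using cInf_greatest[OF ne, of 0] cInf_lower[OF _ bdd, of 1] P1 by auto
  have lt: "P \<theta>" if "0 \<le> \<theta>" "\<theta> < ?T" for \<theta>
    using cInf_lower[OF _ bdd, of \<theta>] that T by force
  have nT: "\<not> P ?T"
  proof
    assume "P ?T"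
    from op[OF T this] obtain e where e: "0 < e" "\<And>\<theta>. dist \<theta> ?T < e \<Longrightarrow> P \<theta>"
      unfolding eventually_nhds_metric by blast
    have "?T + e \<le> \<theta>" if "\<theta> \<in> ?N" for \<theta>
      using cInf_lower[OF that bdd] e(2)[of \<theta>] that by (force simp: dist_real_def)
    then have "?T + e \<le> ?T" using cInf_greatest[OF ne] by blast
    with e show False by simp
  qed
  have "?T \<noteq> 0"
  proof
    assume "?T = 0"
    with nT P0 show False by simp
  qed
  with T have "0 < ?T" by simp
  from that[OF this T(2) nT lt] show thesis by blast
qed

section \<open>The indefinite weight, shooting intervals and the doubling of their number\<close>

locale indefinite_weight =
  fixes a :: "real \<Rightarrow> real" and p :: real and n :: nat
  assumes p: "1 < p" and a_cont: "continuous_on {0..1} a" and zeros: "finite {r \<in> {0<..<1}. a r = 0}"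
begin

text \<open>The sign is opposite to that of \<open>weight\<close>, the term having moved to the
  right-hand side. On bumps \<mu> drops out, which makes the bounds there uniform in \<mu>.\<close>

definition Q :: "real \<Rightarrow> real \<Rightarrow> real" where
  "Q \<mu> r = \<mu> * max (- a r) 0 - max (a r) 0"

abbreviation solv :: "real \<Rightarrow> real \<Rightarrow> real \<Rightarrow> bool" where
  "solv \<mu> \<equiv> power_ivp.solvable n (Q \<mu>) p"

abbreviation so :: "real \<Rightarrow> real \<Rightarrow> real \<Rightarrow> real" where
  "so \<mu> \<equiv> power_ivp.sol n (Q \<mu>) p"

lemma power_ivp: "power_ivp (Q \<mu>) p"
proof
  show "continuous_on {0..1} (Q \<mu>)"
    unfolding Q_def by (intro continuous_intros a_cont)
qed (rule p)

lemma Q_gap: "a r \<le> 0 \<Longrightarrow> Q \<mu> r = - \<mu> * a r"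
  by (simp add: Q_def)

lemma Q_nonneg: "a r \<le> 0 \<Longrightarrow> 0 < \<mu> \<Longrightarrow> 0 \<le> Q \<mu> r"
  by (simp add: Q_gap mult_nonneg_nonpos)

lemma Q_ge:
  assumes "a r \<le> 0" "0 < \<mu>" "k \<le> \<bar>a r\<bar>"
  shows "\<mu> * k \<le> Q \<mu> r"
  using assms mult_left_mono[of k "- a r" \<mu>] by (simp add: Q_gap)

lemma Q_bump: "0 \<le> a r \<Longrightarrow> Q \<mu> r = - a r"
  by (simp add: Q_def)

text \<open>Finitely many zeros leave in every subinterval a point where \<open>a\<close> does not
  vanish, and continuity gives an interval to its right. This provides the constant \<open>k\<close>
  of the quantitative estimates.\<close>

lemma bounded_away:
  assumes st: "0 \<le> s" "s < t" "t \<le> 1"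
  obtains x y k where "s < x" "x < y" "y < t" "0 < k" "\<And>r. r \<in> {x..y} \<Longrightarrow> k \<le> \<bar>a r\<bar>"
proof -
  have "infinite ({s<..<t} - {r \<in> {0<..<1}. a r = 0})"
    using st zeros by (intro Diff_infinite_finite) auto
  then obtain r0 where "r0 \<in> {s<..<t} - {r \<in> {0<..<1}. a r = 0}"
    by (metis finite.emptyI equals0I)
  then have r0: "s < r0" "r0 < t" "a r0 \<noteq> 0" using st by auto
  have "continuous_on {0..1} (\<lambda>r. \<bar>a r\<bar>)" by (intro continuous_intros a_cont)
  then have "((\<lambda>r. \<bar>a r\<bar>) \<longlongrightarrow> \<bar>a r0\<bar>) (at r0 within {0..1})"
    using r0 st by (auto simp: continuous_on)
  then have "\<forall>\<^sub>F r in at r0 within {0..1}. \<bar>a r0\<bar> / 2 < \<bar>a r\<bar>"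
    by (rule order_tendstoD) (use r0 in simp)
  then obtain e where e: "0 < e" "\<And>r. r \<in> {0..1} \<Longrightarrow> r \<noteq> r0 \<Longrightarrow> dist r r0 < e \<Longrightarrow> \<bar>a r0\<bar> / 2 < \<bar>a r\<bar>"
    unfolding eventually_at by blast
  define y where "y = min ((r0 + t) / 2) (r0 + e / 2)"
  have y: "r0 < y" "y < t" "y < r0 + e" using r0 e by (auto simp: y_def min_def field_simps)
  show thesis
  proof (rule that[of r0 y "\<bar>a r0\<bar> / 2"])
    fix r assume r: "r \<in> {r0..y}"
    show "\<bar>a r0\<bar> / 2 \<le> \<bar>a r\<bar>"
    proof (cases "r = r0")
      case False
      then show ?thesis using r y r0 st by (intro less_imp_le e(2)) (auto simp: dist_real_def)
    qed simp
  qed (use r0 y in auto)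
qed

definition boundary_blowup :: "real \<Rightarrow> real \<Rightarrow> bool" where
  "boundary_blowup \<mu> c \<longleftrightarrow> (\<forall>r<1. solv \<mu> c r) \<and> \<not> solv \<mu> c 1"

text \<open>A shooting interval for the gap \<open>[s, t]\<close> joins a parameter \<open>z\<close> whose solution has vanished
  by \<open>t\<close> to a parameter \<open>b\<close> whose solution blows up in \<open>]s, t[\<close>, and no solution in between blows up
  up to \<open>s\<close>.\<close>

definition shooting_interval :: "real \<Rightarrow> real \<Rightarrow> real \<Rightarrow> real \<Rightarrow> real \<Rightarrow> bool" where
  "shooting_interval \<mu> s t z b \<longleftrightarrow> 0 \<le> z \<and> 0 \<le> b \<and> solv \<mu> z t \<and> so \<mu> z t \<le> 0 \<and>
     (\<exists>\<rho><t. \<not> solv \<mu> b \<rho>) \<and> (\<forall>c\<in>closed_segment z b. solv \<mu> c s)"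

text \<open>\<open>k\<close> stands for the number of bumps to the right of the gap. Quantifying
  over all shooting intervals lets the induction hypothesis serve both intervals produced for the
  next gap.\<close>

definition many_blowups :: "real \<Rightarrow> real \<Rightarrow> real \<Rightarrow> nat \<Rightarrow> bool" where
  "many_blowups \<mu> s t k \<longleftrightarrow> (\<forall>z b. shooting_interval \<mu> s t z b \<longrightarrow>
     (\<exists>C. card C = 2 ^ k \<and> C \<subseteq> open_segment z b \<and> (\<forall>c\<in>C. boundary_blowup \<mu> c)))"

text \<open>Parametrising from \<open>z\<close> to \<open>b\<close> treats z < b and b < z alike.
  Both orders occur, because of the two intervals produced at each stage one has its vanishing end
  on the far side of its blow-up end.\<close>

lemma shooting_path:
  assumes si: "shooting_interval \<mu> s t z b" and st: "0 \<le> s" "s \<le> t" "t \<le> 1"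
  obtains \<Theta> where "0 < \<Theta>" "\<Theta> \<le> 1" "\<not> solv \<mu> (z + \<Theta> * (b - z)) t"
    "\<And>\<theta>. 0 \<le> \<theta> \<Longrightarrow> \<theta> < \<Theta> \<Longrightarrow> solv \<mu> (z + \<theta> * (b - z)) t"
    "\<And>\<theta>. 0 \<le> \<theta> \<Longrightarrow> \<theta> \<le> 1 \<Longrightarrow> solv \<mu> (z + \<theta> * (b - z)) s \<and> 0 \<le> z + \<theta> * (b - z)"
proof -
  interpret power_ivp n "Q \<mu>" p by (rule power_ivp)
  let ?c = "\<lambda>\<theta>. z + \<theta> * (b - z)"
  have seg: "solvable (?c \<theta>) s \<and> 0 \<le> ?c \<theta>" if "0 \<le> \<theta>" "\<theta> \<le> 1" for \<theta>
  proof
    have "?c \<theta> = (1 - \<theta>) * z + \<theta> * b" by (simp add: algebra_simps)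
    then show "0 \<le> ?c \<theta>" using si that by (simp add: shooting_interval_def)
    have "?c \<theta> \<in> closed_segment z b"
      unfolding closed_segment_def using that by (auto intro!: exI[of _ \<theta>] simp: algebra_simps)
    then show "solvable (?c \<theta>) s" using si by (simp add: shooting_interval_def)
  qed
  obtain \<Theta> where "0 < \<Theta>" "\<Theta> \<le> 1" "\<not> solvable (?c \<Theta>) t" "\<And>\<theta>. 0 \<le> \<theta> \<Longrightarrow> \<theta> < \<Theta> \<Longrightarrow> solvable (?c \<theta>) t"
  proof (rule first_failure[of "\<lambda>\<theta>. solvable (?c \<theta>) t"])
    show "solvable (?c 0) t" using si by (simp add: shooting_interval_def)
    show "\<not> solvable (?c 1) t" using si solvable_mono[of b t] by (auto simp: shooting_interval_def)
    fix \<theta> assume "solvable (?c \<theta>) t"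
    from eventually_solvable[OF this] st have "eventually (\<lambda>d. solvable d t) (nhds (?c \<theta>))" by simp
    moreover have "filterlim ?c (nhds (?c \<theta>)) (nhds \<theta>)"
      by (intro tendsto_intros filterlim_ident)
    ultimately show "eventually (\<lambda>\<theta>. solvable (?c \<theta>) t) (nhds \<theta>)"
      by (auto simp: filterlim_iff)
  qed blast
  with seg that show thesis by blast
qed

text \<open>Transfers the growth before the blow-up radius to parameters slightly below \<Theta>: at
  one fixed r < T value and flux are continuous in the parameter.\<close>

lemma near_blowup:
  assumes st: "0 \<le> s" "s < T" "T \<le> 1" and gap: "\<And>r. r \<in> {s..T} \<Longrightarrow> a r \<le> 0" and \<mu>: "0 < \<mu>"
    and \<Theta>: "0 < \<Theta>" and T: "\<And>r. r < T \<Longrightarrow> solv \<mu> (z + \<Theta> * (b - z)) r" "\<not> solv \<mu> (z + \<Theta> * (b - z)) T"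
  obtains r \<theta> where "s < r" "r < T" "0 < \<theta>" "\<theta> < \<Theta>" "K < so \<mu> (z + \<theta> * (b - z)) r"
    "K < power_ivp.w n (Q \<mu>) p (z + \<theta> * (b - z)) r"
proof -
  interpret power_ivp n "Q \<mu>" p by (rule power_ivp)
  let ?c = "\<lambda>\<theta>. z + \<theta> * (b - z)"
  have "0 \<le> Q \<mu> x" if "x \<in> {s..<T}" for x
    using gap[of x] \<mu> that by (simp add: Q_gap mult_nonneg_nonpos)
  with blowup_unbounded[OF st T, of K] obtain r where r: "s < r" "r < T"
    and big: "K < sol (?c \<Theta>) r" "K < w (?c \<Theta>) r" by (metis order_refl)
  have ct: "isCont ?c \<Theta>" by (intro continuous_intros)
  have r1: "0 \<le> r" "r \<le> 1" using r st by auto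
  have "isCont (\<lambda>\<theta>. sol (?c \<theta>) r) \<Theta>" "isCont (\<lambda>\<theta>. w (?c \<theta>) r) \<Theta>"
    using isCont_o2[OF ct isCont_sol[OF T(1)[OF r(2)] r1]] isCont_o2[OF ct isCont_w[OF T(1)[OF r(2)] r1]] by auto
  then have "\<forall>\<^sub>F \<theta> in at \<Theta>. K < sol (?c \<theta>) r" "\<forall>\<^sub>F \<theta> in at \<Theta>. K < w (?c \<theta>) r"
    using big by (auto simp: isCont_def order_tendsto_iff)
  then have "\<forall>\<^sub>F \<theta> in at_left \<Theta>. K < sol (?c \<theta>) r \<and> K < w (?c \<theta>) r"
    unfolding eventually_at_split by (auto elim: eventually_elim2)
  moreover have "\<forall>\<^sub>F \<theta> in at_left \<Theta>. \<theta> \<in> {0<..<\<Theta>}" by (rule eventually_at_leftI[OF _ \<Theta>]) auto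
  ultimately have "\<forall>\<^sub>F \<theta> in at_left \<Theta>. (K < sol (?c \<theta>) r \<and> K < w (?c \<theta>) r) \<and> \<theta> \<in> {0<..<\<Theta>}"
    by (rule eventually_conj)
  then obtain \<theta> where "K < sol (?c \<theta>) r" "K < w (?c \<theta>) r" "0 < \<theta>" "\<theta> < \<Theta>"
    using eventually_happens'[OF trivial_limit_at_left_real] by (metis (no_types, lifting) greaterThanLessThan_iff)
  with r show thesis using that by blast
qed

text \<open>If the solution at \<Theta> blew up at T < 1, slightly smaller parameters would give,
  before T, a value so large with positive flux that they could not reach radius 1 either, against
  the minimality of \<Theta>.\<close>

lemma many_blowups_last_gap:
  assumes s: "0 \<le> s" "s < 1" and gap: "\<And>r. r \<in> {s..1} \<Longrightarrow> a r \<le> 0" and \<mu>: "0 < \<mu>"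
  shows "many_blowups \<mu> s 1 0"
  unfolding many_blowups_def
proof (intro allI impI)
  fix z b assume si: "shooting_interval \<mu> s 1 z b"
  interpret power_ivp n "Q \<mu>" p by (rule power_ivp)
  let ?c = "\<lambda>\<theta>. z + \<theta> * (b - z)"
  obtain \<Theta> where \<Theta>: "0 < \<Theta>" "\<Theta> \<le> 1" "\<not> solvable (?c \<Theta>) 1"
    "\<And>\<theta>. 0 \<le> \<theta> \<Longrightarrow> \<theta> < \<Theta> \<Longrightarrow> solvable (?c \<theta>) 1" 
    and seg: "\<And>\<theta>. 0 \<le> \<theta> \<Longrightarrow> \<theta> \<le> 1 \<Longrightarrow> solvable (?c \<theta>) s \<and> 0 \<le> ?c \<theta>"
    using shooting_path[OF si] s by (metis less_imp_le order_refl)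
  have "solvable (?c \<Theta>) s" using seg[of \<Theta>] \<Theta> by auto
  then obtain T where T: "s < T" "T \<le> 1" "\<And>r. r < T \<Longrightarrow> solvable (?c \<Theta>) r" "\<not> solvable (?c \<Theta>) T"
    using blowup_time[OF _ \<Theta>(3)] s by auto
  have Q: "0 \<le> Q \<mu> r" if "r \<in> {s..1}" for r
    using gap[OF that] \<mu> by (simp add: Q_gap mult_nonneg_nonpos)
  have "T = 1"
  proof (rule ccontr)
    assume "T \<noteq> 1"
    with T have T1: "T < 1" by simp
    obtain x y k where xy: "T < x" "x < y" "y < 1" "0 < k" "\<And>r. r \<in> {x..y} \<Longrightarrow> k \<le> \<bar>a r\<bar>"
      using bounded_away[of T 1] T1 T s by auto
    have kQ: "\<mu> * k \<le> Q \<mu> r" if "r \<in> {x..y}" for r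
      by (rule Q_ge[OF gap \<mu> xy(5)[OF that]]) (use that xy T s in auto)
    obtain d where d: "0 < d" "4 / (x ^ n * ((y - x) * (1 - 2 powr ((1 - p) / 2))) ^ 2) \<le> \<mu> * k * d powr (p - 1)"
      using powr_eventually_ge[OF p, of "\<mu> * k"] \<mu> xy by (metis mult_pos_pos order_refl)
    obtain r \<theta> where r: "s < r" "r < T" "0 < \<theta>" "\<theta> < \<Theta>" "d < sol (?c \<theta>) r" "d < w (?c \<theta>) r"
      using near_blowup[of s T \<mu> \<Theta> z b d] s T gap \<mu> \<Theta> by auto
    have "\<not> solvable (?c \<theta>) 1"
    proof (rule blowup_in_gap[OF _ _ _ xy(2) _ _ _ _ kQ _ d(1) _ _ d(2)])
      show "solvable (?c \<theta>) r" using solvable_mono[OF \<Theta>(4)[of \<theta>]] r T1 by auto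
      show "0 \<le> Q \<mu> r'" if "r' \<in> {r..1}" for r' using Q that r by auto
    qed (use r xy T s \<mu> d in auto)
    with \<Theta>(4)[of \<theta>] r show False by auto
  qed
  have "?c \<Theta> \<in> open_segment z b"
  proof -
    have "?c \<Theta> \<noteq> b" using si T \<open>T = 1\<close> by (auto simp: shooting_interval_def)
    moreover have "?c \<Theta> \<noteq> z" using si \<Theta> by (auto simp: shooting_interval_def)
    moreover have "?c \<Theta> \<in> closed_segment z b"
      unfolding closed_segment_def using \<Theta> by (auto intro!: exI[of _ \<Theta>] simp: algebra_simps)
    ultimately show ?thesis by (simp add: open_segment_def)
  qed
  moreover have "boundary_blowup \<mu> (?c \<Theta>)"
    unfolding boundary_blowup_def using T \<open>T = 1\<close> by simp
  ultimately show "\<exists>C. card C = 2 ^ 0 \<and> C \<subseteq> open_segment z b \<and> (\<forall>c\<in>C. boundary_blowup \<mu> c)"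
    by (intro exI[of _ "{?c \<Theta>}"]) auto
qed

lemma bump_bound:
  assumes st: "0 < s" "s < t" "t \<le> 1" and bump: "\<And>r. r \<in> {s..t} \<Longrightarrow> 0 \<le> a r"
  obtains M where "0 \<le> M" "\<And>\<mu> c r. solv \<mu> c t \<Longrightarrow> (\<And>r. r \<in> {s..t} \<Longrightarrow> 0 < so \<mu> c r) \<Longrightarrow> r \<in> {s..t} \<Longrightarrow> so \<mu> c r \<le> M"
proof -
  obtain x y k where xy: "s < x" "x < y" "y < t" "0 < k" "\<And>r. r \<in> {x..y} \<Longrightarrow> k \<le> \<bar>a r\<bar>"
    using bounded_away[of s t] st by auto
  define \<delta> where "\<delta> = min (x - s) (t - y)"
  have \<delta>: "0 < \<delta>" "s + \<delta> \<le> x" "y + \<delta> \<le> t" using xy by (auto simp: \<delta>_def)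
  let ?M = "(2 / (\<delta> * (y - x) * s ^ n * k * (s ^ n * \<delta> / 2) powr p)) powr (1 / (p - 1))"
  show thesis
  proof (rule that[of ?M])
    fix \<mu> c r assume c: "solv \<mu> c t" "\<And>r. r \<in> {s..t} \<Longrightarrow> 0 < so \<mu> c r" and r: "r \<in> {s..t}"
    show "so \<mu> c r \<le> ?M"
    proof (rule power_ivp.sol_bump_bound[OF power_ivp st(1) \<delta>(1,2) xy(2) \<delta>(3) st(3) _ xy(4) _ c r])
      show "Q \<mu> r \<le> 0" if "r \<in> {s..t}" for r using bump[OF that] by (simp add: Q_bump)
      show "Q \<mu> r \<le> - k" if "r \<in> {x..y}" for r using bump[of r] xy(5)[OF that] that xy by (simp add: Q_bump)
    qed
  qed simp
qed

text \<open>All constants down to \<open>d\<close> and \<open>k2\<close> are fixed before \<mu>0 and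
  do not depend on \<mu>. The hypothesis \<open>before\<close> supplies a bump to the left, on which
  entry values are bounded; for a gap starting at the origin the zero flux there takes over this
  role.\<close>

lemma many_blowups_step:
  assumes st: "0 \<le> s" "s < t" "t < t'" "t' < t''" "t'' \<le> 1"
    and gap1: "\<And>r. r \<in> {s..t} \<Longrightarrow> a r \<le> 0" and bump: "\<And>r. r \<in> {t..t'} \<Longrightarrow> 0 \<le> a r"
    and gap2: "\<And>r. r \<in> {t'..t''} \<Longrightarrow> a r \<le> 0"
    and before: "s = 0 \<or> (\<exists>s0. 0 < s0 \<and> s0 < s \<and> (\<forall>r\<in>{s0..s}. 0 \<le> a r))"
  obtains \<mu>0 where "0 < \<mu>0" "\<And>\<mu>. \<mu>0 < \<mu> \<Longrightarrow> many_blowups \<mu> t' t'' k \<Longrightarrow> many_blowups \<mu> s t (Suc k)"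
proof -
  have t01: "0 < t" "t \<le> 1" "0 < t'" "t' \<le> 1" using st by auto
  obtain M where M: "0 \<le> M" "\<And>\<mu> c r. solv \<mu> c t' \<Longrightarrow> (\<And>r. r \<in> {t..t'} \<Longrightarrow> 0 < so \<mu> c r) \<Longrightarrow>
      r \<in> {t..t'} \<Longrightarrow> so \<mu> c r \<le> M"
    using bump_bound[OF t01(1) st(3) t01(4) bump] by blast
  have "\<exists>M0\<ge>0. s = 0 \<or> (\<forall>\<mu> c. solv \<mu> c s \<longrightarrow> (\<forall>r\<in>{0..s}. 0 < so \<mu> c r) \<longrightarrow> so \<mu> c s \<le> M0)"
  proof (cases "s = 0")
    case False
    with before obtain s0 where s0: "0 < s0" "s0 < s" "\<And>r. r \<in> {s0..s} \<Longrightarrow> 0 \<le> a r" by blast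
    obtain M0 where "0 \<le> M0" "\<And>\<mu> c r. solv \<mu> c s \<Longrightarrow> (\<And>r. r \<in> {s0..s} \<Longrightarrow> 0 < so \<mu> c r) \<Longrightarrow>
        r \<in> {s0..s} \<Longrightarrow> so \<mu> c r \<le> M0"
      using bump_bound[OF s0(1,2) _ s0(3)] st by auto
    with s0 show ?thesis by (intro exI[of _ M0]) auto
  qed auto
  then obtain M0 where M0: "0 \<le> M0"
    "\<And>\<mu> c. s \<noteq> 0 \<Longrightarrow> solv \<mu> c s \<Longrightarrow> (\<forall>r\<in>{0..s}. 0 < so \<mu> c r) \<Longrightarrow> so \<mu> c s \<le> M0" by blast
  have "bounded (a ` {0..1})"
    by (rule compact_imp_bounded[OF compact_continuous_image[OF a_cont compact_Icc]])
  then obtain A where "\<forall>y\<in>a ` {0..1}. norm y \<le> A" unfolding bounded_iff by blast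
  then have A: "\<bar>a r\<bar> \<le> A" if "r \<in> {0..1}" for r using that by simp
  have A0: "0 \<le> A" using A[of 0] by simp
  obtain \<beta> where \<beta>: "0 < \<beta>" "A * (\<beta> * (1 + 1 / t ^ n)) powr p \<le> \<beta> / 2"
    using superlinear_small[OF p A0, of "1 + 1 / t ^ n"] t01 by (auto simp: add_pos_pos)
  \<comment> \<open>Two demands: x lies in the right half of the gap, and t - x is so small that a
    slope \<beta> / x^n changes the value by at most \<beta> / 2 on [x, t].\<close>
  define x where "x = max ((s + t) / 2) (t - (t / 2) ^ n / 2)"
  have "(s + t) / 2 \<le> x" "t - (t / 2) ^ n / 2 \<le> x" by (simp_all only: x_def max.cobounded1 max.cobounded2)
  moreover have "x < t" using st t01 by (simp add: x_def)
  ultimately have x: "s < x" "x < t" "t / 2 \<le> x" "t - x \<le> (t / 2) ^ n / 2" using st by (auto simp: field_simps)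
  have "(t / 2) ^ n \<le> x ^ n" using x t01 by (intro power_mono) auto
  moreover have "0 < x ^ n" using x t01 by simp
  ultimately have x_close: "\<beta> / x ^ n * (t - x) \<le> \<beta> / 2"
  proof -
    have "\<beta> * (t - x) \<le> \<beta> * (x ^ n / 2)"
      using x \<open>(t / 2) ^ n \<le> x ^ n\<close> \<beta> by (intro mult_left_mono) auto
    then show ?thesis using \<open>0 < x ^ n\<close> by (simp add: field_simps)
  qed
  obtain x1 x2 k1 where x12: "x < x1" "x1 < x2" "x2 < t" "0 < k1" "\<And>r. r \<in> {x1..x2} \<Longrightarrow> k1 \<le> \<bar>a r\<bar>"
    using bounded_away[of x t] x st by auto
  \<comment> \<open>A flux at most - K on [s, x] lowers the value by at least M0 + 1 and so forces
    an entry value above M0.\<close>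
  define K where "K = (M0 + 1) / (x - s)"
  have K: "0 < K" using M0 x by (simp add: K_def)
  \<comment> \<open>The height gained on the bump by a solution whose flux stays at least \<beta> /
    2.\<close>
  define d where "d = \<beta> / 2 * (t' - t)"
  have d: "0 < d" using \<beta> st by (simp add: d_def)
  \<comment> \<open>The blow-up has to take place strictly inside the next gap, as
    \<open>shooting_interval\<close> demands.\<close>
  define \<rho> where "\<rho> = (t' + t'') / 2"
  have \<rho>: "t' < \<rho>" "\<rho> < t''" using st by (auto simp: \<rho>_def)
  obtain y1 y2 k2 where y12: "t' < y1" "y1 < y2" "y2 < \<rho>" "0 < k2" "\<And>r. r \<in> {y1..y2} \<Longrightarrow> k2 \<le> \<bar>a r\<bar>"
    using bounded_away[of t' \<rho>] \<rho> st by auto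
  \<comment> \<open>The second entry makes the flux gained across [x1, x2] at least \<beta> + K; the
    third makes a solution of height \<open>d\<close> blow up in the next gap by \<rho>.\<close>
  define \<mu>0 where "\<mu>0 = max 1 (max ((\<beta> + K) / (k1 * (x1 ^ n * (\<beta> / 2) powr p * (x2 - x1))))
    (4 / (y1 ^ n * ((y2 - y1) * (1 - 2 powr ((1 - p) / 2))) ^ 2) / (k2 * d powr (p - 1))))"
  show thesis
  proof (rule that[of \<mu>0])
    show "0 < \<mu>0" by (simp add: \<mu>0_def)
    fix \<mu> assume \<mu>: "\<mu>0 < \<mu>" and IH: "many_blowups \<mu> t' t'' k"
    have \<mu>_pos: "0 < \<mu>" using \<mu> by (auto simp: \<mu>0_def)
    have \<mu>1: "\<beta> + K \<le> \<mu> * k1 * (x1 ^ n * (\<beta> / 2) powr p * (x2 - x1))"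
    proof -
      have "(\<beta> + K) / (k1 * (x1 ^ n * (\<beta> / 2) powr p * (x2 - x1))) \<le> \<mu>" using \<mu> by (auto simp: \<mu>0_def)
      moreover have "0 < k1 * (x1 ^ n * (\<beta> / 2) powr p * (x2 - x1))" using x12 x t01 \<beta> by auto
      ultimately show ?thesis by (simp add: pos_divide_le_eq mult.assoc)
    qed
    have \<mu>2: "4 / (y1 ^ n * ((y2 - y1) * (1 - 2 powr ((1 - p) / 2))) ^ 2) \<le> \<mu> * k2 * d powr (p - 1)"
    proof -
      have "4 / (y1 ^ n * ((y2 - y1) * (1 - 2 powr ((1 - p) / 2))) ^ 2) / (k2 * d powr (p - 1)) \<le> \<mu>"
        using \<mu> by (auto simp: \<mu>0_def)
      moreover have "0 < k2 * d powr (p - 1)" using y12 d by auto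
      ultimately show ?thesis by (simp only: pos_divide_le_eq mult.assoc)
    qed
    interpret power_ivp n "Q \<mu>" p by (rule power_ivp)
    have Q1: "0 \<le> Q \<mu> r" if "r \<in> {s..t}" for r using Q_nonneg[OF gap1[OF that] \<mu>_pos] .
    have Q2: "0 \<le> Q \<mu> r" if "r \<in> {t'..t''}" for r using Q_nonneg[OF gap2[OF that] \<mu>_pos] .
    have Qb: "Q \<mu> r \<le> 0 \<and> - A \<le> Q \<mu> r" if "r \<in> {t..t'}" for r
      using bump[OF that] A[of r] that t01 by (auto simp: Q_bump)
    have through_bump: "solvable c t'" if "solvable c t" for c
      by (rule solvable_bump[OF that t01(1) _ t01(4)]) (use Qb st in auto)
    show "many_blowups \<mu> s t (Suc k)"
      unfolding many_blowups_def
    proof (intro allI impI)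
      fix z b assume si: "shooting_interval \<mu> s t z b"
      let ?c = "\<lambda>\<theta>. z + \<theta> * (b - z)"
      obtain \<Theta> where \<Theta>: "0 < \<Theta>" "\<Theta> \<le> 1" "\<not> solvable (?c \<Theta>) t"
        "\<And>\<theta>. 0 \<le> \<theta> \<Longrightarrow> \<theta> < \<Theta> \<Longrightarrow> solvable (?c \<theta>) t"
        and seg: "\<And>\<theta>. 0 \<le> \<theta> \<Longrightarrow> \<theta> \<le> 1 \<Longrightarrow> solvable (?c \<theta>) s \<and> 0 \<le> ?c \<theta>"
        by (rule shooting_path[OF si st(1) less_imp_le[OF st(2)] t01(2)]) blast
      have z: "0 \<le> z" "solvable z t" "sol z t \<le> 0" "b \<noteq> z"
        using si solvable_mono[of z t] by (auto simp: shooting_interval_def)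
      have wz: "w z t \<le> 0" using nonpos_continues(2)[OF z(1,2) _ t01(2) z(3)] t01 by auto
      have "solvable (?c \<Theta>) s" using seg[of \<Theta>] \<Theta> by auto
      then obtain T where T: "s < T" "T \<le> t" "\<And>r. r < T \<Longrightarrow> solvable (?c \<Theta>) r" "\<not> solvable (?c \<Theta>) T"
        using blowup_time[OF _ \<Theta>(3) st(1) t01(2)] by blast
      obtain r \<theta>1 where r: "s < r" "r < T" and \<theta>1: "0 < \<theta>1" "\<theta>1 < \<Theta>" "M + \<beta> < sol (?c \<theta>1) r" "M + \<beta> < w (?c \<theta>1) r"
        using near_blowup[of s T \<mu> \<Theta> z b "M + \<beta>"] st T gap1 \<mu>_pos \<Theta>(1) by auto
      \<comment> \<open>The second vanishing end: its solution arrives at the bump above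
        \<open>M\<close>, which a solution positive on the whole bump cannot do.\<close>
      define z' where "z' = ?c \<theta>1"
      have solv_t: "solvable (?c \<theta>) t" if "0 \<le> \<theta>" "\<theta> \<le> \<theta>1" for \<theta> using \<Theta>(4) that \<theta>1 by auto
      have nn: "0 \<le> ?c \<theta>" if "0 \<le> \<theta>" "\<theta> \<le> \<theta>1" for \<theta> using seg[of \<theta>] that \<theta>1 \<Theta> by auto
      have z't: "solvable z' t" "0 \<le> z'" using solv_t nn \<theta>1 by (auto simp: z'_def)
      have wr: "w z' r \<le> w z' u" if "r \<le> u" "u \<le> t" for u
        by (rule w_mono[OF solvable_mono[OF z't(1)]]) (use that r T st t01 Q1 in auto)
      have wz': "\<beta> < w z' t" using wr[of t] r T \<theta>1 M(1) by (auto simp: z'_def)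
      have "sol z' r \<le> sol z' t"
        by (rule sol_mono[OF z't(1)]) (use r T st t01 wr \<theta>1(4) M(1) \<beta>(1) in \<open>force simp: z'_def\<close>)+
      then have "M < sol z' t" using \<theta>1 \<beta> by (simp add: z'_def)
      then obtain u where u: "u \<in> {t..t'}" "sol z' u \<le> 0"
        using M(2)[OF through_bump[OF z't(1)], of t] st by fastforce
      have z'1: "solvable z' 1" "\<And>v. t' \<le> v \<Longrightarrow> v \<le> 1 \<Longrightarrow> sol z' v \<le> 0"
        using nonpos_continues[OF z't(2) solvable_mono[OF through_bump[OF z't(1)]], of u] u t01 by auto
      have "continuous_on {0..\<theta>1} (\<lambda>\<theta>. w (?c \<theta>) t)"
      proof (intro continuous_at_imp_continuous_on ballI)
        fix \<theta> assume \<theta>: "\<theta> \<in> {0..\<theta>1}"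
        have "isCont ?c \<theta>" by (intro continuous_intros)
        from isCont_o2[OF this isCont_w] show "isCont (\<lambda>\<theta>. w (?c \<theta>) t) \<theta>"
          using solv_t[of \<theta>] \<theta> t01 by auto
      qed
      \<comment> \<open>The flux at \<open>t\<close> is nonpositive for \<open>z\<close> and exceeds
        \<beta> for \<open>z'\<close>, and all solutions in between reach \<open>t\<close>.\<close>
      from IVT'[of "\<lambda>\<theta>. w (?c \<theta>) t" 0 \<beta> \<theta>1, OF _ _ _ this] obtain \<theta>2
        where \<theta>2: "0 \<le> \<theta>2" "\<theta>2 \<le> \<theta>1" "w (?c \<theta>2) t = \<beta>"
        using wz wz' \<beta> \<theta>1 by (auto simp: z'_def)
      have \<theta>2': "0 < \<theta>2" "\<theta>2 < \<theta>1"
        using \<theta>2 wz wz' \<beta> by (auto simp: z'_def less_le)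
      define e where "e = ?c \<theta>2"
      have e: "0 \<le> e" "solvable e t" "w e t = \<beta>" using nn[of \<theta>2] solv_t[of \<theta>2] \<theta>2 by (auto simp: e_def)
      have e_pos: "0 < sol e v" if "0 \<le> v" "v \<le> t" for v
        by (rule pos_of_pos_later[OF e(1,2) t01(2)]) (use e that \<beta> in auto)
      \<comment> \<open>Otherwise the large weight forces a flux at most - K on [s, x],
        contradicting the zero flux at the origin or the entry bound \<open>M0\<close>.\<close>
      have "sol e t \<le> \<beta>"
      proof (rule ccontr)
        assume "\<not> sol e t \<le> \<beta>"
        then have big: "\<beta> < sol e t" by simp
        have x1x: "x \<le> x1" and x2t: "x2 \<le> t" using x12 by auto
        have Qx: "0 \<le> Q \<mu> v" if "v \<in> {x..t}" for v using Q1 that x by auto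
        have Qk: "\<mu> * k1 \<le> Q \<mu> v" if "v \<in> {x1..x2}" for v
          by (rule Q_ge[OF gap1 \<mu>_pos x12(5)[OF that]]) (use that x12 x in auto)
        have wx: "w e x \<le> - K" and sx: "\<beta> / 2 \<le> sol e x"
          using w_before_gap_end[OF st(1) x(1) x1x x12(2) x2t t01(2) Qx _ Qk e(2) \<beta>(1) _ \<beta>(1) big x_close \<mu>1]
            \<mu>_pos x12(4) e(3) by auto
        have ws: "w e v \<le> - K" if "s \<le> v" "v \<le> x" for v
          using w_mono[OF solvable_mono[OF e(2)], of x v] that x st t01 Q1 wx by fastforce
        have "s \<noteq> 0" using ws[of s] x K by auto
        have "sol e x - sol e s \<le> - K * (x - s)"
          by (rule sol_diff(2)[OF solvable_mono[OF e(2)]]) (use x st t01 K ws in auto)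
        also have "\<dots> = - (M0 + 1)" using x by (simp add: K_def)
        finally have "M0 < sol e s" using sx \<beta> by linarith
        moreover have "sol e s \<le> M0"
          by (rule M0(2)[OF \<open>s \<noteq> 0\<close> solvable_mono[OF e(2)]]) (use st e_pos in auto)
        ultimately show False by simp
      qed
      have we: "\<beta> / 2 \<le> w e v" if "v \<in> {t..t'}" for v
        by (rule w_bump_lower[OF t01(1) _ t01(4) Qb through_bump[OF e(2)] \<beta>(1) e(3) \<open>sol e t \<le> \<beta>\<close> \<beta>(2) that])
          (use st in auto)
      have "\<beta> / 2 * (t' - t) \<le> sol e t' - sol e t"
        by (rule sol_diff(1)[OF through_bump[OF e(2)]]) (use we \<beta> st t01 in auto)
      then have se: "d \<le> sol e t'" using e_pos[of t] t01 by (simp add: d_def)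
      have e_blow: "\<not> solvable e \<rho>"
      proof (rule blowup_in_gap[OF _ _ _ y12(2) _ _ _ _ _ through_bump[OF e(2)] d se _ \<mu>2])
        show "\<mu> * k2 \<le> Q \<mu> v" if "v \<in> {y1..y2}" for v
          by (rule Q_ge[OF gap2 \<mu>_pos y12(5)[OF that]]) (use that y12 \<rho> in auto)
        show "0 \<le> w e t'" using we[of t'] st \<beta> by auto
      qed (use y12 \<rho> st t01 \<mu>_pos Q2 in auto)
      have seg_z': "solvable c t'" if c: "c \<in> closed_segment z z'" for c
      proof -
        obtain v where v: "0 \<le> v" "v \<le> 1" "c = (1 - v) * z + v * z'"
          using c by (auto simp: closed_segment_def)
        then have "c = ?c (v * \<theta>1)" by (simp add: z'_def algebra_simps)
        moreover have "v * \<theta>1 \<le> \<theta>1" using v \<theta>1 by (simp add: mult_left_le_one_le)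
        ultimately show ?thesis using through_bump[OF solv_t[of "v * \<theta>1"]] v \<theta>1 by simp
      qed
      \<comment> \<open>\<open>e\<close> is the blow-up end of both new intervals, which lie on
        opposite sides of it and are therefore disjoint.\<close>
      have order: "z < e \<and> e < z' \<and> z' < b \<or> b < z' \<and> z' < e \<and> e < z"
      proof -
        have "e - z = \<theta>2 * (b - z)" "z' - e = (\<theta>1 - \<theta>2) * (b - z)" "b - z' = (1 - \<theta>1) * (b - z)"
          by (simp_all add: e_def z'_def algebra_simps)
        moreover have "0 < \<theta>2" "0 < \<theta>1 - \<theta>2" "0 < 1 - \<theta>1" using \<theta>2' \<theta>1 \<Theta> by auto
        ultimately show ?thesis using z(4)
          by (cases "z < b") (smt (verit) mult_pos_pos mult_pos_neg)+
      qed
      have "shooting_interval \<mu> t' t'' z e"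
        unfolding shooting_interval_def
      proof (intro conjI ballI)
        show "solvable z t''" "sol z t'' \<le> 0"
          using solvable_mono[OF nonpos_continues(1)[OF z(1,2) _ t01(2) z(3)]]
            nonpos_continues(2)[OF z(1,2) _ t01(2) z(3)] st t01 by auto
        show "solvable c t'" if "c \<in> closed_segment z e" for c
          by (rule seg_z') (use that order in \<open>auto simp: closed_segment_eq_real_ivl split: if_splits\<close>)
      qed (use z e e_blow \<rho> in auto)
      moreover have "shooting_interval \<mu> t' t'' z' e"
        unfolding shooting_interval_def
      proof (intro conjI ballI)
        show "solvable z' t''" "sol z' t'' \<le> 0"
          using solvable_mono[OF z'1(1)] z'1(2) st by auto
        show "solvable c t'" if "c \<in> closed_segment z' e" for c
          by (rule seg_z') (use that order in \<open>auto simp: closed_segment_eq_real_ivl split: if_splits\<close>)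
      qed (use z't e e_blow \<rho> in auto)
      ultimately obtain C C' where C: "card C = 2 ^ k" "C \<subseteq> open_segment z e" "\<forall>c\<in>C. boundary_blowup \<mu> c"
        and C': "card C' = 2 ^ k" "C' \<subseteq> open_segment z' e" "\<forall>c\<in>C'. boundary_blowup \<mu> c"
        using IH unfolding many_blowups_def by metis
      have "finite C" "finite C'" using C(1) C'(1) by (auto intro: card_ge_0_finite)
      moreover have "open_segment z e \<inter> open_segment z' e = {}"
        and sub: "open_segment z e \<subseteq> open_segment z b" "open_segment z' e \<subseteq> open_segment z b"
        using order by (auto simp: open_segment_eq_real_ivl split: if_splits)
      then have "C \<inter> C' = {}" using C C' by blast
      ultimately have "card (C \<union> C') = 2 ^ Suc k" using C C' by (simp add: card_Un_disjoint)
      with C C' sub show "\<exists>C. card C = 2 ^ Suc k \<and> C \<subseteq> open_segment z b \<and> (\<forall>c\<in>C. boundary_blowup \<mu> c)"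
        by (intro exI[of _ "C \<union> C'"]) auto
    qed
  qed
qed

end

section \<open>The nodal intervals of the weight\<close>

context indefinite_weight
begin

text \<open>The gaps are [\<tau> i, \<sigma> i] and the bumps [\<sigma> i, \<tau> (i + 1)]. The
  induction runs from the last gap to the first, \<open>k\<close> being the number of bumps to the
  right, and each stage enlarges the threshold for \<mu> if necessary.\<close>

lemma positive_blowup_parameters:
  assumes \<tau>0: "\<tau> 0 = 0" and \<sigma>m: "\<sigma> m = 1"
    and bd: "\<And>i. i \<le> m \<Longrightarrow> 0 \<le> \<tau> i" "\<And>i. i \<le> m \<Longrightarrow> \<sigma> i \<le> 1"
    and less: "\<And>i. i \<le> m \<Longrightarrow> \<tau> i < \<sigma> i" "\<And>i. i < m \<Longrightarrow> \<sigma> i < \<tau> (Suc i)"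
    and gap: "\<And>i r. i \<le> m \<Longrightarrow> r \<in> {\<tau> i..\<sigma> i} \<Longrightarrow> a r \<le> 0"
    and bump: "\<And>i r. i < m \<Longrightarrow> r \<in> {\<sigma> i..\<tau> (Suc i)} \<Longrightarrow> 0 \<le> a r"
  shows "\<exists>\<mu>0>0. \<forall>\<mu>>\<mu>0. \<exists>C. card C = 2 ^ m \<and> (\<forall>c\<in>C. 0 < c \<and> boundary_blowup \<mu> c)"
proof -
  have "\<exists>\<mu>0>0. \<forall>\<mu>>\<mu>0. many_blowups \<mu> (\<tau> (m - k)) (\<sigma> (m - k)) k" if "k \<le> m" for k
    using that
  proof (induction k)
    case 0
    have "many_blowups \<mu> (\<tau> m) 1 0" if "1 < \<mu>" for \<mu>
      by (rule many_blowups_last_gap) (use bd(1)[of m] less(1)[of m] gap[of m] \<sigma>m that in auto)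
    then show ?case by (intro exI[of _ 1]) (auto simp: \<sigma>m)
  next
    case (Suc k)
    define i where "i = m - Suc k"
    have i: "i < m" "Suc i = m - k" "i \<le> m" "Suc i \<le> m" using Suc.prems by (auto simp: i_def)
    have before: "\<tau> i = 0 \<or> (\<exists>s0. 0 < s0 \<and> s0 < \<tau> i \<and> (\<forall>r\<in>{s0..\<tau> i}. 0 \<le> a r))"
    proof (cases i)
      case (Suc j)
      then have "j < m" "j \<le> m" using i by auto
      then show ?thesis using bd(1)[of j] less(1)[of j] less(2)[of j] bump[of j] Suc
        by (intro disjI2 exI[of _ "\<sigma> j"]) auto
    qed (simp add: \<tau>0)
    obtain \<mu>0 where \<mu>0: "0 < \<mu>0" "\<forall>\<mu>>\<mu>0. many_blowups \<mu> (\<tau> (Suc i)) (\<sigma> (Suc i)) k"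
      using Suc i by auto
    obtain \<mu>1 where "0 < \<mu>1" "\<And>\<mu>. \<mu>1 < \<mu> \<Longrightarrow> many_blowups \<mu> (\<tau> (Suc i)) (\<sigma> (Suc i)) k \<Longrightarrow> many_blowups \<mu> (\<tau> i) (\<sigma> i) (Suc k)"
      using many_blowups_step[OF bd(1)[OF i(3)] less(1)[OF i(3)] less(2)[OF i(1)] less(1)[OF i(4)] bd(2)[OF i(4)]
          gap[OF i(3)] bump[OF i(1)] gap[OF i(4)] before] by blast
    with \<mu>0 show ?case unfolding i_def[symmetric] by (intro exI[of _ "max \<mu>0 \<mu>1"]) auto
  qed
  from this[of m] obtain \<mu>0 where \<mu>0: "0 < \<mu>0" "\<forall>\<mu>>\<mu>0. many_blowups \<mu> 0 (\<sigma> 0) m"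
    using \<tau>0 by auto
  have s0: "0 < \<sigma> 0" "\<sigma> 0 \<le> 1" using less(1)[of 0] bd(2)[of 0] \<tau>0 by auto
  show ?thesis
  proof (intro exI[of _ \<mu>0] conjI allI impI)
    fix \<mu> assume \<mu>: "\<mu>0 < \<mu>"
    then have \<mu>_pos: "0 < \<mu>" using \<mu>0 by simp
    interpret power_ivp n "Q \<mu>" p by (rule power_ivp)
    \<comment> \<open>The initial shooting interval is [0, b]: the zero solution counts as vanished,
      and a large \<open>b\<close>, which may depend on \<mu>, blows up within the first half of the
      first gap.\<close>
    obtain x y k where xy: "0 < x" "x < y" "y < \<sigma> 0 / 2" "0 < k" "\<And>r. r \<in> {x..y} \<Longrightarrow> k \<le> \<bar>a r\<bar>"
      using bounded_away[of 0 "\<sigma> 0 / 2"] s0 by auto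
    obtain b where b: "0 < b" "4 / (x ^ n * ((y - x) * (1 - 2 powr ((1 - p) / 2))) ^ 2) \<le> \<mu> * k * b powr (p - 1)"
      using powr_eventually_ge[OF p, of "\<mu> * k"] \<mu>_pos xy by (metis mult_pos_pos order_refl)
    have neg: "a r \<le> 0" if "0 \<le> r" "r \<le> \<sigma> 0" for r using gap[of 0 r] \<tau>0 that by auto
    have "\<not> solvable b (\<sigma> 0 / 2)"
    proof (rule blowup_in_gap[OF _ _ _ xy(2) _ _ _ _ _ solvable_0 b(1) _ _ b(2)])
      show "\<mu> * k \<le> Q \<mu> r" if "r \<in> {x..y}" for r
        by (rule Q_ge[OF neg \<mu>_pos xy(5)[OF that]]) (use that xy in auto)
      show "0 \<le> Q \<mu> r" if "r \<in> {0..\<sigma> 0 / 2}" for r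
        by (rule Q_nonneg[OF neg \<mu>_pos]) (use that in auto)
    qed (use xy s0 \<mu>_pos in auto)
    moreover have "solvable 0 1" "sol 0 (\<sigma> 0) \<le> 0"
      using nonpos_continues(2)[OF order_refl solvable_0 order_refl zero_le_one, of "\<sigma> 0"]
        nonpos_continues(1)[OF order_refl solvable_0 order_refl zero_le_one] s0 by auto
    ultimately have "shooting_interval \<mu> 0 (\<sigma> 0) 0 b"
      unfolding shooting_interval_def using s0 b(1) solvable_mono[of 0 1 "\<sigma> 0"] solvable_0
      by (auto intro!: exI[of _ "\<sigma> 0 / 2"])
    then obtain C where "card C = 2 ^ m" "C \<subseteq> open_segment 0 b" "\<forall>c\<in>C. boundary_blowup \<mu> c"
      using \<mu>0 \<mu> unfolding many_blowups_def by blast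
    then show "\<exists>C. card C = 2 ^ m \<and> (\<forall>c\<in>C. 0 < c \<and> boundary_blowup \<mu> c)"
      using b(1) by (intro exI[of _ C]) (auto simp: open_segment_eq_real_ivl)
  qed (use \<mu>0 in auto)
qed

end

section \<open>Maximal nonnegative subintervals and their order\<close>

lemma nonneg_subinterval_Union:
  assumes "\<And>I. I \<in> \<I> \<Longrightarrow> nonneg_subinterval a I" "\<I> \<noteq> {}" "\<And>I. I \<in> \<I> \<Longrightarrow> r \<in> I"
  shows "nonneg_subinterval a (\<Union>\<I>)"
  unfolding nonneg_subinterval_def
proof (intro conjI)
  have "connected (\<Union>\<I>)"
  proof (rule connected_Union)
    show "\<Inter>\<I> \<noteq> {}" using assms(3) by blast
  qed (use assms(1) in \<open>auto simp: nonneg_subinterval_def is_interval_connected_1\<close>)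
  then show "is_interval (\<Union>\<I>)" by (simp add: is_interval_connected_1)
qed (use assms in \<open>unfold nonneg_subinterval_def, blast+\<close>)

lemma max_nonneg_subintervals_disjoint:
  assumes "I \<in> max_nonneg_subintervals a" "J \<in> max_nonneg_subintervals a" "r \<in> I" "r \<in> J"
  shows "I = J"
proof -
  have "nonneg_subinterval a (\<Union>{I, J})"
    by (rule nonneg_subinterval_Union[of _ _ r]) (use assms in \<open>auto simp: max_nonneg_subintervals_def\<close>)
  then have "\<Union>{I, J} = I" "\<Union>{I, J} = J" using assms unfolding max_nonneg_subintervals_def by blast+
  then show ?thesis by blast
qed

lemma in_max_nonneg_subinterval:
  assumes "nonneg_subinterval a J"
  obtains I where "I \<in> max_nonneg_subintervals a" "J \<subseteq> I"
proof -
  obtain r where r: "r \<in> J" using assms by (auto simp: nonneg_subinterval_def)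
  let ?I = "\<Union>{I. nonneg_subinterval a I \<and> r \<in> I}"
  have "nonneg_subinterval a ?I" by (rule nonneg_subinterval_Union[of _ _ r]) (use assms r in auto)
  moreover have "K = ?I" if "nonneg_subinterval a K" "?I \<subseteq> K" for K
    using that assms r by blast
  ultimately have "?I \<in> max_nonneg_subintervals a" unfolding max_nonneg_subintervals_def by blast
  moreover have "J \<subseteq> ?I" using assms r by auto
  ultimately show thesis by (rule that)
qed

locale negative_ends = indefinite_weight +
  assumes ends: "a 0 < 0" "a 1 < 0"
begin

text \<open>By continuity \<open>a\<close> is nonnegative on the closure too, so maximality makes
  the interval closed; the negative end values keep it away from 0 and 1.\<close>

lemma max_nonneg_subinterval_Icc:
  assumes "I \<in> max_nonneg_subintervals a"
  obtains l u where "I = {l..u}" "0 < l" "l < u" "u < 1" "\<And>r. r \<in> {l..u} \<Longrightarrow> 0 \<le> a r"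
proof -
  have I: "is_interval I" "I \<subseteq> {0..1}" "\<exists>x\<in>I. \<exists>y\<in>I. x < y" "\<forall>r\<in>I. a r \<ge> 0"
    and mx: "\<And>J. nonneg_subinterval a J \<Longrightarrow> I \<subseteq> J \<Longrightarrow> J = I"
    using assms by (auto simp: max_nonneg_subintervals_def nonneg_subinterval_def)
  have cl: "closure I \<subseteq> {0..1}" by (rule closure_minimal[OF I(2)]) simp
  have "nonneg_subinterval a (closure I)"
    unfolding nonneg_subinterval_def
  proof (intro conjI ballI)
    show "is_interval (closure I)" using I(1) by (simp add: is_interval_connected_1 connected_imp_connected_closure)
    show "\<exists>x\<in>closure I. \<exists>y\<in>closure I. x < y" using I(3) closure_subset by blast
    fix r assume "r \<in> closure I"
    then show "0 \<le> a r"
      using continuous_ge_on_closure[of I a r 0] continuous_on_subset[OF a_cont cl] I(4) by blast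
  qed fact
  then have "closure I = I" by (rule mx) (rule closure_subset)
  then have "compact I" using I(2) by (metis bounded_closed_interval bounded_subset closure_closed closed_closure compact_eq_bounded_closed)
  then obtain l u where lu: "I = {l..u}"
    using I(1) connected_compact_interval_1[of I] by (auto simp: is_interval_connected_1)
  then have "l < u" using I(3) by auto
  moreover have "0 \<in> I \<Longrightarrow> False" "1 \<in> I \<Longrightarrow> False" using I(4) ends by force+
  then have "l \<noteq> 0" "u \<noteq> 1" using lu \<open>l < u\<close> by auto
  moreover have "0 \<le> l" "u \<le> 1" using I(2) lu \<open>l < u\<close> by auto
  ultimately show thesis using that[OF lu] I(4) lu by auto
qed

lemma positive_in_max_nonneg_subinterval:
  assumes r: "r \<in> {0..1}" "0 < a r"
  obtains l u where "{l..u} \<in> max_nonneg_subintervals a" "l < r" "r < u"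
proof -
  have r01: "0 < r" "r < 1" using r ends by (auto simp: less_le)
  have "(a \<longlongrightarrow> a r) (at r within {0..1})" using a_cont r by (auto simp: continuous_on)
  then have "\<forall>\<^sub>F x in at r within {0..1}. 0 < a x" by (rule order_tendstoD) (use r in simp)
  then obtain e where e: "0 < e" "\<And>x. x \<in> {0..1} \<Longrightarrow> x \<noteq> r \<Longrightarrow> dist x r < e \<Longrightarrow> 0 < a x"
    unfolding eventually_at by blast
  define d where "d = min (e / 2) (min r (1 - r))"
  have d: "0 < d" "d < e" "d \<le> r" "d \<le> 1 - r" using e r01 by (auto simp: d_def)
  have "nonneg_subinterval a {r - d..r + d}"
    unfolding nonneg_subinterval_def
  proof (intro conjI ballI)
    show "\<exists>x\<in>{r - d..r + d}. \<exists>y\<in>{r - d..r + d}. x < y"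
      using d by (intro bexI[of _ r] bexI[of _ "r + d"]) auto
    fix x assume x: "x \<in> {r - d..r + d}"
    show "0 \<le> a x"
    proof (cases "x = r")
      case False
      show ?thesis by (rule less_imp_le, rule e(2)) (use x False d in \<open>auto simp: dist_real_def\<close>)
    qed (use r in simp)
  qed (use d in \<open>auto simp: is_interval_cc\<close>)
  then obtain I where I: "I \<in> max_nonneg_subintervals a" "{r - d..r + d} \<subseteq> I"
    by (rule in_max_nonneg_subinterval)
  obtain l u where "I = {l..u}" using max_nonneg_subinterval_Icc[OF I(1)] by blast
  with I d show thesis by (intro that[of l u]) auto
qed

text \<open>If \<open>a\<close> were positive at \<open>u\<close>, some maximal subinterval would
  contain \<open>u\<close> in its interior, and by disjointness it would be the same one.\<close>

lemma max_nonneg_subinterval_right_zero: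
  assumes I: "{l..u} \<in> max_nonneg_subintervals a"
  shows "u \<in> {r \<in> {0<..<1}. a r = 0}"
proof -
  obtain l' u' where "{l..u} = {l'..u'}" and l: "0 < l'" "l' < u'" "u' < 1" "\<And>r. r \<in> {l'..u'} \<Longrightarrow> 0 \<le> a r"
    using max_nonneg_subinterval_Icc[OF I] by metis
  then have [simp]: "l' = l" "u' = u" by (auto simp: Icc_eq_Icc)
  have "\<not> 0 < a u"
  proof
    assume "0 < a u"
    then obtain l2 u2 where 2: "{l2..u2} \<in> max_nonneg_subintervals a" "l2 < u" "u < u2"
      using positive_in_max_nonneg_subinterval[of u] l by auto
    then have "{l..u} = {l2..u2}" using max_nonneg_subintervals_disjoint[OF I 2(1), of u] l by auto
    with 2 l show False by (auto simp: Icc_eq_Icc)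
  qed
  moreover have "0 \<le> a u" by (rule l(4)) (use l(2) in simp)
  ultimately show ?thesis using l by auto
qed

text \<open>Right endpoints are distinct zeros of \<open>a\<close>. Finiteness gives
  \<open>card\<close> its meaning, since an infinite family would have \<open>card\<close> 0 by
  convention.\<close>

lemma finite_max_nonneg_subintervals: "finite (max_nonneg_subintervals a)"
proof (rule inj_on_finite[OF _ _ zeros])
  have Sup: "Sup I \<in> I \<and> Sup I \<in> {r \<in> {0<..<1}. a r = 0}" if I: "I \<in> max_nonneg_subintervals a" for I
  proof -
    obtain l u where lu: "I = {l..u}" "l < u" using max_nonneg_subinterval_Icc[OF I] by metis
    with max_nonneg_subinterval_right_zero[of l u] I show ?thesis by simp
  qed
  show "inj_on Sup (max_nonneg_subintervals a)"
    by (rule inj_onI) (metis Sup max_nonneg_subintervals_disjoint)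
  show "Sup ` max_nonneg_subintervals a \<subseteq> {r \<in> {0<..<1}. a r = 0}" using Sup by blast
qed

lemma gaps_and_bumps:
  obtains \<sigma> \<tau> :: "nat \<Rightarrow> real" where
    "\<tau> 0 = 0" "\<sigma> (card (max_nonneg_subintervals a)) = 1"
    "\<And>i. i \<le> card (max_nonneg_subintervals a) \<Longrightarrow> 0 \<le> \<tau> i \<and> \<sigma> i \<le> 1 \<and> \<tau> i < \<sigma> i"
    "\<And>i. i < card (max_nonneg_subintervals a) \<Longrightarrow> \<sigma> i < \<tau> (Suc i)"
    "\<And>i r. i \<le> card (max_nonneg_subintervals a) \<Longrightarrow> r \<in> {\<tau> i..\<sigma> i} \<Longrightarrow> a r \<le> 0"
    "\<And>i r. i < card (max_nonneg_subintervals a) \<Longrightarrow> r \<in> {\<sigma> i..\<tau> (Suc i)} \<Longrightarrow> 0 \<le> a r"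
proof -
  let ?F = "max_nonneg_subintervals a"
  define m where "m = card ?F"
  define ls where "ls = sorted_list_of_set (Inf ` ?F)"
  have Icc: "\<exists>u. I = {Inf I..u} \<and> 0 < Inf I \<and> Inf I < u \<and> u < 1 \<and> (\<forall>r\<in>{Inf I..u}. 0 \<le> a r)" if "I \<in> ?F" for I
    using max_nonneg_subinterval_Icc[OF that] by (metis cInf_atLeastAtMost less_imp_le)
  have inj: "inj_on Inf ?F"
  proof (rule inj_onI)
    fix I J assume IJ: "I \<in> ?F" "J \<in> ?F" "Inf I = Inf J"
    then have "Inf I \<in> I" "Inf I \<in> J" using Icc[of I] Icc[of J] by (metis atLeastAtMost_iff less_imp_le order_refl)+
    with IJ show "I = J" using max_nonneg_subintervals_disjoint by blast
  qed
  have ls: "set ls = Inf ` ?F" "sorted_wrt (<) ls" "length ls = m"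
    using finite_max_nonneg_subintervals inj by (auto simp: ls_def m_def card_image)
  define \<sigma> where "\<sigma> i = (if i < m then ls ! i else 1)" for i
  \<comment> \<open>The shift by one is deliberate: the right end of bump j is where gap j + 1
    begins.\<close>
  define \<tau> where "\<tau> i = (if i = 0 then 0 else (SOME u. {ls ! (i - 1)..u} \<in> ?F))" for i :: nat
  have bump: "{\<sigma> i..\<tau> (Suc i)} \<in> ?F \<and> 0 < \<sigma> i \<and> \<sigma> i < \<tau> (Suc i) \<and> \<tau> (Suc i) < 1 \<and> (\<forall>r\<in>{\<sigma> i..\<tau> (Suc i)}. 0 \<le> a r)"
    if i: "i < m" for i
  proof -
    have "\<sigma> i \<in> Inf ` ?F" using i ls by (metis \<sigma>_def nth_mem)
    then obtain I where I: "I \<in> ?F" "Inf I = \<sigma> i" by auto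
    then have "\<exists>u. {\<sigma> i..u} \<in> ?F" using Icc[of I] by auto
    then have "{\<sigma> i..(SOME u. {\<sigma> i..u} \<in> ?F)} \<in> ?F" by (rule someI_ex)
    then have F: "{\<sigma> i..\<tau> (Suc i)} \<in> ?F"
      using i by (simp add: \<sigma>_def \<tau>_def)
    from max_nonneg_subinterval_Icc[OF F] show ?thesis using F
      by (metis Icc_eq_Icc linorder_not_less order_less_imp_le)
  qed
  have mono: "\<sigma> i < \<sigma> j" if "i < j" "j < m" for i j
    using that ls by (simp add: \<sigma>_def sorted_wrt_nth_less)
  have less: "\<tau> i < \<sigma> i" if "i \<le> m" for i
  proof (cases i)
    case 0
    then show ?thesis using bump[of 0] by (cases "m = 0") (auto simp: \<tau>_def \<sigma>_def)
  next
    case (Suc j)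
    then have j: "j < m" using that by simp
    show ?thesis
    proof (cases "i < m")
      case False then show ?thesis using bump[OF j] Suc by (simp add: \<sigma>_def)
    next
      case True
      show ?thesis
      proof (rule ccontr)
        assume "\<not> ?thesis"
        then have "\<sigma> i \<in> {\<sigma> j..\<tau> (Suc j)}" using mono[of j i] True Suc by auto
        moreover have "\<sigma> i \<in> {\<sigma> i..\<tau> (Suc i)}" using bump[OF True] by auto
        ultimately have "{\<sigma> j..\<tau> (Suc j)} = {\<sigma> i..\<tau> (Suc i)}"
          using max_nonneg_subintervals_disjoint bump[OF j] bump[OF True] by blast
        then show False using bump[OF j] bump[OF True] mono[of j i] True Suc by (auto simp: Icc_eq_Icc)
      qed
    qed
  qed
  \<comment> \<open>A point of positivity in gap i would be interior to some bump j. Its left end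
    forces j < i, and then its right end \<tau> (j + 1) is at most \<tau> i, where the gap
    begins.\<close>
  have gap: "a r \<le> 0" if i: "i \<le> m" and r: "r \<in> {\<tau> i..\<sigma> i}" for i r
  proof (rule ccontr)
    assume pos: "\<not> a r \<le> 0"
    have \<tau>0: "0 \<le> \<tau> i" using bump[of "i - 1"] i by (cases i) (auto simp: \<tau>_def[of 0])
    have "\<sigma> i \<le> 1" using bump[of i] i by (cases "i < m") (auto simp: \<sigma>_def[of m])
    then obtain l u where lu: "{l..u} \<in> ?F" "l < r" "r < u"
      using positive_in_max_nonneg_subinterval[of r] pos r \<tau>0 by auto
    have "l \<in> set ls" using lu ls(1) by (metis cInf_atLeastAtMost image_eqI less_imp_le less_trans)
    then obtain j where j: "j < m" "l = \<sigma> j" using ls by (metis \<sigma>_def in_set_conv_nth)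
    have "{l..u} = {\<sigma> j..\<tau> (Suc j)}"
      using max_nonneg_subintervals_disjoint[OF lu(1), of "{\<sigma> j..\<tau> (Suc j)}" l] bump[OF j(1)] j lu by auto
    then have u: "u = \<tau> (Suc j)" using lu by (auto simp: Icc_eq_Icc)
    have "j < i"
      using mono[of i j] j lu r by (cases "i < j"; cases "i = j") auto
    show False
    proof (cases "Suc j = i")
      case True then show ?thesis using u lu r by simp
    next
      case False
      with \<open>j < i\<close> obtain h where h: "i = Suc h" "j < h" by (cases i) auto
      have "\<tau> (Suc j) < \<sigma> (Suc j)" using less[of "Suc j"] h i by simp
      also have "\<sigma> (Suc j) \<le> \<sigma> h" using mono[of "Suc j" h] h i by (cases "Suc j = h") auto
      also have "\<sigma> h < \<tau> i" using bump[of h] h i by simp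
      finally show ?thesis using u lu r by simp
    qed
  qed
  show thesis
  proof (rule that[of \<tau> \<sigma>], unfold m_def[symmetric])
    show "0 \<le> \<tau> i \<and> \<sigma> i \<le> 1 \<and> \<tau> i < \<sigma> i" if i: "i \<le> m" for i
      using less[OF i] bump[of i] bump[of "i - 1"] i \<sigma>_def[of m]
      by (cases "i < m"; cases i) (auto simp: \<tau>_def[of 0])
  qed (use bump gap in \<open>auto simp: \<tau>_def[of 0] \<sigma>_def[of m]\<close>)
qed

end

section \<open>Radial functions on the unit ball\<close>

lemma partial_deriv_eq:
  assumes "(f has_derivative D) (at x)"
  shows "partial_deriv i f x = D (axis i 1)"
proof -
  have line: "((\<lambda>t. x + t *\<^sub>R axis i 1) has_derivative (\<lambda>t. t *\<^sub>R axis i 1)) (at 0)"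
    by (auto intro!: derivative_eq_intros)
  have "((\<lambda>t. f (x + t *\<^sub>R axis i 1)) has_derivative (\<lambda>t. D (t *\<^sub>R axis i 1))) (at 0)"
    by (rule has_derivative_compose[OF line]) (use assms in simp)
  moreover have "(\<lambda>t. D (t *\<^sub>R axis i 1)) = (*) (D (axis i 1))"
    using linear_cmul[OF has_derivative_linear[OF assms]] by (auto simp: mult.commute)
  ultimately have "((\<lambda>t. f (x + t *\<^sub>R axis i 1)) has_real_derivative D (axis i 1)) (at 0)"
    by (simp add: has_field_derivative_def)
  then show ?thesis unfolding partial_deriv_def by (rule DERIV_imp_deriv)
qed

lemma filterlim_norm_at_0:
  "filterlim norm (at 0 within {0..<1}) (at (0 :: 'a :: real_normed_vector))"
  unfolding filterlim_at
proof
  show "\<forall>\<^sub>F x in at (0 :: 'a). norm x \<in> {0..<1} \<and> norm x \<noteq> 0"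
    unfolding eventually_at by (intro exI[of _ 1]) auto
qed (auto intro!: tendsto_eq_intros)

text \<open>With \<open>v' = r \<psi>\<close>, the gradient of \<open>v (norm x)\<close> is \<open>\<psi> (norm x) *\<^sub>R x\<close>, which avoids the singularity of
  the norm at the origin.\<close>

locale radial_C2 =
  fixes v \<psi> \<phi> :: "real \<Rightarrow> real"
  assumes v_deriv: "\<And>r. 0 < r \<Longrightarrow> r < 1 \<Longrightarrow> (v has_real_derivative r * \<psi> r) (at r)"
    and v_deriv_0: "(v has_real_derivative 0) (at 0 within {0..<1})"
    and \<psi>_deriv: "\<And>r. 0 < r \<Longrightarrow> r < 1 \<Longrightarrow> (\<psi> has_real_derivative \<phi> r / r) (at r)"
    and \<psi>_cont: "continuous_on {0..<1} \<psi>" and \<phi>_cont: "continuous_on {0..<1} \<phi>" and \<phi>_0: "\<phi> 0 = 0"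
begin

definition grad :: "real ^ 'n::finite \<Rightarrow> real ^ 'n" where
  "grad x = \<psi> (norm x) *\<^sub>R x"

text \<open>The second-derivative matrix of v(|x|), with \<phi> = r \<psi>'. At the origin the
  division by 0 gives 0, leaving the correct value \<psi>(0) times the identity.\<close>

definition hess :: "real ^ 'n::finite \<Rightarrow> real ^ 'n ^ 'n" where
  "hess x = (\<chi> i j. \<psi> (norm x) * (if i = j then 1 else 0) + \<phi> (norm x) / (norm x)\<^sup>2 * (x $ i * x $ j))"

lemma hess_mult: "hess x *v h = \<psi> (norm x) *\<^sub>R h + (\<phi> (norm x) / (norm x)\<^sup>2 * (x \<bullet> h)) *\<^sub>R x"
proof (subst vec_eq_iff, intro allI)
  fix i
  define k where "k = \<phi> (norm x) / (norm x)\<^sup>2"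
  have "(hess x *v h) $ i = (\<Sum>j\<in>UNIV. \<psi> (norm x) * (if j = i then h $ j else 0) + k * x $ i * (x $ j * h $ j))"
    unfolding matrix_vector_mult_def hess_def k_def[symmetric] by (auto intro!: sum.cong simp: algebra_simps)
  also have "\<dots> = \<psi> (norm x) * h $ i + k * x $ i * (x \<bullet> h)"
    by (simp add: sum.distrib sum_distrib_left[symmetric] inner_vec_def)
  finally show "(hess x *v h) $ i = (\<psi> (norm x) *\<^sub>R h + (\<phi> (norm x) / (norm x)\<^sup>2 * (x \<bullet> h)) *\<^sub>R x) $ i"
    by (simp add: k_def)
qed

lemma norm_has_derivative: "x \<noteq> 0 \<Longrightarrow> (norm has_derivative (\<lambda>h. (x \<bullet> h) / norm x)) (at (x :: real ^ 'n::finite))"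
  by (rule has_derivative_eq_rhs[OF has_derivative_norm]) (auto simp: sgn_div_norm divide_inverse mult.commute inner_commute)

lemma radial_has_derivative:
  assumes x: "x \<in> ball 0 1"
  shows "((\<lambda>x. v (norm x)) has_derivative (\<lambda>h. grad x \<bullet> h)) (at (x :: real ^ 'n::finite))"
proof (cases "x = 0")
  case False
  have "(v has_derivative (*) (norm x * \<psi> (norm x))) (at (norm x))"
    using v_deriv[of "norm x"] x False by (simp add: has_field_derivative_def)
  from has_derivative_compose[OF norm_has_derivative[OF False] this] show ?thesis
    by (rule has_derivative_eq_rhs) (use False in \<open>auto simp: grad_def field_simps\<close>)
next
  case True
  have "((\<lambda>r. (v r - v 0) / (r - 0)) \<longlongrightarrow> 0) (at 0 within {0..<1})"
    using v_deriv_0 by (simp add: has_field_derivative_iff)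
  from filterlim_compose[OF tendsto_norm_zero[OF this] filterlim_norm_at_0[where 'a = "real ^ 'n"]]
  have "((\<lambda>y :: real ^ 'n. norm (v (norm y) - v 0) / norm y) \<longlongrightarrow> 0) (at 0)" by simp
  then show ?thesis
    unfolding True has_derivative_at by (simp add: grad_def bounded_linear_inner_right)
qed

lemma grad_has_derivative:
  assumes x: "x \<in> ball 0 1"
  shows "(grad has_derivative (\<lambda>h. hess x *v h)) (at (x :: real ^ 'n::finite))"
proof (cases "x = 0")
  case False
  have "(\<psi> has_derivative (*) (\<phi> (norm x) / norm x)) (at (norm x))"
    using \<psi>_deriv[of "norm x"] x False by (simp add: has_field_derivative_def)
  from has_derivative_scaleR[OF has_derivative_compose[OF norm_has_derivative[OF False] this] has_derivative_ident]
  show ?thesis unfolding grad_def [abs_def]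
    by (rule has_derivative_eq_rhs) (auto simp: hess_mult fun_eq_iff power2_eq_square)
next
  case True
  have "(\<psi> \<longlongrightarrow> \<psi> 0) (at 0 within {0..<1})" using \<psi>_cont by (auto simp: continuous_on)
  then have "((\<lambda>r. \<psi> r - \<psi> 0) \<longlongrightarrow> 0) (at 0 within {0..<1})" by (simp add: LIM_zero)
  from filterlim_compose[OF tendsto_norm_zero[OF this] filterlim_norm_at_0[where 'a = "real ^ 'n"]]
  have lim: "((\<lambda>y :: real ^ 'n. norm (\<psi> (norm y) - \<psi> 0)) \<longlongrightarrow> 0) (at 0)" .
  have eq: "norm (\<psi> (norm y) *\<^sub>R y - \<psi> 0 *\<^sub>R y) / norm y = norm (\<psi> (norm y) - \<psi> 0)" if "y \<noteq> 0" for y :: "real ^ 'n"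
    using that by (simp flip: scaleR_diff_left)
  have "((\<lambda>y :: real ^ 'n. norm (\<psi> (norm y) *\<^sub>R y - \<psi> 0 *\<^sub>R y) / norm y) \<longlongrightarrow> 0) (at 0)"
    by (rule tendsto_cong[THEN iffD1, OF _ lim]) (auto simp: eventually_at_filter eq)
  then show ?thesis
    unfolding True by (auto simp: has_derivative_at grad_def hess_mult bounded_linear_scaleR_right)
qed

lemma continuous_on_norm_comp:
  assumes "continuous_on {0..<1} f"
  shows "continuous_on (ball 0 1) (\<lambda>x :: real ^ 'n::finite. f (norm x) :: real)"
  by (rule continuous_on_compose2[OF assms]) (auto intro!: continuous_intros)

lemma hess_continuous: "continuous_on (ball 0 1) (hess :: real ^ 'n::finite \<Rightarrow> real ^ 'n ^ 'n)"
proof -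
  have 1: "continuous_on (ball 0 1) (\<lambda>x :: real ^ 'n. \<psi> (norm x) * (if i = j then 1 else 0))" for i j :: 'n
    by (intro continuous_on_mult continuous_on_const continuous_on_norm_comp \<psi>_cont)
  have 2: "continuous_on (ball 0 1) (\<lambda>x :: real ^ 'n. \<phi> (norm x) / (norm x)\<^sup>2 * (x $ i * x $ j))" for i j
    unfolding continuous_on
  proof
    fix x :: "real ^ 'n" assume x: "x \<in> ball 0 1"
    have \<phi>x: "((\<lambda>x :: real ^ 'n. \<phi> (norm x)) \<longlongrightarrow> \<phi> (norm x)) (at x within ball 0 1)"
      using continuous_on_norm_comp[OF \<phi>_cont] x by (auto simp: continuous_on)
    show "((\<lambda>x. \<phi> (norm x) / (norm x)\<^sup>2 * (x $ i * x $ j)) \<longlongrightarrow> \<phi> (norm x) / (norm x)\<^sup>2 * (x $ i * x $ j))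
      (at x within ball 0 1)"
    proof (cases "x = 0")
      case False
      then show ?thesis by (intro tendsto_intros \<phi>x) auto
    next
      case True
      \<comment> \<open>The product of two coordinates is at most |y|^2, which cancels the
        denominator, and \<phi> tends to 0 at the origin.\<close>
      have "norm (\<phi> (norm y) / (norm y)\<^sup>2 * (y $ i * y $ j)) \<le> \<bar>\<phi> (norm y)\<bar>" for y :: "real ^ 'n"
      proof (cases "y = 0")
        case False
        have "\<bar>y $ i\<bar> * \<bar>y $ j\<bar> \<le> norm y * norm y"
          by (intro mult_mono component_le_norm_cart) auto
        then have "\<bar>\<phi> (norm y)\<bar> * (\<bar>y $ i\<bar> * \<bar>y $ j\<bar>) \<le> \<bar>\<phi> (norm y)\<bar> * (norm y)\<^sup>2"
          by (intro mult_left_mono) (auto simp: power2_eq_square)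
        then show ?thesis using False by (simp add: abs_mult divide_le_eq)
      qed simp
      then have ev: "\<forall>\<^sub>F y in at x within ball 0 1. norm (\<phi> (norm y) / (norm y)\<^sup>2 * (y $ i * y $ j)) \<le> \<bar>\<phi> (norm y)\<bar>"
        by (intro always_eventually allI)
      have lim: "((\<lambda>y :: real ^ 'n. \<bar>\<phi> (norm y)\<bar>) \<longlongrightarrow> 0) (at x within ball 0 1)"
        using tendsto_rabs[OF \<phi>x] True \<phi>_0 by simp
      from Lim_null_comparison[OF ev lim] have "((\<lambda>y :: real ^ 'n. \<phi> (norm y) / (norm y)\<^sup>2 * (y $ i * y $ j)) \<longlongrightarrow> 0) (at x within ball 0 1)"
        .
      then show ?thesis using True by simp
    qed
  qed
  show ?thesis unfolding hess_def [abs_def]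
    by (intro continuous_on_vec_lambda continuous_on_add 1 2)
qed

lemma C2_on_radial: "C2_on (ball 0 1) (\<lambda>x :: real ^ 'n::finite. v (norm x))"
  unfolding C2_on_def
  using radial_has_derivative grad_has_derivative hess_continuous by blast

text \<open>The trace of \<open>hess\<close>; away from the origin it is v'' + (N - 1) v' / r
  expressed by \<psi> and \<phi>.\<close>

lemma laplacian_radial:
  assumes x: "x \<in> ball 0 1"
  shows "laplacian (\<lambda>x. v (norm x)) (x :: real ^ 'n::finite) = CARD('n) * \<psi> (norm x) + \<phi> (norm x)"
proof -
  have "partial_deriv i (partial_deriv i (\<lambda>x. v (norm x))) x = hess x $ i $ i" for i
  proof -
    have "((\<lambda>y. grad y $ i) has_derivative (\<lambda>h. (hess x *v h) $ i)) (at x)"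
      by (rule bounded_linear.has_derivative[OF bounded_linear_vec_nth grad_has_derivative[OF x]])
    then have "(partial_deriv i (\<lambda>x. v (norm x)) has_derivative (\<lambda>h. (hess x *v h) $ i)) (at x)"
      by (rule has_derivative_transform_within_open[OF _ open_ball x])
        (simp add: partial_deriv_eq[OF radial_has_derivative] inner_axis)
    then show ?thesis by (simp add: partial_deriv_eq matrix_vector_mul_component inner_axis)
  qed
  then have "laplacian (\<lambda>x. v (norm x)) x = (\<Sum>i\<in>UNIV. \<psi> (norm x) + \<phi> (norm x) / (norm x)\<^sup>2 * (x $ i * x $ i))"
    by (simp add: laplacian_def hess_def)
  also have "\<dots> = CARD('n) * \<psi> (norm x) + \<phi> (norm x) / (norm x)\<^sup>2 * (\<Sum>i\<in>UNIV. x $ i * x $ i)"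
    by (simp add: sum.distrib sum_distrib_left)
  also have "(\<Sum>i\<in>UNIV. x $ i * x $ i) = (norm x)\<^sup>2"
    by (simp add: power2_norm_eq_inner inner_vec_def)
  finally show ?thesis using \<phi>_0 by (cases "x = 0") auto
qed

end

lemma at_within_Icc_eq_at_within_lessThan:
  fixes r R :: real
  assumes "r < R" "R \<le> 1"
  shows "at r within {0..R} = at r within {0..<1}"
  by (rule at_within_nhd[of _ "{..<R}"]) (use assms in auto)

section \<open>From a blow-up parameter to a classical solution in the ball\<close>

context indefinite_weight
begin

lemma weight_eq: "weight a \<mu> r = - Q \<mu> r"
  by (simp add: weight_def Q_def)

context
  fixes \<mu> c :: real
  assumes \<mu>: "0 < \<mu>" and c: "0 < c" and blowup: "boundary_blowup \<mu> c"
    and near_1: "\<exists>s. 0 \<le> s \<and> s < 1 \<and> (\<forall>r\<in>{s..1}. a r \<le> 0)"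
begin

interpretation power_ivp n "Q \<mu>" p by (rule power_ivp)

lemma blowup_solvable: "r < 1 \<Longrightarrow> solvable c r"
  using blowup by (simp add: boundary_blowup_def)

lemma blowup_pos:
  assumes "0 \<le> r" "r < 1" shows "0 < sol c r"
proof (rule ccontr)
  assume "\<not> 0 < sol c r"
  then have "solvable c 1"
    using nonpos_continues(1)[OF less_imp_le[OF c] blowup_solvable[OF assms(2)] assms(1)] assms by simp
  with blowup show False by (simp add: boundary_blowup_def)
qed

lemma blowup_deriv:
  assumes r: "0 \<le> r" "r < 1"
  shows "(sol c has_real_derivative w c r / r ^ n) (at r within {0..<1})"
    and "(w c has_real_derivative r ^ n * (Q \<mu> r * sol c r powr p)) (at r within {0..<1})"
proof -
  define R where "R = (r + 1) / 2"
  have R: "r < R" "R < 1" using r by (auto simp: R_def)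
  have *: "at r within {0..R} = at r within {0..<1}"
    by (rule at_within_Icc_eq_at_within_lessThan) (use R in auto)
  show "(sol c has_real_derivative w c r / r ^ n) (at r within {0..<1})"
    using sol_has_derivative[OF blowup_solvable[OF R(2)], of r] R r by (simp add: *)
  show "(w c has_real_derivative r ^ n * (Q \<mu> r * sol c r powr p)) (at r within {0..<1})"
    using w_has_derivative[OF blowup_solvable[OF R(2)], of r] R r blowup_pos[OF r] by (simp add: * pos_powr_pos)
qed

lemma blowup_deriv_at:
  assumes r: "0 < r" "r < 1"
  shows "(sol c has_real_derivative w c r / r ^ n) (at r)"
    and "(w c has_real_derivative r ^ n * (Q \<mu> r * sol c r powr p)) (at r)"
proof -
  have "at r within {0..<1} = at r" by (rule at_within_interior) (use r in simp)
  then show "(sol c has_real_derivative w c r / r ^ n) (at r)"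
    "(w c has_real_derivative r ^ n * (Q \<mu> r * sol c r powr p)) (at r)"
    using blowup_deriv[of r] r by simp_all
qed

text \<open>Failure to reach radius 1 by itself gives only unboundedness. The limit comes from the
  last gap, where value and flux, once large, stay large.\<close>

lemma blowup_filterlim: "filterlim (sol c) at_top (at_left 1)"
  unfolding filterlim_at_top
proof
  fix K
  obtain s where s: "0 \<le> s" "s < 1" "\<And>r. r \<in> {s..1} \<Longrightarrow> a r \<le> 0" using near_1 by blast
  have "0 \<le> Q \<mu> x" if "x \<in> {s..<1}" for x using Q_nonneg[OF s(3) \<mu>, of x] that by simp
  then obtain r where r: "s < r" "r < 1" "\<And>x. r \<le> x \<Longrightarrow> x < 1 \<Longrightarrow> K < sol c x \<and> K < w c x"
    using blowup_unbounded[OF s(1,2) order_refl, of c K] blowup by (auto simp: boundary_blowup_def)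
  show "\<forall>\<^sub>F x in at_left 1. K \<le> sol c x"
  proof (rule eventually_at_leftI[OF _ r(2)])
    fix x assume "x \<in> {r<..<1}"
    then show "K \<le> sol c x" using r(3)[of x] by auto
  qed
qed

lemma radial_profile_sol: "radial_profile (Suc n) a p \<mu> (sol c)"
  unfolding radial_profile_def
proof (intro exI[of _ "\<lambda>r. w c r / r ^ n"] conjI ballI)
  fix r :: real assume r: "r \<in> {0<..<1}"
  show "\<exists>d. ((\<lambda>s. s ^ (Suc n - 1) * (w c s / s ^ n)) has_real_derivative d) (at r) \<and>
    d + r ^ (Suc n - 1) * weight a \<mu> r * sol c r powr p = 0"
  proof (intro exI conjI)
    show "((\<lambda>s. s ^ (Suc n - 1) * (w c s / s ^ n)) has_real_derivative r ^ n * (Q \<mu> r * sol c r powr p)) (at r)"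
      by (rule has_field_derivative_transform_within_open[OF blowup_deriv_at(2), of _ "{0<..<1}"]) (use r in auto)
  qed (simp add: weight_eq)
qed (use blowup_deriv(1) blowup_filterlim in auto)

text \<open>This is u'(r) / r. The value at 0 is its limit, because near the origin the flux behaves
  like Q(0) c^p r^(n+1) / (n+1).\<close>

definition \<psi> :: "real \<Rightarrow> real" where
  "\<psi> r = (if r = 0 then Q \<mu> 0 * c powr p / Suc n else w c r / r ^ Suc n)"

text \<open>This is r \<psi>'(r) rewritten by means of the equation, so that N \<psi> + \<phi> is
  the right-hand side by construction and continuity at 0 needs no second derivative.\<close>

definition \<phi> :: "real \<Rightarrow> real" where
  "\<phi> r = Q \<mu> r * sol c r powr p - Suc n * \<psi> r"

lemma rhs_continuous: "continuous_on {0..<1} (\<lambda>r. Q \<mu> r * sol c r powr p)"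
proof (intro continuous_on_mult continuous_on_powr')
  show "continuous_on {0..<1} (Q \<mu>)" by (rule continuous_on_subset[OF q]) auto
  show "continuous_on {0..<1} (sol c)" by (rule DERIV_continuous_on[OF blowup_deriv(1)]) auto
qed (use p blowup_pos in \<open>auto intro: less_imp_le\<close>)

lemma \<psi>_tendsto_0: "(\<psi> \<longlongrightarrow> \<psi> 0) (at 0 within {0..<1})"
proof (rule tendstoI)
  fix e :: real assume e: "0 < e"
  let ?G = "\<lambda>r. Q \<mu> r * sol c r powr p"
  have "(?G \<longlongrightarrow> ?G 0) (at 0 within {0..<1})"
    using rhs_continuous unfolding continuous_on by (drule_tac bspec[of _ _ 0]) auto
  from tendstoD[OF this, of "e / 2"] obtain d where d: "0 < d"
    "\<And>r. r \<in> {0..<1} \<Longrightarrow> r \<noteq> 0 \<Longrightarrow> dist r 0 < d \<Longrightarrow> dist (?G r) (?G 0) < e / 2"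
    using e unfolding eventually_at by auto
  have "dist (\<psi> r) (\<psi> 0) < e" if r: "0 < r" "r < 1" "r < d" for r
  proof -
    \<comment> \<open>The difference from the flux belonging to the constant right-hand side
      \<open>?G 0\<close>. Its derivative is x^n times a quantity of modulus at most e / 2, so
      dividing by r^(n+1) gives the estimate.\<close>
    let ?D = "\<lambda>x. w c x - ?G 0 * x ^ Suc n / Suc n"
    have der: "(?D has_real_derivative x ^ n * (?G x - ?G 0)) (at x within {0..r})" if x: "x \<in> {0..r}" for x
    proof -
      have "(w c has_real_derivative x ^ n * ?G x) (at x within {0..r})"
        by (rule has_field_derivative_subset[OF blowup_deriv(2)]) (use x r in auto)
      then show ?thesis
        by (auto intro!: derivative_eq_intros simp: field_simps simp del: of_nat_Suc power_Suc)
    qed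
    have bd: "\<bar>x ^ n * (?G x - ?G 0)\<bar> \<le> r ^ n * (e / 2)" if x: "x \<in> {0..r}" for x
    proof -
      have "\<bar>?G x - ?G 0\<bar> \<le> e / 2"
        using d(2)[of x] x r e by (cases "x = 0") (auto simp: dist_real_def)
      then show ?thesis unfolding abs_mult using x r e
        by (intro mult_mono) (auto intro: power_mono)
    qed
    have "- (r ^ n * (e / 2)) * (r - 0) \<le> ?D r - ?D 0" "?D r - ?D 0 \<le> r ^ n * (e / 2) * (r - 0)"
      by (rule deriv_bound_diff[OF der]; use r bd in \<open>fastforce simp: abs_le_iff\<close>)+
    moreover define X where "X = r ^ Suc n"
    moreover have D0: "?D 0 = 0" by simp
    ultimately have "- (e / 2 * X) \<le> w c r - ?G 0 * X / Suc n" "w c r - ?G 0 * X / Suc n \<le> e / 2 * X"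
      by (simp_all only: D0 diff_zero power_Suc mult_ac minus_mult_left)
    then have "\<bar>w c r - ?G 0 * X / Suc n\<bar> \<le> e / 2 * X" unfolding abs_le_iff by linarith
    moreover have X: "0 < X" using r by (simp add: X_def)
    moreover have "\<psi> r - \<psi> 0 = (w c r - ?G 0 * X / Suc n) / X"
      using r X unfolding \<psi>_def X_def[symmetric] by (simp add: diff_divide_distrib del: of_nat_Suc)
    ultimately have "\<bar>\<psi> r - \<psi> 0\<bar> \<le> e / 2"
      by (simp only: abs_divide abs_of_pos pos_divide_le_eq)
    then show ?thesis using e by (simp add: dist_real_def)
  qed
  then show "\<forall>\<^sub>F r in at 0 within {0..<1}. dist (\<psi> r) (\<psi> 0) < e"
    unfolding eventually_at using d(1) by (intro exI[of _ d]) (auto simp: dist_real_def)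
qed

lemma \<psi>_has_derivative:
  assumes r: "0 < r" "r < 1"
  shows "(\<psi> has_real_derivative \<phi> r / r) (at r)"
proof -
  have "((\<lambda>r. w c r / r ^ Suc n) has_real_derivative
      (r ^ n * (Q \<mu> r * sol c r powr p) * r ^ Suc n - w c r * (Suc n * r ^ n)) / (r ^ Suc n * r ^ Suc n)) (at r)"
    using blowup_deriv_at(2)[OF r] r
    by (auto intro!: derivative_eq_intros simp del: of_nat_Suc power_Suc)
  also have "(r ^ n * (Q \<mu> r * sol c r powr p) * r ^ Suc n - w c r * (Suc n * r ^ n)) / (r ^ Suc n * r ^ Suc n) = \<phi> r / r"
    using r by (simp add: \<phi>_def \<psi>_def divide_simps del: of_nat_Suc) (simp add: algebra_simps del: of_nat_Suc)
  finally show ?thesis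
    by (rule has_field_derivative_transform_within_open[of _ _ _ "{0<..<1}"]) (use r in \<open>auto simp: \<psi>_def\<close>)
qed

lemma \<psi>_continuous: "continuous_on {0..<1} \<psi>"
  unfolding continuous_on
proof
  fix r :: real assume r: "r \<in> {0..<1}"
  show "(\<psi> \<longlongrightarrow> \<psi> r) (at r within {0..<1})"
  proof (cases "r = 0")
    case False
    then have "isCont \<psi> r" by (intro DERIV_isCont[OF \<psi>_has_derivative]) (use r in auto)
    then show ?thesis unfolding isCont_def by (rule Lim_at_imp_Lim_at_within)
  qed (simp add: \<psi>_tendsto_0)
qed

lemma radial_C2_sol: "radial_C2 (sol c) \<psi> \<phi>"
proof
  show "continuous_on {0..<1} \<phi>"
    unfolding \<phi>_def by (intro continuous_intros rhs_continuous \<psi>_continuous)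
  show "\<phi> 0 = 0" by (simp add: \<phi>_def \<psi>_def del: of_nat_Suc)
  show "(sol c has_real_derivative r * \<psi> r) (at r)" if "0 < r" "r < 1" for r
    using blowup_deriv_at(1)[OF that] that by (simp add: \<psi>_def)
  show "(sol c has_real_derivative 0) (at 0 within {0..<1})"
    using blowup_deriv(1)[of 0] by simp
qed (use \<psi>_has_derivative \<psi>_continuous in auto)

lemma positive_radial_solution_sol:
  assumes n: "CARD('n) = Suc n"
  shows "positive_radial_solution a p \<mu> (\<lambda>x :: real ^ 'n::finite. sol c (norm x))"
proof -
  interpret radial_C2 "sol c" \<psi> \<phi> by (rule radial_C2_sol)
  have "laplacian (\<lambda>x. sol c (norm x)) x + weight a \<mu> (norm x) * sol c (norm x) powr p = 0"
    if "x \<in> ball 0 1" for x :: "real ^ 'n"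
    unfolding laplacian_radial[OF that] n by (simp add: \<phi>_def weight_eq)
  then show ?thesis
    unfolding positive_radial_solution_def boundary_blowup_solution_def n
    using C2_on_radial radial_profile_sol blowup_pos
      filterlim_compose[OF blowup_filterlim filterlim_filtercomap]
    by auto
qed

end

end

theorem theorem1p1:
  fixes a :: "real \<Rightarrow> real" and p :: real and m :: nat
  assumes p: "p > 1"
    and cont: "continuous_on {0..1} a"
    and sign_changing: "\<exists>r\<in>{0..1}. a r > 0" "\<exists>r\<in>{0..1}. a r < 0"
    and zeros: "finite {r\<in>{0<..<1}. a r = 0}"
    and ends: "a 0 < 0" "a 1 < 0"
    and m: "m = card (max_nonneg_subintervals a)"
  shows "\<exists>\<mu>star>0. \<forall>\<mu>>\<mu>star. \<exists>U :: (real ^ 'n::finite \<Rightarrow> real) set.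
           card U = 2 ^ m \<and>
           (\<forall>u\<in>U. positive_radial_solution a p \<mu> u) \<and>
           pairwise (\<lambda>u w. \<exists>x\<in>ball 0 1. u x \<noteq> w x) U"
proof -
  define n where "n = CARD('n) - 1"
  have n: "CARD('n) = Suc n" by (simp add: n_def)
  interpret negative_ends a p n
    by unfold_locales (use p cont zeros ends in auto)
  obtain \<sigma> \<tau> :: "nat \<Rightarrow> real" where st: "\<tau> 0 = 0" "\<sigma> m = 1"
    "\<And>i. i \<le> m \<Longrightarrow> 0 \<le> \<tau> i \<and> \<sigma> i \<le> 1 \<and> \<tau> i < \<sigma> i"
    "\<And>i. i < m \<Longrightarrow> \<sigma> i < \<tau> (Suc i)"
    "\<And>i r. i \<le> m \<Longrightarrow> r \<in> {\<tau> i..\<sigma> i} \<Longrightarrow> a r \<le> 0"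
    "\<And>i r. i < m \<Longrightarrow> r \<in> {\<sigma> i..\<tau> (Suc i)} \<Longrightarrow> 0 \<le> a r"
    unfolding m by (rule gaps_and_bumps) blast
  have near_1: "\<exists>s. 0 \<le> s \<and> s < 1 \<and> (\<forall>r\<in>{s..1}. a r \<le> 0)"
    using st(2) st(3)[of m] st(5)[of m] by (intro exI[of _ "\<tau> m"]) auto
  obtain \<mu>0 where \<mu>0: "0 < \<mu>0" "\<forall>\<mu>>\<mu>0. \<exists>C. card C = 2 ^ m \<and> (\<forall>c\<in>C. 0 < c \<and> boundary_blowup \<mu> c)"
    using positive_blowup_parameters[of \<tau> \<sigma> m] st by blast
  show ?thesis
  proof (intro exI[of _ \<mu>0] conjI allI impI)
    fix \<mu> assume \<mu>: "\<mu>0 < \<mu>"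
    then have \<mu>_pos: "0 < \<mu>" using \<mu>0 by simp
    obtain C where C: "card C = 2 ^ m" "\<And>c. c \<in> C \<Longrightarrow> 0 < c" "\<And>c. c \<in> C \<Longrightarrow> boundary_blowup \<mu> c"
      using \<mu>0 \<mu> by blast
    define U where "U c x = so \<mu> c (norm x)" for c and x :: "real ^ 'n"
    \<comment> \<open>The value at the centre recovers the parameter, so distinct parameters give
      solutions that differ inside the ball.\<close>
    have U0: "U c 0 = c" for c by (simp add: U_def power_ivp.sol_0[OF power_ivp])
    have "inj_on U C" by (rule inj_onI) (metis U0)
    then have "card (U ` C) = 2 ^ m" using C by (simp add: card_image)
    moreover have "positive_radial_solution a p \<mu> u" if "u \<in> U ` C" for u
      using that positive_radial_solution_sol[OF \<mu>_pos C(2) C(3) near_1 n] by (auto simp: U_def [abs_def])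
    moreover have "pairwise (\<lambda>u w. \<exists>x\<in>ball 0 1. u x \<noteq> w x) (U ` C)"
      unfolding pairwise_def by (metis U0 centre_in_ball imageE zero_less_one)
    ultimately show "\<exists>U :: (real ^ 'n \<Rightarrow> real) set. card U = 2 ^ m \<and>
        (\<forall>u\<in>U. positive_radial_solution a p \<mu> u) \<and> pairwise (\<lambda>u w. \<exists>x\<in>ball 0 1. u x \<noteq> w x) U"
      by (intro exI[of _ "U ` C"]) auto
  qed (use \<mu>0 in auto)
qed

end
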